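(* Let $k$ be an algebraically closed field of characteristic $0$, and let $X \subset \mathbb{A}_k^n$ be an irreducible affine variety. The Lie algebra $\mathcal{D}_X$ of polynomial vector fields on $X$ is simple if and only if $X$ is a smooth variety.
   Context: Let $I\subset k[x_1,\ldots,x_n]$ be the (prime) ideal of all polynomials vanishing on $X$, and let $A = k[x_1,\ldots,x_n]/I$ be the algebra of polynomial functions on $X$. The Lie algebra of polynomial vector fields on $X$ is $\mathcal{D}_X = \mathrm{Der}_k(A)$, the Lie algebra over $k$ of $k$-linear derivations of $A$ with the commutator bracket. The variety $X$ is smooth if it has no singular points, where, for generators $f_1,\ldots,f_m$ of $I$, a point $P\in X$ is singular if the rank over $k$ of the Jacobian matrix $(\partial f_i/\partial x_j)(P)$ is less than the rank of $(\partial f_i/\partial x_j)$ over the field of fractions of $A$.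
   Formalization: The variety X is additionally assumed not to be a single point: for a point, the Lie algebra D_X is zero, hence not simple (simple meaning non-abelian), although a point is a smooth variety. *)

theory Defs
  imports
    "HOL-Library.Poly_Mapping"
    "HOL-Computational_Algebra.Polynomial"
    "HOL-Algebra.Module"
    "HOL-Algebra.QuotRing"
    "HOL-Decision_Procs.Algebra_Aux"
    "HOL-Analysis.Finite_Cartesian_Product"
begin

section \<open>Lie algebras\<close>

text \<open>
  A Lie algebra over \<open>K\<close> is represented by a \<open>module\<close> record whose \<open>mult\<close> field is the bracket;
  the \<open>one\<close> field is not used.
\<close>

locale lie_algebra = K?: field K + L?: module K L for K (structure) and L (structure) +
  assumes bracket_closed:
      "\<lbrakk>x \<in> carrier L; y \<in> carrier L\<rbrakk> \<Longrightarrow> x \<otimes>\<^bsub>L\<^esub> y \<in> carrier L"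
    and bracket_add_left:
      "\<lbrakk>x \<in> carrier L; y \<in> carrier L; z \<in> carrier L\<rbrakk> \<Longrightarrow>
        (x \<oplus>\<^bsub>L\<^esub> y) \<otimes>\<^bsub>L\<^esub> z = x \<otimes>\<^bsub>L\<^esub> z \<oplus>\<^bsub>L\<^esub> y \<otimes>\<^bsub>L\<^esub> z"
    and bracket_add_right:
      "\<lbrakk>x \<in> carrier L; y \<in> carrier L; z \<in> carrier L\<rbrakk> \<Longrightarrow>
        x \<otimes>\<^bsub>L\<^esub> (y \<oplus>\<^bsub>L\<^esub> z) = x \<otimes>\<^bsub>L\<^esub> y \<oplus>\<^bsub>L\<^esub> x \<otimes>\<^bsub>L\<^esub> z"
    and bracket_smult_left:
      "\<lbrakk>c \<in> carrier K; x \<in> carrier L; y \<in> carrier L\<rbrakk> \<Longrightarrow>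
        (c \<odot>\<^bsub>L\<^esub> x) \<otimes>\<^bsub>L\<^esub> y = c \<odot>\<^bsub>L\<^esub> (x \<otimes>\<^bsub>L\<^esub> y)"
    and bracket_smult_right:
      "\<lbrakk>c \<in> carrier K; x \<in> carrier L; y \<in> carrier L\<rbrakk> \<Longrightarrow>
        x \<otimes>\<^bsub>L\<^esub> (c \<odot>\<^bsub>L\<^esub> y) = c \<odot>\<^bsub>L\<^esub> (x \<otimes>\<^bsub>L\<^esub> y)"
    and bracket_self: "x \<in> carrier L \<Longrightarrow> x \<otimes>\<^bsub>L\<^esub> x = \<zero>\<^bsub>L\<^esub>"
    and jacobi:
      "\<lbrakk>x \<in> carrier L; y \<in> carrier L; z \<in> carrier L\<rbrakk> \<Longrightarrow>
        x \<otimes>\<^bsub>L\<^esub> (y \<otimes>\<^bsub>L\<^esub> z) \<oplus>\<^bsub>L\<^esub> (y \<otimes>\<^bsub>L\<^esub> (z \<otimes>\<^bsub>L\<^esub> x) \<oplus>\<^bsub>L\<^esub> z \<otimes>\<^bsub>L\<^esub> (x \<otimes>\<^bsub>L\<^esub> y)) = \<zero>\<^bsub>L\<^esub>"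

definition lie_ideal :: "'b set \<Rightarrow> ('a, 'c) ring_scheme \<Rightarrow> ('a, 'b, 'd) module_scheme \<Rightarrow> bool" where
  "lie_ideal J K L \<longleftrightarrow> submodule J K L \<and> (\<forall>x\<in>carrier L. \<forall>y\<in>J. x \<otimes>\<^bsub>L\<^esub> y \<in> J)"

text \<open>Simple Lie algebras are non-abelian, in particular nonzero.\<close>

definition simple_lie_algebra :: "('a, 'c) ring_scheme \<Rightarrow> ('a, 'b, 'd) module_scheme \<Rightarrow> bool" where
  "simple_lie_algebra K L \<longleftrightarrow>
     lie_algebra K L \<and>
     (\<exists>x\<in>carrier L. \<exists>y\<in>carrier L. x \<otimes>\<^bsub>L\<^esub> y \<noteq> \<zero>\<^bsub>L\<^esub>) \<and>
     (\<forall>J. lie_ideal J K L \<longrightarrow> J = {\<zero>\<^bsub>L\<^esub>} \<or> J = carrier L)"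

text \<open>
  Derivations are \<open>undefined\<close> outside the carrier, so that equality of derivations is
  equality of functions.
\<close>

definition derivations :: "('a, 'c) ring_scheme \<Rightarrow> ('a, 'b, 'd) module_scheme \<Rightarrow> ('b \<Rightarrow> 'b) set" where
  "derivations K A =
     {D \<in> carrier A \<rightarrow>\<^sub>E carrier A.
        (\<forall>a\<in>carrier A. \<forall>b\<in>carrier A. D (a \<oplus>\<^bsub>A\<^esub> b) = D a \<oplus>\<^bsub>A\<^esub> D b) \<and>
        (\<forall>c\<in>carrier K. \<forall>a\<in>carrier A. D (c \<odot>\<^bsub>A\<^esub> a) = c \<odot>\<^bsub>A\<^esub> D a) \<and>
        (\<forall>a\<in>carrier A. \<forall>b\<in>carrier A. D (a \<otimes>\<^bsub>A\<^esub> b) = D a \<otimes>\<^bsub>A\<^esub> b \<oplus>\<^bsub>A\<^esub> a \<otimes>\<^bsub>A\<^esub> D b)}"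

definition Der :: "('a, 'c) ring_scheme \<Rightarrow> ('a, 'b, 'd) module_scheme \<Rightarrow> ('a, 'b \<Rightarrow> 'b) module" where
  "Der K A =
     \<lparr>carrier = derivations K A,
      mult = (\<lambda>D E. \<lambda>a\<in>carrier A. D (E a) \<ominus>\<^bsub>A\<^esub> E (D a)),
      one = undefined,
      ring.zero = (\<lambda>a\<in>carrier A. \<zero>\<^bsub>A\<^esub>),
      add = (\<lambda>D E. \<lambda>a\<in>carrier A. D a \<oplus>\<^bsub>A\<^esub> E a),
      module.smult = (\<lambda>c D. \<lambda>a\<in>carrier A. c \<odot>\<^bsub>A\<^esub> D a)\<rparr>"

section \<open>Field of fractions and rank\<close>

definition frac_rel :: "('a, 'b) ring_scheme \<Rightarrow> (('a \<times> 'a) \<times> ('a \<times> 'a)) set" where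
  "frac_rel R =
     {((a, b), (c, d)). a \<in> carrier R \<and> b \<in> carrier R - {\<zero>\<^bsub>R\<^esub>} \<and>
        c \<in> carrier R \<and> d \<in> carrier R - {\<zero>\<^bsub>R\<^esub>} \<and> a \<otimes>\<^bsub>R\<^esub> d = c \<otimes>\<^bsub>R\<^esub> b}"

definition fraction :: "('a, 'b) ring_scheme \<Rightarrow> 'a \<Rightarrow> 'a \<Rightarrow> ('a \<times> 'a) set" where
  "fraction R a b = frac_rel R `` {(a, b)}"

text \<open>
  For a domain \<open>R\<close>. The operations take the union over all representatives; all the classes in
  the union coincide.
\<close>

definition frac_field :: "('a, 'b) ring_scheme \<Rightarrow> ('a \<times> 'a) set ring" where
  "frac_field R =
     \<lparr>carrier = (carrier R \<times> (carrier R - {\<zero>\<^bsub>R\<^esub>})) // frac_rel R,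
      mult = (\<lambda>p q. \<Union>(a, b)\<in>p. \<Union>(c, d)\<in>q. fraction R (a \<otimes>\<^bsub>R\<^esub> c) (b \<otimes>\<^bsub>R\<^esub> d)),
      one = fraction R \<one>\<^bsub>R\<^esub> \<one>\<^bsub>R\<^esub>,
      ring.zero = fraction R \<zero>\<^bsub>R\<^esub> \<one>\<^bsub>R\<^esub>,
      add = (\<lambda>p q. \<Union>(a, b)\<in>p. \<Union>(c, d)\<in>q.
               fraction R (a \<otimes>\<^bsub>R\<^esub> d \<oplus>\<^bsub>R\<^esub> c \<otimes>\<^bsub>R\<^esub> b) (b \<otimes>\<^bsub>R\<^esub> d))\<rparr>"

definition lin_indep_rows :: "('a, 'b) ring_scheme \<Rightarrow> nat set \<Rightarrow> (nat \<Rightarrow> 'n \<Rightarrow> 'a) \<Rightarrow> bool" where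
  "lin_indep_rows F S M \<longleftrightarrow>
     (\<forall>c \<in> S \<rightarrow> carrier F.
        (\<forall>j. (\<Oplus>\<^bsub>F\<^esub>i\<in>S. c i \<otimes>\<^bsub>F\<^esub> M i j) = \<zero>\<^bsub>F\<^esub>) \<longrightarrow> (\<forall>i\<in>S. c i = \<zero>\<^bsub>F\<^esub>))"

text \<open>The rank over the field \<open>F\<close> of the matrix with rows \<open>M 0, \<dots>, M (m - 1)\<close>.\<close>

definition matrix_rank :: "('a, 'b) ring_scheme \<Rightarrow> nat \<Rightarrow> (nat \<Rightarrow> 'n \<Rightarrow> 'a) \<Rightarrow> nat" where
  "matrix_rank F m M = Max {card S |S. S \<subseteq> {..<m} \<and> lin_indep_rows F S M}"

section \<open>Affine varieties\<close>

text \<open>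
  Polynomials in variables indexed by the finite type \<open>'n\<close> are finitely supported maps from
  exponents to coefficients; their product is the convolution product.
\<close>

type_synonym ('n, 'k) mpoly = "('n \<Rightarrow>\<^sub>0 nat) \<Rightarrow>\<^sub>0 'k"

definition mpoly_eval :: "'k::comm_ring_1 ^ 'n::finite \<Rightarrow> ('n, 'k) mpoly \<Rightarrow> 'k" where
  "mpoly_eval P f =
     (\<Sum>\<alpha>\<in>Poly_Mapping.keys f. Poly_Mapping.lookup f \<alpha> * (\<Prod>i\<in>UNIV. (P $ i) ^ Poly_Mapping.lookup \<alpha> i))"

definition mpoly_partial :: "'n \<Rightarrow> ('n, 'k::comm_ring_1) mpoly \<Rightarrow> ('n, 'k) mpoly" where
  "mpoly_partial j f =
     (\<Sum>\<alpha>\<in>Poly_Mapping.keys f. Poly_Mapping.single (\<alpha> - Poly_Mapping.single j 1) (of_nat (Poly_Mapping.lookup \<alpha> j) * Poly_Mapping.lookup f \<alpha>))"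

definition zero_locus :: "('n, 'k) mpoly set \<Rightarrow> ('k::comm_ring_1 ^ 'n::finite) set" where
  "zero_locus S = {P. \<forall>f\<in>S. mpoly_eval P f = 0}"

definition zariski_closed :: "('k::comm_ring_1 ^ 'n::finite) set \<Rightarrow> bool" where
  "zariski_closed X \<longleftrightarrow> (\<exists>S. X = zero_locus S)"

definition irreducible_affine_variety :: "('k::field ^ 'n::finite) set \<Rightarrow> bool" where
  "irreducible_affine_variety X \<longleftrightarrow>
     zariski_closed X \<and> X \<noteq> {} \<and>
     (\<forall>Y Z. zariski_closed Y \<and> zariski_closed Z \<and> X = Y \<union> Z \<longrightarrow> X = Y \<or> X = Z)"

abbreviation mpoly_ring :: "('n, 'k::comm_ring_1) mpoly ring" where
  "mpoly_ring \<equiv> cring_class_ops"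

definition vanishing_ideal :: "('k::comm_ring_1 ^ 'n::finite) set \<Rightarrow> ('n, 'k) mpoly set" where
  "vanishing_ideal X = {f. \<forall>P\<in>X. mpoly_eval P f = 0}"

definition residue_class :: "('k::comm_ring_1 ^ 'n::finite) set \<Rightarrow> ('n, 'k) mpoly \<Rightarrow> ('n, 'k) mpoly set" where
  "residue_class X f = vanishing_ideal X +>\<^bsub>mpoly_ring\<^esub> f"

text \<open>The algebra \<open>A\<close> of polynomial functions on \<open>X\<close>; a scalar acts as its constant polynomial.\<close>

definition coordinate_algebra :: "('k::comm_ring_1 ^ 'n::finite) set \<Rightarrow> ('k, ('n, 'k) mpoly set) module" where
  "coordinate_algebra X = (let A = mpoly_ring Quot vanishing_ideal X in
     \<lparr>carrier = carrier A, mult = mult A, one = one A, ring.zero = ring.zero A, add = add A,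
      module.smult = (\<lambda>c a. residue_class X (Poly_Mapping.single 0 c) \<otimes>\<^bsub>A\<^esub> a)\<rparr>)"

definition polynomial_vector_fields ::
  "('k::comm_ring_1 ^ 'n::finite) set \<Rightarrow> ('k, ('n, 'k) mpoly set \<Rightarrow> ('n, 'k) mpoly set) module" where
  "polynomial_vector_fields X = Der cring_class_ops (coordinate_algebra X)"

definition jacobian_rank_at :: "('n, 'k) mpoly list \<Rightarrow> 'k::field ^ 'n::finite \<Rightarrow> nat" where
  "jacobian_rank_at fs P =
     matrix_rank cring_class_ops (length fs) (\<lambda>i j. mpoly_eval P (mpoly_partial j (fs ! i)))"

definition generic_jacobian_rank :: "('n, 'k) mpoly list \<Rightarrow> ('k::field ^ 'n::finite) set \<Rightarrow> nat" where
  "generic_jacobian_rank fs X =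
     matrix_rank (frac_field (coordinate_algebra X)) (length fs)
       (\<lambda>i j. fraction (coordinate_algebra X)
                (residue_class X (mpoly_partial j (fs ! i))) \<one>\<^bsub>coordinate_algebra X\<^esub>)"

text \<open>
  Singularity does not depend on the choice of the finite generating family \<open>fs\<close>, and such a
  family exists by Hilbert's basis theorem.
\<close>

definition singular_point :: "('k::field ^ 'n::finite) set \<Rightarrow> 'k ^ 'n \<Rightarrow> bool" where
  "singular_point X P \<longleftrightarrow>
     P \<in> X \<and>
     (\<exists>fs. Idl\<^bsub>mpoly_ring\<^esub> (set fs) = vanishing_ideal X \<and>
           jacobian_rank_at fs P < generic_jacobian_rank fs X)"

definition smooth_variety :: "('k::field ^ 'n::finite) set \<Rightarrow> bool" where
  "smooth_variety X \<longleftrightarrow> (\<nexists>P. singular_point X P)"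

end

theory Submission
  imports Defs "Jordan_Normal_Form.Determinant"
begin

text \<open>
  Both properties are compared with the absence of nontrivial ideals of \<open>A\<close> stable under all
  derivations.

  If \<open>A\<close> has no such ideal, then a nonzero Lie ideal \<open>W\<close> is everything (Jordan): the elements \<open>a\<close>
  with \<open>a D \<subseteq> W\<close> form a stable ideal, and bracket computations show that it contains
  \<open>2 w(w f) w(g)\<close> for all \<open>w \<in> W\<close>, which is not always zero. Conversely, if \<open>K\<close> is a proper nonzero stable
  ideal, then for each \<open>s\<close> the derivations with image in \<open>K^s\<close> form a nonzero Lie ideal; were they
  all of \<open>D\<close>, Krull's intersection theorem would give \<open>D = 0\<close>.

  At a singular point the ideal of minors of the Jacobian matrix of generic size is proper and
  nonzero, and it is stable. If \<open>X\<close> is smooth, a proper stable ideal \<open>Q\<close> vanishes at some point \<open>P\<close> by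
  the Nullstellensatz. A minor \<open>h\<close> of generic size with \<open>h(P) \<noteq> 0\<close> gives derivations \<open>E_j\<close> with
  \<open>E_j x_l = h \<delta>_jl\<close> on the complementary coordinates, and the vector field \<open>\<Theta> = \<Sum>j. (x_j - P_j) E_j\<close> acts on
  \<open>m^s / m^(s+1)\<close> as multiplication by \<open>s h\<close>. Since \<open>\<Theta> f \<in> m Q\<close> for \<open>f \<in> Q\<close>, induction yields
  \<open>Q \<subseteq> m^s\<close> for all \<open>s\<close>, so \<open>Q = 0\<close> by Krull's theorem.
\<close>

section \<open>Polynomials in finitely many variables\<close>

text \<open>The argument stays in the polynomial ring. An ideal of \<open>A\<close> is an ideal
  containing \<open>I\<close>, the powers of an ideal \<open>K\<close> of \<open>A\<close> become
  the ideals \<open>I + K^s\<close>, and a derivation of \<open>A\<close> becomes a derivation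
  preserving \<open>I\<close>, two of them being identified when their difference takes values in
  \<open>I\<close>. Such lifts exist because a derivation of the polynomial ring may take arbitrary
  values on the variables. Quotients and fractions enter only when this is translated into the given
  definitions. Krull's theorem is applied to the ideal of a point, but also to the ideal of minors,
  which is proper without being maximal in general. It is therefore proved for every proper ideal
  containing a prime \<open>I\<close>: Nakayama's lemma yields only an element \<open>w\<close>
  congruent to 1 with \<open>w Q \<subseteq> I\<close>, and primality of \<open>I\<close> removes
  \<open>w\<close>. The factor \<open>h\<close> in \<open>E_j\<close> and \<Theta> is the price for
  not localizing at \<open>h\<close>. It is harmless, since an element that does not vanish at
  \<open>P\<close> can be cancelled between consecutive steps of the filtration.\<close>

definition mpoly_var :: "'n \<Rightarrow> ('n, 'k::comm_ring_1) mpoly" where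
  "mpoly_var i = Poly_Mapping.single (Poly_Mapping.single i 1) 1"

definition mpoly_const :: "'k \<Rightarrow> ('n, 'k::comm_ring_1) mpoly" where
  "mpoly_const c = Poly_Mapping.single 0 c"

lemma poly_mapping_single_induct [case_names single add]:
  fixes f :: "'a \<Rightarrow>\<^sub>0 'b::comm_monoid_add"
  assumes single: "\<And>a c. R (Poly_Mapping.single a c)"
    and add: "\<And>f g. R f \<Longrightarrow> R g \<Longrightarrow> R (f + g)"
  shows "R f"
proof (induct f rule: Poly_Mapping.update_induct)
  case const
  show ?case using single[of undefined 0] by simp
next
  case (update f a b)
  have "Poly_Mapping.update a b f = f + Poly_Mapping.single a b"
    using update(1)
    by (intro poly_mapping_eqI)
      (auto simp: Poly_Mapping.lookup_update lookup_add lookup_single in_keys_iff when_def)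
  then show ?case using add[OF update(3) single] by simp
qed

lemma mpoly_induct [case_names const var add mult]:
  fixes f :: "('n, 'k::comm_ring_1) mpoly"
  assumes const: "\<And>c. R (mpoly_const c)"
    and var: "\<And>i. R (mpoly_var i)"
    and add: "\<And>f g. R f \<Longrightarrow> R g \<Longrightarrow> R (f + g)"
    and mult: "\<And>f g. R f \<Longrightarrow> R g \<Longrightarrow> R (f * g)"
  shows "R f"
proof (induct f rule: poly_mapping_single_induct)
  case (single a c)
  show ?case
  \<comment> \<open>An exponent is itself a finitely supported map, so the same induction principle
    splits the monomial into powers of single variables.\<close>
  proof (induct a arbitrary: c rule: poly_mapping_single_induct)
    case (single i n)
    show ?case
    proof (induct n)
      case 0
      show ?case using const[of c] by (simp add: mpoly_const_def)
    next
      case (Suc n)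
      have "Poly_Mapping.single i (Suc n) = Poly_Mapping.single i 1 + Poly_Mapping.single i n"
        by (simp flip: single_add)
      then have "Poly_Mapping.single (Poly_Mapping.single i (Suc n)) c
        = mpoly_var i * Poly_Mapping.single (Poly_Mapping.single i n) c"
        by (simp add: mpoly_var_def mult_single)
      then show ?case using mult[OF var Suc] by simp
    qed
  next
    case (add a b)
    have "Poly_Mapping.single (a + b) c = Poly_Mapping.single a c * Poly_Mapping.single b 1"
      by (simp add: mult_single)
    then show ?case using mult[OF add] by simp
  qed
next
  case (add f g)
  then show ?case by (rule assms(3))
qed

section \<open>Evaluation at a point and formal partial derivatives\<close>

lemma mpoly_eval_single:
  "mpoly_eval P (Poly_Mapping.single a c) = c * (\<Prod>i\<in>UNIV. (vec_nth P i) ^ Poly_Mapping.lookup a i)"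
  by (cases "c = 0") (simp_all add: mpoly_eval_def)

lemma mpoly_eval_add [simp]: "mpoly_eval P (f + g) = mpoly_eval P f + mpoly_eval P g"
  unfolding mpoly_eval_def
  by (rule setsum_keys_plus_distrib[where f = "\<lambda>\<alpha> v. v * (\<Prod>i\<in>UNIV. (vec_nth P i) ^ Poly_Mapping.lookup \<alpha> i)"])
    (simp_all add: distrib_right)

lemma mpoly_eval_mult [simp]: "mpoly_eval P (f * g) = mpoly_eval P f * mpoly_eval P g"
proof (induct f rule: poly_mapping_single_induct)
  case (single a c)
  show ?case
  proof (induct g rule: poly_mapping_single_induct)
    case (single b d)
    show ?case
      by (simp add: mult_single mpoly_eval_single lookup_add power_add prod.distrib mult_ac)
  qed (simp add: distrib_left)
qed (simp add: distrib_right)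

lemma mpoly_eval_const [simp]: "mpoly_eval P (mpoly_const c) = c"
  by (simp add: mpoly_const_def mpoly_eval_single)

lemma mpoly_eval_var [simp]: "mpoly_eval P (mpoly_var i) = vec_nth P i"
proof -
  have "(\<Prod>j\<in>UNIV. vec_nth P j ^ Poly_Mapping.lookup (Poly_Mapping.single i (1::nat)) j)
     = (\<Prod>j\<in>UNIV. if j = i then vec_nth P j else 1)"
    by (intro prod.cong) (auto simp: lookup_single when_def)
  then show ?thesis by (simp add: mpoly_var_def mpoly_eval_single)
qed

lemma mpoly_const_0 [simp]: "mpoly_const 0 = 0"
  and mpoly_const_1 [simp]: "mpoly_const 1 = 1"
  and mpoly_const_add: "mpoly_const (a + b) = mpoly_const a + mpoly_const b"
  and mpoly_const_diff: "mpoly_const (a - b) = mpoly_const a - mpoly_const b"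
  and mpoly_const_mult: "mpoly_const (a * b) = mpoly_const a * mpoly_const b"
  by (simp_all add: mpoly_const_def single_add single_diff mult_single)

lemma mpoly_eval_0 [simp]: "mpoly_eval P 0 = 0"
  using mpoly_eval_const[of P 0] by simp

lemma mpoly_eval_1 [simp]: "mpoly_eval P 1 = 1"
  using mpoly_eval_const[of P 1] by simp

lemma mpoly_eval_uminus [simp]: "mpoly_eval P (- f) = - mpoly_eval P f"
proof -
  have "mpoly_eval P (- f) + mpoly_eval P f = 0"
    by (simp flip: mpoly_eval_add)
  then show ?thesis by (simp add: eq_neg_iff_add_eq_0)
qed

lemma mpoly_eval_diff [simp]: "mpoly_eval P (f - g) = mpoly_eval P f - mpoly_eval P g"
  using mpoly_eval_add[of P f "- g"] by simp

lemma mpoly_eval_sum: "mpoly_eval P (sum f A) = (\<Sum>x\<in>A. mpoly_eval P (f x))"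
  by (induct A rule: infinite_finite_induct) simp_all

lemma mpoly_eval_power [simp]: "mpoly_eval P (f ^ n) = mpoly_eval P f ^ n"
  by (induct n) simp_all

lemma mpoly_partial_single:
  "mpoly_partial j (Poly_Mapping.single a c) =
    Poly_Mapping.single (a - Poly_Mapping.single j 1) (of_nat (Poly_Mapping.lookup a j) * c)"
  by (cases "c = 0") (simp_all add: mpoly_partial_def)

lemma mpoly_partial_add: "mpoly_partial j (f + g) = mpoly_partial j f + mpoly_partial j g"
  unfolding mpoly_partial_def
  by (rule setsum_keys_plus_distrib[where f = "\<lambda>\<alpha> v. Poly_Mapping.single (\<alpha> - Poly_Mapping.single j 1) (of_nat (Poly_Mapping.lookup \<alpha> j) * v)"])
    (simp_all add: distrib_left single_add)

text \<open>One half of the product rule for monomials. Subtraction of exponents is truncated and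
  commutes with adding \<open>b\<close> only if \<open>j\<close> occurs in \<open>a\<close>;
  otherwise the factor \<open>of_nat 0\<close> annihilates both sides.\<close>

lemma single_pred_mult:
  "Poly_Mapping.single (a + b - Poly_Mapping.single j 1) (of_nat (Poly_Mapping.lookup a j) * c)
   = Poly_Mapping.single (a - Poly_Mapping.single j (1::nat)) (of_nat (Poly_Mapping.lookup a j)) * Poly_Mapping.single b (c::'k::comm_ring_1)"
proof (cases "Poly_Mapping.lookup a j = 0")
  case False
  have "a + b - Poly_Mapping.single j 1 = a - Poly_Mapping.single j 1 + b"
    using False by (intro poly_mapping_eqI) (auto simp: lookup_add lookup_minus lookup_single when_def)
  then show ?thesis by (simp add: mult_single)
qed simp

lemma mpoly_partial_mult: "mpoly_partial j (f * g) = mpoly_partial j f * g + f * mpoly_partial j g"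
proof (induct f rule: poly_mapping_single_induct)
  case (single a c)
  show ?case
  proof (induct g rule: poly_mapping_single_induct)
    case (single b d)
    have 1: "mpoly_partial j (Poly_Mapping.single a c) = Poly_Mapping.single (a - Poly_Mapping.single j 1) (of_nat (Poly_Mapping.lookup a j)) * mpoly_const c" for a and c :: 'b
      by (simp add: mpoly_partial_single mpoly_const_def mult_single)
    have 2: "Poly_Mapping.single a c = Poly_Mapping.single a 1 * mpoly_const c" for a and c :: 'b
      by (simp add: mpoly_const_def mult_single)
    have "mpoly_partial j (Poly_Mapping.single a c * Poly_Mapping.single b d)
      = Poly_Mapping.single (a + b - Poly_Mapping.single j 1) (of_nat (Poly_Mapping.lookup a j) * (c * d))
      + Poly_Mapping.single (b + a - Poly_Mapping.single j 1) (of_nat (Poly_Mapping.lookup b j) * (d * c))"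
      by (simp add: mult_single mpoly_partial_single lookup_add distrib_right single_add add.commute[of a b] mult.commute[of c d])
    also have "\<dots> = mpoly_partial j (Poly_Mapping.single a c) * Poly_Mapping.single b d
      + Poly_Mapping.single a c * mpoly_partial j (Poly_Mapping.single b d)"
      unfolding single_pred_mult unfolding 1 by (simp add: 2[of a c] 2[of b d] 2[of b "c * d"] 2[of a "d * c"] 2[of a "c * d"] mpoly_const_mult mult_ac)
    finally show ?case .
  qed (simp add: distrib_left mpoly_partial_add algebra_simps)
qed (simp add: distrib_right mpoly_partial_add algebra_simps)

lemma mpoly_partial_const [simp]: "mpoly_partial j (mpoly_const c) = 0"
  by (simp add: mpoly_const_def mpoly_partial_single)

lemma mpoly_partial_var: "mpoly_partial j (mpoly_var i) = (if i = j then 1 else 0)"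
  by (auto simp add: mpoly_var_def mpoly_partial_single lookup_single when_def)

text \<open>The ring as a module over itself: \<open>idl.subspace\<close> means ideal and
  \<open>idl.span\<close> the ideal generated by a set, so results on modules serve as ideal
  theory.\<close>

interpretation idl: Modules.module "(*) :: 'a::comm_ring_1 \<Rightarrow> 'a \<Rightarrow> 'a"
  by unfold_locales (simp_all add: algebra_simps)

text \<open>As a simplification rule it would undo associativity and make \<open>algebra_simps\<close> diverge.\<close>

declare idl.scale_scale [simp del]

definition prime_idl :: "'a::comm_ring_1 set \<Rightarrow> bool" where
  "prime_idl Q \<longleftrightarrow> idl.subspace Q \<and> 1 \<notin> Q \<and> (\<forall>a b. a * b \<in> Q \<longrightarrow> a \<in> Q \<or> b \<in> Q)"

lemma prime_idlD:
  assumes "prime_idl Q"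
  shows "idl.subspace Q" "1 \<notin> Q" "a * b \<in> Q \<Longrightarrow> a \<in> Q \<or> b \<in> Q"
  using assms by (auto simp: prime_idl_def)

lemma prime_idl_power: "prime_idl Q \<Longrightarrow> a ^ n \<in> Q \<Longrightarrow> a \<in> Q"
  by (induct n) (auto simp: prime_idl_def)

lemma idl_mult_right: "idl.subspace Q \<Longrightarrow> x \<in> Q \<Longrightarrow> x * a \<in> Q"
  by (metis idl.subspace_scale mult.commute)

section \<open>Subrings, adjunction of one element, polynomials in some of the variables\<close>

definition cls_subring :: "'a::comm_ring_1 set \<Rightarrow> bool" where
  "cls_subring B \<longleftrightarrow> 1 \<in> B \<and> (\<forall>x\<in>B. \<forall>y\<in>B. x - y \<in> B \<and> x * y \<in> B)"

lemma cls_subringD: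
  assumes "cls_subring B"
  shows "0 \<in> B" "1 \<in> B" "x \<in> B \<Longrightarrow> y \<in> B \<Longrightarrow> x + y \<in> B" "x \<in> B \<Longrightarrow> y \<in> B \<Longrightarrow> x - y \<in> B"
    "x \<in> B \<Longrightarrow> y \<in> B \<Longrightarrow> x * y \<in> B" "x \<in> B \<Longrightarrow> - x \<in> B"
proof -
  have s: "1 \<in> B" "x \<in> B \<Longrightarrow> y \<in> B \<Longrightarrow> x - y \<in> B" "x \<in> B \<Longrightarrow> y \<in> B \<Longrightarrow> x * y \<in> B" for x y
    using assms by (auto simp: cls_subring_def)
  show 0: "0 \<in> B" using s(2)[of 1 1] s(1) by simp
  show n: "- x \<in> B" if "x \<in> B" for x using s(2)[of 0 x] 0 that by simp
  show "x + y \<in> B" if "x \<in> B" "y \<in> B" using s(2)[of x "- y"] n that by simp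
qed (use assms in \<open>auto simp: cls_subring_def\<close>)

lemma cls_subring_sum: "cls_subring B \<Longrightarrow> (\<And>x. x \<in> A \<Longrightarrow> f x \<in> B) \<Longrightarrow> sum f A \<in> B"
  by (induct A rule: infinite_finite_induct) (auto simp: cls_subringD)

lemma cls_subring_power: "cls_subring B \<Longrightarrow> x \<in> B \<Longrightarrow> x ^ n \<in> B"
  by (induct n) (auto simp: cls_subringD)

definition polys_over :: "'a::comm_ring_1 set \<Rightarrow> 'a poly set" where
  "polys_over B = {F. \<forall>i. coeff F i \<in> B}"

lemma polys_over_coeff: "F \<in> polys_over B \<Longrightarrow> coeff F i \<in> B"
  by (simp add: polys_over_def)

lemma polys_over_closed:
  assumes B: "cls_subring B"
  shows "0 \<in> polys_over B" "1 \<in> polys_over B"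
    "F \<in> polys_over B \<Longrightarrow> G \<in> polys_over B \<Longrightarrow> F + G \<in> polys_over B"
    "F \<in> polys_over B \<Longrightarrow> G \<in> polys_over B \<Longrightarrow> F - G \<in> polys_over B"
    "F \<in> polys_over B \<Longrightarrow> G \<in> polys_over B \<Longrightarrow> F * G \<in> polys_over B"
    "c \<in> B \<Longrightarrow> F \<in> polys_over B \<Longrightarrow> Polynomial.smult c F \<in> polys_over B"
    "c \<in> B \<Longrightarrow> Polynomial.monom c n \<in> polys_over B"
    "c \<in> B \<Longrightarrow> [:c:] \<in> polys_over B"
  using B by (auto simp: polys_over_def cls_subringD coeff_mult coeff_pCons split: nat.split
      intro!: cls_subring_sum)

text \<open>The ring \<open>B[y]\<close> inside the ambient ring. Here \<open>y\<close> may be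
  algebraic over \<open>B\<close>, so the polynomial representing an element is not unique.\<close>

definition adjoin :: "'a::comm_ring_1 set \<Rightarrow> 'a \<Rightarrow> 'a set" where
  "adjoin B y = (\<lambda>F. poly F y) ` polys_over B"

lemma cls_subring_adjoin:
  assumes B: "cls_subring B"
  shows "cls_subring (adjoin B y)"
  unfolding cls_subring_def adjoin_def
proof safe
  show "1 \<in> (\<lambda>F. poly F y) ` polys_over B"
    by (rule image_eqI[of _ _ 1]) (simp_all add: polys_over_closed[OF B])
next
  fix F G assume *: "F \<in> polys_over B" "G \<in> polys_over B"
  show "poly F y - poly G y \<in> (\<lambda>F. poly F y) ` polys_over B"
    by (rule image_eqI[of _ _ "F - G"]) (simp_all add: * polys_over_closed[OF B])
  show "poly F y * poly G y \<in> (\<lambda>F. poly F y) ` polys_over B"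
    by (rule image_eqI[of _ _ "F * G"]) (simp_all add: * polys_over_closed[OF B])
qed

text \<open>Polynomial rings in fewer variables are kept as subrings of one fixed ring, so that
  inductions on the number of variables stay within one type.\<close>

definition vars_in :: "'n set \<Rightarrow> ('n, 'k::comm_ring_1) mpoly set" where
  "vars_in V = {f. \<forall>\<alpha>\<in>Poly_Mapping.keys f. \<forall>i. i \<notin> V \<longrightarrow> Poly_Mapping.lookup \<alpha> i = 0}"

lemma vars_in_UNIV: "vars_in UNIV = UNIV"
  by (simp add: vars_in_def)

lemma vars_in_empty: "vars_in {} = range mpoly_const"
proof (intro equalityI subsetI)
  fix f :: "('a, 'b) mpoly" assume f: "f \<in> vars_in {}"
  have "\<alpha> = 0" if "\<alpha> \<in> Poly_Mapping.keys f" for \<alpha>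
    using f that by (intro poly_mapping_eqI) (auto simp: vars_in_def)
  then have "f = mpoly_const (Poly_Mapping.lookup f 0)"
    unfolding mpoly_const_def
    by (intro poly_mapping_eqI) (auto simp: lookup_single when_def in_keys_iff)
  then show "f \<in> range mpoly_const" by blast
qed (auto simp: vars_in_def mpoly_const_def split: if_splits)

lemma cls_subring_vars_in: "cls_subring (vars_in V)"
  unfolding cls_subring_def
proof (intro conjI ballI)
  fix f g :: "('a, 'b) mpoly" assume fg: "f \<in> vars_in V" "g \<in> vars_in V"
  show "f - g \<in> vars_in V"
    using fg keys_add[of f "- g"] by (auto simp: vars_in_def in_keys_iff lookup_minus)
  show "f * g \<in> vars_in V"
    using fg keys_mult[of f g] by (fastforce simp: vars_in_def lookup_add)
qed (auto simp: vars_in_def)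

lemma single_vars_in: "(\<And>i. i \<notin> V \<Longrightarrow> Poly_Mapping.lookup a i = 0) \<Longrightarrow> Poly_Mapping.single a c \<in> vars_in V"
  by (auto simp: vars_in_def split: if_splits)

lemma vars_in_mono: "V \<subseteq> W \<Longrightarrow> vars_in V \<subseteq> vars_in W"
  by (auto simp: vars_in_def)

lemma poly_mapping_eq_sum_single: "f = (\<Sum>a\<in>Poly_Mapping.keys f. Poly_Mapping.single a (Poly_Mapping.lookup f a))"
  by (intro poly_mapping_eqI) (auto simp: lookup_sum lookup_single when_def in_keys_iff sum.If_cases)

text \<open>The induction step on variables, shared by the basis theorem and the Nullstellensatz:
  \<open>k[V, y] = k[V][y]\<close>.\<close>

lemma vars_in_insert: "vars_in (insert y V) = adjoin (vars_in V) (mpoly_var y :: ('n, 'k::comm_ring_1) mpoly)"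
proof (intro equalityI subsetI)
  fix f :: "('n, 'k) mpoly" assume f: "f \<in> vars_in (insert y V)"
  have "(\<Sum>a\<in>Poly_Mapping.keys f. Poly_Mapping.single a (Poly_Mapping.lookup f a)) \<in> adjoin (vars_in V) (mpoly_var y)"
  proof (rule cls_subring_sum[OF cls_subring_adjoin[OF cls_subring_vars_in]])
    fix a assume a: "a \<in> Poly_Mapping.keys f"
    let ?c = "Poly_Mapping.lookup f a" and ?m = "Poly_Mapping.lookup a y"
    define b where "b = a - Poly_Mapping.single y ?m"
    have ab: "a = b + Poly_Mapping.single y ?m"
      by (intro poly_mapping_eqI) (auto simp: b_def lookup_add lookup_minus lookup_single when_def)
    have b: "Poly_Mapping.single b ?c \<in> vars_in V"
      using f a by (intro single_vars_in) (auto simp: b_def lookup_minus lookup_single when_def vars_in_def)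
    have pw: "mpoly_var y ^ m = Poly_Mapping.single (Poly_Mapping.single y m) (1::'k)" for m
    proof (induct m)
      case (Suc m)
      have "Poly_Mapping.single y (Suc m) = Poly_Mapping.single y 1 + Poly_Mapping.single y m"
        by (simp flip: single_add)
      then show ?case by (simp add: Suc) (simp add: mpoly_var_def mult_single)
    qed simp
    have "Poly_Mapping.single a ?c = poly (Polynomial.monom (Poly_Mapping.single b ?c) ?m) (mpoly_var y)"
      by (subst ab) (simp add: poly_monom pw mult_single)
    then show "Poly_Mapping.single a ?c \<in> adjoin (vars_in V) (mpoly_var y)"
      unfolding adjoin_def using polys_over_closed(7)[OF cls_subring_vars_in b] by blast
  qed
  then show "f \<in> adjoin (vars_in V) (mpoly_var y)"
    by (simp flip: poly_mapping_eq_sum_single)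
next
  fix f :: "('n, 'k) mpoly" assume "f \<in> adjoin (vars_in V) (mpoly_var y)"
  then obtain F where F: "F \<in> polys_over (vars_in V)" "f = poly F (mpoly_var y)"
    by (auto simp: adjoin_def)
  have y: "mpoly_var y \<in> vars_in (insert y V)"
    unfolding mpoly_var_def by (rule single_vars_in) (auto simp: lookup_single when_def)
  have "coeff F i \<in> vars_in (insert y V)" for i
    using polys_over_coeff[OF F(1), of i] vars_in_mono[of V "insert y V"] by blast
  then show "f \<in> vars_in (insert y V)"
    unfolding F(2) poly_altdef
    by (intro cls_subring_sum[OF cls_subring_vars_in] cls_subringD[OF cls_subring_vars_in]
        cls_subring_power[OF cls_subring_vars_in] y)
qed

lemma mpoly_eval_cong_vars_in:
  assumes "f \<in> vars_in V" "\<And>i. i \<in> V \<Longrightarrow> vec_nth P i = vec_nth P' i"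
  shows "mpoly_eval P f = mpoly_eval P' f"
  unfolding mpoly_eval_def
proof (intro sum.cong refl arg_cong2[where f = "(*)"] prod.cong)
  fix \<alpha> i assume "\<alpha> \<in> Poly_Mapping.keys f"
  then show "vec_nth P i ^ Poly_Mapping.lookup \<alpha> i = vec_nth P' i ^ Poly_Mapping.lookup \<alpha> i"
    using assms by (cases "i \<in> V") (auto simp: vars_in_def)
qed

section \<open>Hilbert's basis theorem\<close>

definition sub_idl :: "'a::comm_ring_1 set \<Rightarrow> 'a set \<Rightarrow> bool" where
  "sub_idl B Q \<longleftrightarrow> Q \<subseteq> B \<and> 0 \<in> Q \<and> (\<forall>x\<in>Q. \<forall>y\<in>Q. x + y \<in> Q) \<and> (\<forall>c\<in>B. \<forall>x\<in>Q. c * x \<in> Q)"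

text \<open>Generation by \<open>G\<close> is expressed through minimality among the ideals of
  \<open>B\<close>, because \<open>idl.span\<close> would admit coefficients from outside
  \<open>B\<close>.\<close>

definition noeth :: "'a::comm_ring_1 set \<Rightarrow> bool" where
  "noeth B \<longleftrightarrow> (\<forall>Q. sub_idl B Q \<longrightarrow>
     (\<exists>G. finite G \<and> G \<subseteq> Q \<and> (\<forall>Q'. sub_idl B Q' \<and> G \<subseteq> Q' \<longrightarrow> Q \<subseteq> Q')))"

lemma sub_idl_UNIV: "sub_idl UNIV Q \<longleftrightarrow> idl.subspace Q"
  by (auto simp: sub_idl_def idl.subspace_def)

lemma sub_idl_Int: "sub_idl B Q \<Longrightarrow> sub_idl B Q' \<Longrightarrow> sub_idl B (Q \<inter> Q')"
  by (auto simp: sub_idl_def)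

lemma sub_idl_diff:
  assumes "cls_subring B" "sub_idl B Q" "x \<in> Q" "y \<in> Q" shows "x - y \<in> Q"
proof -
  have "(- 1) * y \<in> Q"
    using assms cls_subringD(2,6)[OF assms(1)] unfolding sub_idl_def by blast
  then have "x + (- 1) * y \<in> Q"
    using assms unfolding sub_idl_def by blast
  then show ?thesis by simp
qed

text \<open>Hilbert's argument with leading coefficients. As representations by polynomials are not
  unique, \<open>L T d\<close> collects the coefficients at \<open>d\<close> of all polynomials over
  \<open>B\<close> of degree at most \<open>d\<close> whose value at \<open>y\<close> lies in
  \<open>T\<close>.\<close>

theorem noeth_adjoin:
  assumes B: "cls_subring B" and noeth: "noeth B"
  shows "noeth (adjoin B y)"
  unfolding noeth_def
proof (intro allI impI)
  fix Q assume Q: "sub_idl (adjoin B y) Q"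
  note By = cls_subring_adjoin[OF B, of y]
  define R where "R T d a F \<longleftrightarrow> F \<in> polys_over B \<and> (\<forall>i>d. coeff F i = 0) \<and> coeff F d = a \<and> poly F y \<in> T"
    for T d a and F :: "'a poly"
  define L where "L T d = {a. \<exists>F. R T d a F}" for T d
  have L: "sub_idl B (L T d)" if T: "sub_idl (adjoin B y) T" for T d
    unfolding sub_idl_def
  proof (intro conjI ballI subsetI)
    fix a assume "a \<in> L T d"
    then show "a \<in> B" by (auto simp: L_def R_def polys_over_coeff)
  next
    have "R T d 0 0"
      using T polys_over_closed[OF B] by (auto simp: R_def sub_idl_def)
    then show "0 \<in> L T d" by (auto simp: L_def)
  next
    fix a b assume "a \<in> L T d" "b \<in> L T d"
    then obtain F G where "R T d a F" "R T d b G" by (auto simp: L_def)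
    then have "R T d (a + b) (F + G)"
      using T polys_over_closed[OF B] by (auto simp: R_def sub_idl_def)
    then show "a + b \<in> L T d" by (auto simp: L_def)
  next
    fix c a assume c: "c \<in> B" and "a \<in> L T d"
    then obtain F where F: "R T d a F" by (auto simp: L_def)
    have "c \<in> adjoin B y"
      unfolding adjoin_def using polys_over_closed(8)[OF B c] by (intro image_eqI[of _ _ "[:c:]"]) auto
    then have "R T d (c * a) (Polynomial.smult c F)"
      using T F polys_over_closed[OF B] c by (auto simp: R_def sub_idl_def)
    then show "c * a \<in> L T d" by (auto simp: L_def)
  qed
  have shift: "L T d \<subseteq> L T (d + e)" if T: "sub_idl (adjoin B y) T" for T d e
  proof
    fix a assume "a \<in> L T d"
    then obtain F where F: "R T d a F" by (auto simp: L_def)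
    have m: "Polynomial.monom 1 e \<in> polys_over B"
      using polys_over_closed(7)[OF B cls_subringD(2)[OF B]] .
    have ye: "y ^ e \<in> adjoin B y"
      unfolding adjoin_def using m by (intro image_eqI[of _ _ "Polynomial.monom 1 e"]) (auto simp: poly_monom)
    have "R T (d + e) a (Polynomial.monom 1 e * F)"
      using F T ye polys_over_closed(5)[OF B m]
      by (auto simp: R_def coeff_monom_mult poly_monom sub_idl_def)
    then show "a \<in> L T (d + e)" by (auto simp: L_def)
  qed
  \<comment> \<open>The ideals \<open>L Q d\<close> increase with \<open>d\<close>. Finitely many
    generators of their union lie in one \<open>L Q N\<close>, after which the sequence is
    constant.\<close>
  have "sub_idl B (\<Union>d. L Q d)"
    unfolding sub_idl_def
  proof (intro conjI ballI)
    have "L Q d \<subseteq> B" "0 \<in> L Q d" for d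
      using L[OF Q, of d] by (auto simp: sub_idl_def)
    then show "(\<Union>d. L Q d) \<subseteq> B" "0 \<in> (\<Union>d. L Q d)" by blast+
  next
    fix a b assume "a \<in> (\<Union>d. L Q d)" "b \<in> (\<Union>d. L Q d)"
    then obtain d e where "a \<in> L Q d" "b \<in> L Q e" by blast
    then have "a \<in> L Q (d + e)" "b \<in> L Q (d + e)"
      using shift[OF Q, of d e] shift[OF Q, of e d] by (auto simp: add.commute)
    then show "a + b \<in> (\<Union>d. L Q d)"
      using L[OF Q, of "d + e"] by (auto simp: sub_idl_def)
  next
    fix c a assume c: "c \<in> B" and "a \<in> (\<Union>d. L Q d)"
    then obtain d where "a \<in> L Q d" by blast
    then have "c * a \<in> L Q d" using L[OF Q, of d] c by (auto simp: sub_idl_def)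
    then show "c * a \<in> (\<Union>d. L Q d)" by blast
  qed
  then obtain G0 where G0: "finite G0" "G0 \<subseteq> (\<Union>d. L Q d)"
    "\<And>T. sub_idl B T \<Longrightarrow> G0 \<subseteq> T \<Longrightarrow> (\<Union>d. L Q d) \<subseteq> T"
    using noeth unfolding noeth_def by metis
  have "\<exists>N. G0 \<subseteq> L Q N"
    using G0(1,2)
  proof (induct G0)
    case (insert g G)
    then obtain N d where "G \<subseteq> L Q N" "g \<in> L Q d" by auto
    then have "insert g G \<subseteq> L Q (N + d)"
      using shift[OF Q, of N d] shift[OF Q, of d N] by (auto simp: add.commute)
    then show ?case by blast
  qed simp
  then obtain N where N: "G0 \<subseteq> L Q N" by blast
  have LN: "L Q d \<subseteq> L Q N" for d
    using G0(3)[OF L[OF Q] N] by blast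
  have "\<exists>G. finite G \<and> G \<subseteq> L Q d \<and> (\<forall>T. sub_idl B T \<and> G \<subseteq> T \<longrightarrow> L Q d \<subseteq> T)" for d
    using noeth L[OF Q, of d] unfolding noeth_def by blast
  then obtain G where G: "\<And>d. finite (G d)" "\<And>d. G d \<subseteq> L Q d"
    "\<And>d T. sub_idl B T \<Longrightarrow> G d \<subseteq> T \<Longrightarrow> L Q d \<subseteq> T"
    by metis
  define W where "W d a = (SOME F. R Q d a F)" for d a
  have W: "R Q d a (W d a)" if "a \<in> G d" for a d
  proof -
    have "\<exists>F. R Q d a F" using that G(2)[of d] by (auto simp: L_def)
    then show ?thesis unfolding W_def by (rule someI_ex)
  qed
  define H where "H = (\<Union>d\<in>{..N}. (\<lambda>a. poly (W d a) y) ` G d)"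
  \<comment> \<open>Intersecting with \<open>Q\<close> keeps the values of the polynomials found
    below in \<open>Q\<close>, so that they may be subtracted from elements of
    \<open>Q\<close>.\<close>
  have "Q \<subseteq> T" if T0: "sub_idl (adjoin B y) T0" and HT: "H \<subseteq> T0" and T_def: "T = T0 \<inter> Q" for T T0
  proof -
    have T: "sub_idl (adjoin B y) T" unfolding T_def using T0 Q by (rule sub_idl_Int)
    have low: "L Q d \<subseteq> L T d" if "d \<le> N" for d
    proof (rule G(3)[OF L[OF T]])
      show "G d \<subseteq> L T d"
      proof
        fix a assume a: "a \<in> G d"
        then have "poly (W d a) y \<in> T"
          using HT that W[OF a] by (auto simp: H_def T_def R_def)
        then show "a \<in> L T d" using W[OF a] by (auto simp: L_def R_def)
      qed
    qed
    have LT: "L Q d \<subseteq> L T d" for d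
    proof (cases "d \<le> N")
      case False
      have "L Q d \<subseteq> L T N" using LN low[of N] by blast
      also have "\<dots> \<subseteq> L T (N + (d - N))" by (rule shift[OF T])
      finally show ?thesis using False by simp
    qed (rule low)
    \<comment> \<open>Subtracting a polynomial with value in \<open>T\<close> and the same leading
      coefficient lowers the degree bound \<open>d\<close>.\<close>
    have "poly F y \<in> T" if "F \<in> polys_over B" "\<forall>i\<ge>d. coeff F i = 0" "poly F y \<in> Q" for F d
      using that
    proof (induct d arbitrary: F)
      case 0
      then have "F = 0" by (intro poly_eqI) simp
      then show ?case using T by (simp add: sub_idl_def)
    next
      case (Suc d)
      then have "R Q d (coeff F d) F" by (simp add: R_def)
      then have "coeff F d \<in> L T d" using LT[of d] by (auto simp: L_def)
      then obtain F' where F': "R T d (coeff F d) F'" by (auto simp: L_def)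
      have "poly F' y \<in> Q" using F' by (auto simp: R_def T_def)
      then have "poly (F - F') y \<in> Q" using sub_idl_diff[OF By Q Suc(4)] by simp
      moreover have "\<forall>i\<ge>d. coeff (F - F') i = 0"
      proof (intro allI impI)
        fix i assume "d \<le> i"
        then consider "i = d" | "i > d" "i \<ge> Suc d" by linarith
        then show "coeff (F - F') i = 0"
          using F' Suc(3) by cases (simp_all add: R_def)
      qed
      ultimately have "poly (F - F') y \<in> T"
        using Suc(2) F' by (intro Suc(1) polys_over_closed(4)[OF B]) (simp_all add: R_def)
      moreover have "poly F' y \<in> T" using F' by (simp add: R_def)
      ultimately have "poly (F - F') y + poly F' y \<in> T"
        using T unfolding sub_idl_def by blast
      then show ?case by simp
    qed
    note key = this
    show "Q \<subseteq> T"
    proof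
      fix x assume x: "x \<in> Q"
      then obtain F where F: "F \<in> polys_over B" "x = poly F y"
        using Q by (auto simp: sub_idl_def adjoin_def)
      show "x \<in> T"
        using key[OF F(1), of "Suc (degree F)"] x F(2) by (auto simp: coeff_eq_0)
    qed
  qed
  moreover have "finite H" "H \<subseteq> Q"
    using G(1) W by (auto simp: H_def R_def)
  ultimately show "\<exists>G. finite G \<and> G \<subseteq> Q \<and> (\<forall>Q'. sub_idl (adjoin B y) Q' \<and> G \<subseteq> Q' \<longrightarrow> Q \<subseteq> Q')"
    by (intro exI[of _ H]) blast
qed

lemma noeth_consts: "noeth (range mpoly_const :: ('n, 'k::field) mpoly set)"
  unfolding noeth_def
proof (intro allI impI)
  fix Q :: "('n, 'k) mpoly set" assume Q: "sub_idl (range mpoly_const) Q"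
  show "\<exists>G. finite G \<and> G \<subseteq> Q \<and> (\<forall>Q'. sub_idl (range mpoly_const) Q' \<and> G \<subseteq> Q' \<longrightarrow> Q \<subseteq> Q')"
  proof (cases "Q = {0}")
    case False
    have "Q \<subseteq> range mpoly_const" "0 \<in> Q" using Q by (auto simp: sub_idl_def)
    moreover obtain x where x: "x \<in> Q" "x \<noteq> 0" using False \<open>0 \<in> Q\<close> by blast
    ultimately obtain c where "x = mpoly_const c" by auto
    then have c: "mpoly_const c \<in> Q" "c \<noteq> 0" using x by auto
    have "Q \<subseteq> Q'" if Q': "sub_idl (range mpoly_const) Q'" "mpoly_const c \<in> Q'" for Q'
    proof
      fix x assume "x \<in> Q"
      then obtain d where d: "x = mpoly_const d" using Q by (auto simp: sub_idl_def)
      have "mpoly_const (d / c) * mpoly_const c \<in> Q'"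
        using Q' by (simp add: sub_idl_def)
      then show "x \<in> Q'" using c(2) by (simp add: d flip: mpoly_const_mult)
    qed
    then show ?thesis using c by (intro exI[of _ "{mpoly_const c}"]) auto
  qed (auto simp: sub_idl_def)
qed

theorem noeth_mpoly: "noeth (UNIV :: ('n::finite, 'k::field) mpoly set)"
proof -
  have "noeth (vars_in V :: ('n, 'k) mpoly set)" if "finite V" for V
    using that
  proof induct
    case empty
    show ?case by (simp add: vars_in_empty noeth_consts)
  next
    case (insert y V)
    then show ?case by (simp add: vars_in_insert noeth_adjoin[OF cls_subring_vars_in])
  qed
  from this[of UNIV] show ?thesis by (simp add: vars_in_UNIV)
qed

lemma noeth_finitely_generated:
  assumes "noeth (UNIV :: 'a::comm_ring_1 set)" "idl.subspace (Q :: 'a set)"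
  obtains G where "finite G" "Q = idl.span G"
proof -
  obtain G where G: "finite G" "G \<subseteq> Q" "\<And>Q'. idl.subspace Q' \<Longrightarrow> G \<subseteq> Q' \<Longrightarrow> Q \<subseteq> Q'"
    using assms unfolding noeth_def sub_idl_UNIV by metis
  have "Q = idl.span G"
    using G(3)[OF idl.subspace_span idl.span_superset] idl.span_minimal[OF G(2) assms(2)] by blast
  then show ?thesis using G(1) that by blast
qed

text \<open>Zorn's lemma applies because the finitely many generators of the union of a chain
  already lie in one member, which is then the union.\<close>

lemma noeth_maximal:
  assumes noeth: "noeth (UNIV :: 'a::comm_ring_1 set)"
    and A: "A \<noteq> {}" "\<And>Q. Q \<in> A \<Longrightarrow> idl.subspace (Q :: 'a set)"
  shows "\<exists>N\<in>A. \<forall>Q\<in>A. N \<subseteq> Q \<longrightarrow> Q = N"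
proof (rule subset_Zorn_nonempty[OF A(1)])
    fix C assume C: "C \<noteq> {}" "subset.chain A C"
    then have CA: "C \<subseteq> A" and lin: "\<And>x y. x \<in> C \<Longrightarrow> y \<in> C \<Longrightarrow> x \<subseteq> y \<or> y \<subseteq> x"
      by (auto simp: subset.chain_def)
    have sub: "idl.subspace X" if "X \<in> C" for X using A(2) CA that by (meson subsetD)
    have "idl.subspace (\<Union>C)"
      unfolding idl.subspace_def
    proof (intro conjI ballI allI)
      obtain X where X: "X \<in> C" using C(1) by blast
      then have "0 \<in> X" using sub idl.subspace_0 by metis
      then show "0 \<in> \<Union>C" using X by blast
    next
      fix x y assume "x \<in> \<Union>C" "y \<in> \<Union>C"
      then obtain X Y where XY: "X \<in> C" "x \<in> X" "Y \<in> C" "y \<in> Y" by auto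
      then obtain Z where Z: "Z \<in> C" "x \<in> Z" "y \<in> Z" using lin[OF XY(1,3)] by (metis subsetD)
      then have "x + y \<in> Z" using sub idl.subspace_add by metis
      then show "x + y \<in> \<Union>C" using Z by blast
    next
      fix c x assume "x \<in> \<Union>C"
      then obtain X where X: "X \<in> C" "x \<in> X" by auto
      then have "c * x \<in> X" using sub idl.subspace_scale by metis
      then show "c * x \<in> \<Union>C" using X by blast
    qed
    then obtain G where G: "finite G" "\<Union>C = idl.span G"
      using noeth_finitely_generated[OF noeth] by blast
    have "G \<subseteq> \<Union>C" using G(2) idl.span_superset[of G] by simp
    then obtain X where X: "X \<in> C" "G \<subseteq> X"
      using finite_subset_Union_chain[OF G(1) _ C] by metis
    have "\<Union>C \<subseteq> X" unfolding G(2) using X sub by (intro idl.span_minimal)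
    then have "\<Union>C = X" using X(1) by (simp add: subset_antisym Union_upper)
    then show "\<Union>C \<in> A" using X(1) CA by auto
qed

lemma maximal_idl_prime:
  assumes M: "idl.subspace (M :: 'a::comm_ring_1 set)" "1 \<notin> M"
    and max: "\<And>Q. idl.subspace Q \<Longrightarrow> 1 \<notin> Q \<Longrightarrow> M \<subseteq> Q \<Longrightarrow> Q = M"
  shows "prime_idl M"
  unfolding prime_idl_def
proof (intro conjI allI impI M)
  fix a b assume ab: "a * b \<in> M"
  show "a \<in> M \<or> b \<in> M"
  proof (rule ccontr)
    assume c: "\<not> (a \<in> M \<or> b \<in> M)"
    have "idl.span (insert a M) \<noteq> M" using c idl.span_base[of a "insert a M"] by auto
    then have "1 \<in> idl.span (insert a M)"
      using max[of "idl.span (insert a M)"] idl.span_superset[of "insert a M"] by auto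
    then obtain x where "1 - x * a \<in> idl.span M" by (auto simp: idl.span_insert)
    moreover have "idl.span M = M" using M(1) by (rule idl.span_eq_iff[THEN iffD2])
    ultimately have m: "1 - x * a \<in> M" by simp
    have b: "b * (1 - x * a) + x * (a * b) = b" by (simp add: algebra_simps)
    have "b * (1 - x * a) + x * (a * b) \<in> M"
      by (rule idl.subspace_add[OF M(1) idl.subspace_scale[OF M(1) m] idl.subspace_scale[OF M(1) ab]])
    then have "b \<in> M" by (simp only: b)
    then show False using c by simp
  qed
qed

section \<open>Hilbert's Nullstellensatz\<close>

text \<open>Instead of dividing by the leading coefficient, each step multiplies by it. The bound on
  the degree of the quotient is recorded because it later contradicts the minimality of a
  degree.\<close>

lemma pseudo_division:
  assumes B: "cls_subring B" and R: "R \<in> polys_over B" "\<And>i. i > e \<Longrightarrow> coeff R i = 0"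
    and G: "G \<in> polys_over B" "\<And>i. i \<ge> d \<Longrightarrow> coeff G i = 0"
  shows "\<exists>N Q R'. Q \<in> polys_over B \<and> R' \<in> polys_over B \<and>
    Polynomial.smult (coeff R e ^ N) G = Q * R + R' \<and>
    (\<forall>i\<ge>e. coeff R' i = 0) \<and> (\<forall>i. i + e \<ge> d \<longrightarrow> coeff Q i = 0)"
proof -
  let ?c = "coeff R e"
  note cl = polys_over_closed[OF B]
  show ?thesis
    using G
  proof (induct d arbitrary: G)
    case 0
    then have "G = 0" by (intro poly_eqI) simp
    then show ?case using cl(1) by (intro exI[of _ 0] exI[of _ "0::'a poly"]) simp
  next
    case (Suc d)
    show ?case
    proof (cases "e \<le> d")
      case False
      then have "\<forall>i\<ge>e. coeff G i = 0" using Suc(3) by simp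
      then show ?thesis using Suc(2) cl(1)
        by (intro exI[of _ 0] exI[of _ "0::'a poly"] exI[of _ G]) simp
    next
      case True
      define M where "M = Polynomial.monom (coeff G d) (d - e)"
      have M: "M \<in> polys_over B" unfolding M_def by (intro cl(7) polys_over_coeff Suc(2))
      define G1 where "G1 = Polynomial.smult ?c G - M * R"
      have G1: "G1 \<in> polys_over B"
        unfolding G1_def by (intro cl(4,5,6) M R(1) Suc(2) polys_over_coeff)
      have "coeff G1 i = 0" if "i \<ge> d" for i
      proof (cases "i = d")
        case True
        then show ?thesis using \<open>e \<le> d\<close>
          by (simp add: G1_def M_def coeff_monom_mult)
      next
        case False
        then have "i - (d - e) > e" "i \<ge> Suc d" using that \<open>e \<le> d\<close> by linarith+
        then show ?thesis using R(2) Suc(3) by (simp add: G1_def M_def coeff_monom_mult)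
      qed
      from Suc(1)[OF G1 this] obtain N Q R' where IH: "Q \<in> polys_over B" "R' \<in> polys_over B"
        "Polynomial.smult (?c ^ N) G1 = Q * R + R'" "\<forall>i\<ge>e. coeff R' i = 0"
        "\<forall>i. i + e \<ge> d \<longrightarrow> coeff Q i = 0" by blast
      have "Polynomial.smult (?c ^ Suc N) G = Polynomial.smult (?c ^ N) G1 + Polynomial.smult (?c ^ N) (M * R)"
        by (simp add: G1_def smult_diff_right mult.commute)
      also have "\<dots> = (Q + Polynomial.smult (?c ^ N) M) * R + R'"
        by (simp add: IH(3) algebra_simps)
      finally have eq: "Polynomial.smult (?c ^ Suc N) G = (Q + Polynomial.smult (?c ^ N) M) * R + R'" .
      have "Q + Polynomial.smult (?c ^ N) M \<in> polys_over B"
        by (intro cl(3,6) IH(1) M cls_subring_power[OF B] polys_over_coeff R(1))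
      moreover have "\<forall>i. i + e \<ge> Suc d \<longrightarrow> coeff (Q + Polynomial.smult (?c ^ N) M) i = 0"
        using IH(5) True by (auto simp: M_def)
      ultimately show ?thesis using eq IH(2,4) by blast
    qed
  qed
qed

lemma poly_in_idl: "idl.subspace p \<Longrightarrow> (\<And>i. coeff F i \<in> p) \<Longrightarrow> poly F y \<in> p"
  unfolding poly_altdef by (intro idl.subspace_sum idl_mult_right)

text \<open>Leading coefficients in \<open>p\<close> are dropped one after the other. This changes
  the value at \<open>y\<close> only by elements of \<open>p\<close> and stops at position
  \<open>j\<close> at the latest.\<close>

lemma truncate_poly_mod:
  assumes B: "cls_subring B" and p: "idl.subspace p"
    and F: "F \<in> polys_over B" "\<And>i. i \<ge> d \<Longrightarrow> coeff F i = 0" and nz: "coeff F j \<notin> p"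
  obtains e F' where "e < d" "F' \<in> polys_over B" "\<And>i. i > e \<Longrightarrow> coeff F' i = 0" "coeff F' e \<notin> p"
    "poly F y - poly F' y \<in> p"
proof -
  have "\<exists>e<d. \<exists>F'\<in>polys_over B. (\<forall>i>e. coeff F' i = 0) \<and> coeff F' e \<notin> p \<and> poly F y - poly F' y \<in> p"
    using F nz
  proof (induct d arbitrary: F)
    case 0
    then show ?case using idl.subspace_0[OF p] by simp
  next
    case (Suc d)
    show ?case
    proof (cases "coeff F d \<in> p")
      case False
      have "\<forall>i>d. coeff F i = 0" using Suc(3) by (auto simp: Suc_le_eq)
      then show ?thesis using False Suc(2) idl.subspace_0[OF p]
        by (intro exI[of _ d] conjI bexI[of _ F]) simp_all
    next
      case True
      let ?M = "Polynomial.monom (coeff F d) d"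
      have 1: "F - ?M \<in> polys_over B"
        using Suc(2) by (intro polys_over_closed(4,7)[OF B] polys_over_coeff)
      have 2: "coeff (F - ?M) i = 0" if "i \<ge> d" for i
        using that Suc(3)[of i] by (cases "i = d") auto
      have 3: "coeff (F - ?M) j \<notin> p"
        using Suc(4) True by (cases "j = d") auto
      obtain e F' where e: "e < d" "F' \<in> polys_over B" "\<forall>i>e. coeff F' i = 0" "coeff F' e \<notin> p"
        "poly (F - ?M) y - poly F' y \<in> p" using Suc(1)[OF 1 2 3] by blast
      have "poly (F - ?M) y - poly F' y + coeff F d * y ^ d \<in> p"
        by (intro idl.subspace_add[OF p e(5)] idl_mult_right[OF p True])
      then have "poly F y - poly F' y \<in> p" by (simp add: poly_monom)
      then show ?thesis using e by (intro exI[of _ e] conjI bexI[of _ F']) auto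
    qed
  qed
  then show ?thesis using that by blast
qed

lemma mpoly_eval_poly: "mpoly_eval P (poly F z) = poly (map_poly (mpoly_eval P) F) (mpoly_eval P z)"
  by (induct F) (simp_all add: map_poly_pCons)

text \<open>A specialization of the variables in \<open>V\<close> that respects \<open>p\<close> is
  extended to \<open>y\<close>. Modulo \<open>p\<close>, the variable \<open>y\<close> is either
  transcendental or algebraic over \<open>k[V]\<close>, and in each case \<open>b\<close> yields an
  element of \<open>k[V]\<close> outside \<open>p\<close> whose nonvanishing is what the extension
  needs.\<close>

lemma prime_zero_step:
  fixes p :: "('n::finite, 'k::{alg_closed_field, field_char_0}) mpoly set"
  assumes p: "prime_idl p" and y: "y \<notin> V"
    and IH: "\<And>b. b \<in> vars_in V \<Longrightarrow> b \<notin> p \<Longrightarrow> \<exists>P. (\<forall>f\<in>vars_in V \<inter> p. mpoly_eval P f = 0) \<and> mpoly_eval P b \<noteq> 0"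
    and b: "b \<in> vars_in (insert y V)" "b \<notin> p"
  shows "\<exists>P. (\<forall>f\<in>vars_in (insert y V) \<inter> p. mpoly_eval P f = 0) \<and> mpoly_eval P b \<noteq> 0"
proof -
  define B where "B = (vars_in V :: ('n, 'k) mpoly set)"
  define Y where "Y = (mpoly_var y :: ('n, 'k) mpoly)"
  have B: "cls_subring B" unfolding B_def by (rule cls_subring_vars_in)
  have B': "vars_in (insert y V) = adjoin B Y" by (simp add: vars_in_insert B_def Y_def)
  have sB': "cls_subring (adjoin B Y)" using B by (rule cls_subring_adjoin)
  note cl = polys_over_closed[OF B]
  note ps = prime_idlD(1)[OF p]
  obtain G where G: "G \<in> polys_over B" "b = poly G Y" using b(1) B' by (auto simp: adjoin_def)
  define upd where "upd P \<xi> = (\<chi> i. if i = y then \<xi> else vec_nth P i)" for P :: "'k^'n" and \<xi>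
  have updB: "mpoly_eval (upd P \<xi>) f = mpoly_eval P f" if "f \<in> B" for f P \<xi>
    using that y unfolding B_def upd_def by (intro mpoly_eval_cong_vars_in) auto
  have ev: "mpoly_eval (upd P \<xi>) (poly F Y) = poly (map_poly (mpoly_eval P) F) \<xi>" if "F \<in> polys_over B" for F P \<xi>
  proof -
    have "map_poly (mpoly_eval (upd P \<xi>)) F = map_poly (mpoly_eval P) F"
      by (intro poly_eqI) (simp add: coeff_map_poly updB polys_over_coeff[OF that])
    then show ?thesis unfolding mpoly_eval_poly by (simp add: Y_def upd_def)
  qed
  have ev0: "mpoly_eval (upd P \<xi>) (poly F Y) = 0"
    if "F \<in> polys_over B" "\<And>i. coeff F i \<in> p" "\<And>f. f \<in> B \<Longrightarrow> f \<in> p \<Longrightarrow> mpoly_eval P f = 0" for F P \<xi>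
  proof -
    have "map_poly (mpoly_eval P) F = 0"
      by (intro poly_eqI) (simp add: coeff_map_poly that polys_over_coeff)
    then show ?thesis by (simp add: ev that)
  qed
  have cd: "coeff H i = 0" if "Suc (degree H) \<le> i" for H :: "('n, 'k) mpoly poly" and i
    using that by (simp add: coeff_eq_0)
  define Ld where "Ld F e \<longleftrightarrow> F \<in> polys_over B \<and> (\<forall>i>e. coeff F i = 0) \<and> coeff F e \<notin> p" for F e
  show ?thesis
  proof (cases "\<exists>F\<in>polys_over B. poly F Y \<in> p \<and> (\<exists>i. coeff F i \<notin> p)")
    \<comment> \<open>Transcendental case: relations satisfied by \<open>Y\<close> have all
      coefficients in \<open>p\<close>, so every value for \<open>y\<close> respects them. It
      suffices to avoid the finitely many roots of \<open>G\<close> specialized at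
      \<open>P\<close>.\<close>
    case False
    have "\<exists>i. coeff G i \<notin> p"
      using b(2) G(2) poly_in_idl[OF ps, of G Y] by blast
    then obtain i where i: "coeff G i \<notin> p" by blast
    obtain P where P: "\<And>f. f \<in> B \<Longrightarrow> f \<in> p \<Longrightarrow> mpoly_eval P f = 0" "mpoly_eval P (coeff G i) \<noteq> 0"
      using IH[OF _ i] polys_over_coeff[OF G(1)] unfolding B_def by blast
    let ?g = "map_poly (mpoly_eval P) G"
    have "coeff ?g i \<noteq> 0" using P(2) by (simp add: coeff_map_poly)
    then have "?g \<noteq> 0" by auto
    then have "finite {x. poly ?g x = 0}" by (rule poly_roots_finite)
    then obtain \<xi> where \<xi>: "poly ?g \<xi> \<noteq> 0"
      using infinite_UNIV_char_0 by (metis (mono_tags, lifting) UNIV_eq_I mem_Collect_eq)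
    have "mpoly_eval (upd P \<xi>) b \<noteq> 0" using \<xi> ev[OF G(1)] G(2) by simp
    moreover have "mpoly_eval (upd P \<xi>) f = 0" if f: "f \<in> vars_in (insert y V)" "f \<in> p" for f
    proof -
      obtain F where F: "F \<in> polys_over B" "f = poly F Y" using f(1) unfolding B' adjoin_def by blast
      then have "coeff F i \<in> p" for i using False f(2) by blast
      then show ?thesis using ev0 F P(1) by blast
    qed
    ultimately show ?thesis by blast
  next
    \<comment> \<open>Algebraic case: \<open>F\<close> is a relation of least degree with leading
      coefficient outside \<open>p\<close>, a substitute for the minimal polynomial of
      \<open>Y\<close>.\<close>
    case True
    have "\<exists>d F. Ld F d \<and> poly F Y \<in> p"
    proof -
      obtain F i where F: "F \<in> polys_over B" "poly F Y \<in> p" "coeff F i \<notin> p" using True by blast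
      obtain e F' where e: "F' \<in> polys_over B" "\<And>i. i > e \<Longrightarrow> coeff F' i = 0" "coeff F' e \<notin> p"
        "poly F Y - poly F' Y \<in> p"
        using truncate_poly_mod[where y = Y, OF B ps F(1) cd F(3)] by blast
      have "poly F' Y \<in> p" using idl.subspace_diff[OF ps F(2) e(4)] by simp
      then show ?thesis using e unfolding Ld_def by blast
    qed
    define d where "d = (LEAST d. \<exists>F. Ld F d \<and> poly F Y \<in> p)"
    have "\<exists>F. Ld F d \<and> poly F Y \<in> p" unfolding d_def using \<open>\<exists>d F. _ d F\<close> by (rule LeastI_ex)
    then obtain F where F: "Ld F d" "poly F Y \<in> p" by blast
    have Fp: "F \<in> polys_over B" "\<And>i. i > d \<Longrightarrow> coeff F i = 0" "coeff F d \<notin> p"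
      using F(1) by (auto simp: Ld_def)
    have dmin: "coeff H j \<in> p" if H: "H \<in> polys_over B" "\<And>i. i \<ge> d \<Longrightarrow> coeff H i = 0" "poly H Y \<in> p" for H j
    proof (rule ccontr)
      assume "coeff H j \<notin> p"
      then obtain e F' where e: "e < d" "F' \<in> polys_over B" "\<And>i. i > e \<Longrightarrow> coeff F' i = 0" "coeff F' e \<notin> p"
        "poly H Y - poly F' Y \<in> p"
        using truncate_poly_mod[OF B ps H(1,2)] by blast
      have "poly F' Y \<in> p" using idl.subspace_diff[OF ps H(3) e(5)] by simp
      then have "d \<le> e" unfolding d_def using e by (intro Least_le) (auto simp: Ld_def)
      then show False using e(1) by simp
    qed
    \<comment> \<open>\<open>J\<close> is the ideal \<open>b B[Y] + p\<close>. The aim is an element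
      of \<open>B\<close> in \<open>J\<close> but outside \<open>p\<close>, found as a polynomial
      \<open>R\<close> of least degree \<open>e\<close> with value in \<open>J\<close> and leading
      coefficient outside \<open>p\<close>.\<close>
    define J where "J = {x. \<exists>v\<in>adjoin B Y. x - v * b \<in> p}"
    have pJ: "x \<in> J" if "x \<in> p" for x
      unfolding J_def using that cls_subringD(1)[OF sB'] by (intro CollectI bexI[of _ 0]) auto
    have bJ: "b \<in> J"
      unfolding J_def using idl.subspace_0[OF ps] cls_subringD(2)[OF sB'] by (intro CollectI bexI[of _ 1]) auto
    have Jd: "x - z \<in> J" if xz: "x \<in> J" "z \<in> J" for x z
    proof -
      obtain v w where vw: "v \<in> adjoin B Y" "x - v * b \<in> p" "w \<in> adjoin B Y" "z - w * b \<in> p"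
        using xz by (auto simp: J_def)
      have "(x - v * b) - (z - w * b) \<in> p" by (rule idl.subspace_diff[OF ps vw(2,4)])
      then have "(x - z) - (v - w) * b \<in> p" by (simp add: algebra_simps)
      then show ?thesis unfolding J_def using cls_subringD(4)[OF sB' vw(1,3)] by blast
    qed
    have Jm: "poly H Y * x \<in> J" if H: "H \<in> polys_over B" and x: "x \<in> J" for H x
    proof -
      have h: "poly H Y \<in> adjoin B Y" using H by (auto simp: adjoin_def)
      obtain v where v: "v \<in> adjoin B Y" "x - v * b \<in> p" using x by (auto simp: J_def)
      have "poly H Y * (x - v * b) \<in> p" by (rule idl.subspace_scale[OF ps v(2)])
      then have "poly H Y * x - (poly H Y * v) * b \<in> p" by (simp add: algebra_simps)
      then show ?thesis unfolding J_def using cls_subringD(5)[OF sB' h v(1)] by blast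
    qed
    have Jc: "c * x \<in> J" if "c \<in> B" "x \<in> J" for c x
      using Jm[OF cl(8) that(2), of c] that(1) by simp
    have ex: "\<exists>e R. Ld R e \<and> poly R Y \<in> J" using F pJ by blast
    define e where "e = (LEAST e. \<exists>R. Ld R e \<and> poly R Y \<in> J)"
    have "\<exists>R. Ld R e \<and> poly R Y \<in> J" unfolding e_def using ex by (rule LeastI_ex)
    then obtain R where R: "Ld R e" "poly R Y \<in> J" by blast
    have Rp: "R \<in> polys_over B" "\<And>i. i > e \<Longrightarrow> coeff R i = 0" "coeff R e \<notin> p"
      using R(1) by (auto simp: Ld_def)
    define c where "c = coeff R e"
    have c: "c \<in> B" "c \<notin> p" using Rp polys_over_coeff by (auto simp: c_def)
    have cN: "c ^ N \<in> B" "c ^ N \<notin> p" for N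
      using cls_subring_power[OF B c(1)] prime_idl_power[OF p] c(2) by auto
    have emin: "poly H Y \<in> p" "coeff H j \<in> p" if H: "H \<in> polys_over B" "\<And>i. i \<ge> e \<Longrightarrow> coeff H i = 0" "poly H Y \<in> J" for H j
    proof -
      have *: "coeff H j \<in> p" for j
      proof (rule ccontr)
        assume "coeff H j \<notin> p"
        then obtain e' F' where e': "e' < e" "F' \<in> polys_over B" "\<And>i. i > e' \<Longrightarrow> coeff F' i = 0" "coeff F' e' \<notin> p"
          "poly H Y - poly F' Y \<in> p"
          using truncate_poly_mod[OF B ps H(1,2)] by blast
        have "poly F' Y \<in> J" using Jd[OF H(3) pJ[OF e'(5)]] by simp
        then have "e \<le> e'" unfolding e_def using e' by (intro Least_le) (auto simp: Ld_def)
        then show False using e'(1) by simp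
      qed
      show "poly H Y \<in> p" "coeff H j \<in> p" using * poly_in_idl[OF ps] by auto
    qed
    \<comment> \<open>Pseudo-division of \<open>F\<close> by \<open>R\<close> leaves a remainder
      with value in \<open>J\<close>, hence in \<open>p\<close> by minimality of \<open>e\<close>.
      So the product of the values of the quotient and of \<open>R\<close> lies in the prime
      \<open>p\<close>.\<close>
    have e0: "e = 0"
    proof (rule ccontr)
      assume "e \<noteq> 0"
      obtain N Q R' where D: "Q \<in> polys_over B" "R' \<in> polys_over B"
        "Polynomial.smult (c ^ N) F = Q * R + R'"
        "\<forall>i\<ge>e. coeff R' i = 0" "\<forall>i. i + e \<ge> Suc d \<longrightarrow> coeff Q i = 0"
        using pseudo_division[OF B Rp(1,2) Fp(1) Fp(2)[OF Suc_le_lessD]] unfolding c_def by blast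
      have "poly (Polynomial.smult (c ^ N) F) Y = poly (Q * R + R') Y" by (simp only: D(3))
      then have eq: "c ^ N * poly F Y = poly Q Y * poly R Y + poly R' Y" by simp
      then have "poly R' Y = c ^ N * poly F Y - poly Q Y * poly R Y" by simp
      then have "poly R' Y \<in> J"
        using Jd[OF Jc[OF cN(1) pJ[OF F(2)]] Jm[OF D(1) R(2)]] by simp
      from emin[OF D(2) D(4)[rule_format] this] have R'p: "poly R' Y \<in> p" "\<And>j. coeff R' j \<in> p" by blast+
      have "poly Q Y * poly R Y = c ^ N * poly F Y - poly R' Y" using eq by simp
      then have "poly Q Y * poly R Y \<in> p"
        using idl.subspace_diff[OF ps idl.subspace_scale[OF ps F(2)] R'p(1)] by simp
      then consider "poly Q Y \<in> p" | "poly R Y \<in> p" using prime_idlD(3)[OF p] by blast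
      then show False
      proof cases
        \<comment> \<open>As \<open>e\<close> is positive, \<open>Q\<close> has degree below
          \<open>d\<close>, and minimality of \<open>d\<close> puts its coefficients into
          \<open>p\<close>; then so is the leading coefficient of \<open>F\<close>.\<close>
        case 1
        have "coeff Q i = 0" if "i \<ge> d" for i using D(5) that \<open>e \<noteq> 0\<close> by simp
        then have Qp: "coeff Q i \<in> p" for i using dmin[OF D(1) _ 1] by blast
        have "coeff (Q * R + R') d \<in> p"
          unfolding coeff_add coeff_mult
          by (intro idl.subspace_add[OF ps] idl.subspace_sum[OF ps] idl_mult_right[OF ps] Qp R'p)
        then have "c ^ N * coeff F d \<in> p" by (simp flip: D(3))
        then show False using prime_idlD(3)[OF p] cN(2) Fp(3) by blast
      next
        \<comment> \<open>With \<open>R\<close> a relation, dividing \<open>G\<close> by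
          \<open>R\<close> gives \<open>c ^ N * b \<in> p\<close>.\<close>
        case 2
        obtain N Q R' where D: "Q \<in> polys_over B" "R' \<in> polys_over B"
          "Polynomial.smult (c ^ N) G = Q * R + R'"
          "\<forall>i\<ge>e. coeff R' i = 0"
          using pseudo_division[OF B Rp(1,2) G(1) cd] unfolding c_def by blast
        have "poly (Polynomial.smult (c ^ N) G) Y = poly (Q * R + R') Y" by (simp only: D(3))
        then have eq: "c ^ N * b = poly Q Y * poly R Y + poly R' Y" by (simp add: G(2))
        then have "poly R' Y = c ^ N * b - poly Q Y * poly R Y" by simp
        then have "poly R' Y \<in> J"
          using Jd[OF Jc[OF cN(1) bJ] Jm[OF D(1) R(2)]] by simp
        from emin(1)[OF D(2) D(4)[rule_format] this] have "poly R' Y \<in> p" .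
        then have "c ^ N * b \<in> p"
          unfolding eq by (intro idl.subspace_add[OF ps] idl.subspace_scale[OF ps] 2)
        then show False using prime_idlD(3)[OF p] cN(2) b(2) by blast
      qed
    qed
    have "R = [:c:]"
      using Rp(2) e0 by (intro poly_eqI) (auto simp: c_def coeff_pCons split: nat.split)
    then have "c \<in> J" using R(2) by simp
    then obtain v where v: "v \<in> adjoin B Y" "c - v * b \<in> p" by (auto simp: J_def)
    define a where "a = coeff F d"
    have a: "a \<in> B" "a \<notin> p" using Fp polys_over_coeff by (auto simp: a_def)
    have d0: "d \<noteq> 0"
    proof
      assume "d = 0"
      then have "F = [:a:]"
        using Fp(2) by (intro poly_eqI) (auto simp: a_def coeff_pCons split: nat.split)
      then show False using F(2) a(2) by simp
    qed
    \<comment> \<open>Nonvanishing of \<open>a\<close> keeps the degree of \<open>F\<close> positive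
      after specialization, so a root exists; nonvanishing of \<open>c\<close> passes to
      \<open>b\<close> because \<open>c - v * b \<in> p\<close>.\<close>
    have "a * c \<in> B" "a * c \<notin> p" using cls_subringD(5)[OF B a(1) c(1)] prime_idlD(3)[OF p] a c by blast+
    then obtain P where P: "\<And>f. f \<in> B \<Longrightarrow> f \<in> p \<Longrightarrow> mpoly_eval P f = 0" "mpoly_eval P (a * c) \<noteq> 0"
      using IH[of "a * c"] unfolding B_def by blast
    let ?f = "map_poly (mpoly_eval P) F"
    have "coeff ?f d \<noteq> 0" using P(2) by (simp add: coeff_map_poly a_def)
    then have "degree ?f > 0" using d0 le_degree[of ?f d] by simp
    then obtain \<xi> where \<xi>: "poly ?f \<xi> = 0" using alg_closed_imp_poly_has_root by blast
    \<comment> \<open>Pseudo-division by \<open>F\<close> reduces a multiple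
      \<open>a ^ N * f\<close> to a remainder of degree below \<open>d\<close> with value in
      \<open>p\<close>; its coefficients then lie in \<open>p\<close> and vanish at
      \<open>P\<close>.\<close>
    have zero: "mpoly_eval (upd P \<xi>) f = 0" if f: "f \<in> adjoin B Y" "f \<in> p" for f
    proof -
      obtain H where H: "H \<in> polys_over B" "f = poly H Y" using f(1) by (auto simp: adjoin_def)
      obtain N Q R' where D: "Q \<in> polys_over B" "R' \<in> polys_over B"
          "Polynomial.smult (a ^ N) H = Q * F + R'"
          "\<forall>i\<ge>d. coeff R' i = 0"
        using pseudo_division[OF B Fp(1,2) H(1) cd] unfolding a_def by blast
      have "poly (Polynomial.smult (a ^ N) H) Y = poly (Q * F + R') Y" by (simp only: D(3))
      then have eq: "a ^ N * f = poly Q Y * poly F Y + poly R' Y" by (simp add: H(2))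
      then have "poly R' Y = a ^ N * f - poly Q Y * poly F Y" by simp
      then have "poly R' Y \<in> p"
        using idl.subspace_diff[OF ps idl.subspace_scale[OF ps f(2)] idl.subspace_scale[OF ps F(2)]] by simp
      then have "coeff R' j \<in> p" for j using dmin[OF D(2) D(4)[rule_format]] by blast
      then have "mpoly_eval (upd P \<xi>) (poly R' Y) = 0" using ev0[OF D(2) _ P(1)] by blast
      moreover have "mpoly_eval (upd P \<xi>) (poly F Y) = 0" using ev[OF Fp(1)] \<xi> by simp
      ultimately have "mpoly_eval (upd P \<xi>) (a ^ N * f) = 0" unfolding eq by simp
      moreover have "mpoly_eval (upd P \<xi>) a \<noteq> 0" using P(2) updB[OF a(1)] by simp
      ultimately show ?thesis by simp
    qed
    have cB: "c \<in> adjoin B Y"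
      using c(1) cl(8) unfolding adjoin_def by (intro image_eqI[of _ _ "[:c:]"]) auto
    have bB: "b \<in> adjoin B Y" using b(1) B' by simp
    have "mpoly_eval (upd P \<xi>) (c - v * b) = 0"
      by (intro zero v(2) cls_subringD[OF sB'] cB v(1) bB)
    then have "mpoly_eval (upd P \<xi>) b \<noteq> 0" using P(2) updB[OF c(1)] by auto
    then show ?thesis using zero B' by blast
  qed
qed

text \<open>A zero of a maximal ideal \<open>M\<close> above \<open>Q\<close> is built by adding one
  variable at a time. The induction must allow an arbitrary \<open>b\<close> outside
  \<open>M\<close> that stays nonzero, since the step uses leading coefficients for
  \<open>b\<close>; at the end \<open>b\<close> is 1.\<close>

theorem mpoly_nullstellensatz:
  fixes Q :: "('n::finite, 'k::{alg_closed_field, field_char_0}) mpoly set"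
  assumes Q: "idl.subspace Q" "1 \<notin> Q"
  obtains P where "\<And>f. f \<in> Q \<Longrightarrow> mpoly_eval P f = 0"
proof -
  obtain M where M: "idl.subspace M" "1 \<notin> M" "Q \<subseteq> M"
    and max: "\<And>N. idl.subspace N \<Longrightarrow> 1 \<notin> N \<Longrightarrow> M \<subseteq> N \<Longrightarrow> N = M"
  proof -
    let ?A = "{N :: ('n, 'k) mpoly set. idl.subspace N \<and> 1 \<notin> N \<and> Q \<subseteq> N}"
    have "?A \<noteq> {}" using Q by auto
    moreover have "idl.subspace N" if "N \<in> ?A" for N using that by simp
    ultimately have "\<exists>M\<in>?A. \<forall>N\<in>?A. M \<subseteq> N \<longrightarrow> N = M"
      by (rule noeth_maximal[OF noeth_mpoly])
    then obtain M where M: "M \<in> ?A" "\<forall>N\<in>?A. M \<subseteq> N \<longrightarrow> N = M" by (elim bexE)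
    show ?thesis
    proof (rule that)
      show "idl.subspace M" "1 \<notin> M" "Q \<subseteq> M" using M(1) by auto
    next
      fix N assume N: "idl.subspace N" "1 \<notin> N" "M \<subseteq> N"
      then show "N = M" using M by auto
    qed
  qed
  have p: "prime_idl M" using M(1,2) max by (rule maximal_idl_prime)
  have "\<exists>P. (\<forall>f\<in>vars_in V \<inter> M. mpoly_eval P f = 0) \<and> mpoly_eval P b \<noteq> 0"
    if "finite V" "b \<in> vars_in V" "b \<notin> M" for b V
    using that
  proof (induct V arbitrary: b)
    case empty
    have const: "c = 0" if "mpoly_const c \<in> M" for c
    proof (rule ccontr)
      assume "c \<noteq> 0"
      then have "mpoly_const (1 / c) * mpoly_const c = (1 :: ('n, 'k) mpoly)"
        by (simp flip: mpoly_const_mult)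
      then show False using idl.subspace_scale[OF M(1) that, of "mpoly_const (1 / c)"] M(2) by simp
    qed
    show ?case
      using empty const idl.subspace_0[OF M(1)] by (intro exI[of _ undefined]) (auto simp: vars_in_empty)
  next
    case (insert y V)
    then show ?case using prime_zero_step[OF p insert(2) insert(3)] by blast
  qed
  from this[OF finite, of 1 UNIV] have "\<exists>P. \<forall>f\<in>M. mpoly_eval P f = 0"
    using M(2) by (auto simp: vars_in_UNIV)
  then obtain P where "\<forall>f\<in>M. mpoly_eval P f = 0" ..
  then show ?thesis using that M(3) by blast
qed

section \<open>Krull's intersection theorem\<close>

text \<open>The ideal \<open>I + m Q\<close>, which is the product of \<open>m\<close> and
  \<open>Q\<close> modulo \<open>I\<close>.\<close>

definition idl_sum_prod :: "'a::comm_ring_1 set \<Rightarrow> 'a set \<Rightarrow> 'a set \<Rightarrow> 'a set" where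
  "idl_sum_prod I m Q = idl.span (I \<union> {a * b |a b. a \<in> m \<and> b \<in> Q})"

lemma idl_sum_prod_subspace: "idl.subspace (idl_sum_prod I m Q)"
  by (simp add: idl_sum_prod_def)

lemma idl_sum_prod_left: "x \<in> I \<Longrightarrow> x \<in> idl_sum_prod I m Q"
  by (simp add: idl_sum_prod_def idl.span_base)

lemma idl_sum_prod_mult: "a \<in> m \<Longrightarrow> b \<in> Q \<Longrightarrow> a * b \<in> idl_sum_prod I m Q"
  unfolding idl_sum_prod_def by (rule idl.span_base) blast

lemma idl_sum_prod_minimal:
  assumes "I \<subseteq> L" "\<And>a b. a \<in> m \<Longrightarrow> b \<in> Q \<Longrightarrow> a * b \<in> L" "idl.subspace L"
  shows "idl_sum_prod I m Q \<subseteq> L"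
  unfolding idl_sum_prod_def using assms by (intro idl.span_minimal) auto

text \<open>For \<open>s > 0\<close> this is \<open>I + m^s\<close>, the preimage of the power of
  \<open>m\<close> modulo \<open>I\<close>.\<close>

primrec idl_filtration :: "'a::comm_ring_1 set \<Rightarrow> 'a set \<Rightarrow> nat \<Rightarrow> 'a set" where
  "idl_filtration I m 0 = UNIV"
| "idl_filtration I m (Suc s) = idl_sum_prod I m (idl_filtration I m s)"

lemma idl_filtration_subspace: "idl.subspace (idl_filtration I m s)"
  by (cases s) (simp_all add: idl_sum_prod_subspace)

lemma idl_filtration_base: "x \<in> I \<Longrightarrow> x \<in> idl_filtration I m s"
  by (cases s) (simp_all add: idl_sum_prod_left)

lemma idl_filtration_mult: "a \<in> m \<Longrightarrow> b \<in> idl_filtration I m s \<Longrightarrow> a * b \<in> idl_filtration I m (Suc s)"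
  by (simp add: idl_sum_prod_mult)

lemma idl_filtration_1: "idl.subspace m \<Longrightarrow> I \<subseteq> m \<Longrightarrow> idl_filtration I m (Suc 0) = m"
proof (intro equalityI)
  assume m: "idl.subspace m" "I \<subseteq> m"
  show "idl_filtration I m (Suc 0) \<subseteq> m"
    using idl_sum_prod_minimal[OF m(2) _ m(1)] idl_mult_right[OF m(1)] by simp
  show "m \<subseteq> idl_filtration I m (Suc 0)"
    using idl_filtration_mult[of _ m 1 I 0] by auto
qed

lemma subspace_colon: "idl.subspace L \<Longrightarrow> idl.subspace {z. a * z \<in> L}"
  unfolding idl.subspace_def by (auto simp: distrib_left mult.left_commute[of a])

text \<open>One factor \<open>a\<close> of \<open>m\<close> is split off and absorbed by replacing
  \<open>L\<close> with the colon ideal \<open>{z. a * z \<in> L}\<close>; hence the generalization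
  over \<open>L\<close>.\<close>

lemma idl_filtration_add_subset:
  assumes "idl.subspace L" "I \<subseteq> L"
    and "\<And>u v. u \<in> idl_filtration I m s \<Longrightarrow> v \<in> idl_filtration I m t \<Longrightarrow> u * v \<in> L"
  shows "idl_filtration I m (s + t) \<subseteq> L"
  using assms
proof (induct s arbitrary: L)
  case 0
  then show ?case using "0.prems"(3)[of 1] by auto
next
  case (Suc s)
  have "a * b \<in> L" if a: "a \<in> m" and b: "b \<in> idl_filtration I m (s + t)" for a b
  proof -
    have "idl_filtration I m (s + t) \<subseteq> {z. a * z \<in> L}"
    proof (rule Suc(1))
      show "idl.subspace {z. a * z \<in> L}" using Suc(2) by (rule subspace_colon)
      show "I \<subseteq> {z. a * z \<in> L}" using Suc(2,3) by (auto intro: idl.subspace_scale)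
      fix u v assume "u \<in> idl_filtration I m s" "v \<in> idl_filtration I m t"
      then show "u * v \<in> {z. a * z \<in> L}"
        using Suc(4)[OF idl_filtration_mult[OF a]] by (simp add: mult.assoc)
    qed
    then show ?thesis using b by blast
  qed
  then show ?case using idl_sum_prod_minimal[OF Suc(3) _ Suc(2)] by simp
qed

lemma idl_insert_decomp:
  assumes "idl.subspace N" "y \<in> idl.span (insert x N)"
  obtains k where "y - k * x \<in> N"
proof -
  obtain k where "y - k * x \<in> idl.span N" using assms(2) by (auto simp: idl.span_insert)
  also have "idl.span N = N" using assms(1) by (rule idl.span_eq_iff[THEN iffD2])
  finally show ?thesis by (rule that)
qed

text \<open>The colon ideals of \<open>N\<close> by powers of \<open>x\<close> increase; a maximal
  one among them equals its successor.\<close>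

lemma idl_power_colon_stable:
  assumes noeth: "noeth (UNIV :: 'a::comm_ring_1 set)" and N: "idl.subspace (N :: 'a set)"
  obtains e where "\<And>b. x ^ Suc e * b \<in> N \<Longrightarrow> x ^ e * b \<in> N"
proof -
  let ?C = "\<lambda>e. {b. x ^ e * b \<in> N}"
  have "\<exists>M\<in>range ?C. \<forall>Q\<in>range ?C. M \<subseteq> Q \<longrightarrow> Q = M"
    using subspace_colon[OF N] by (intro noeth_maximal[OF noeth]) auto
  then obtain e where e: "\<And>e'. ?C e \<subseteq> ?C e' \<Longrightarrow> ?C e' = ?C e" by auto
  have "?C e \<subseteq> ?C (Suc e)" using idl.subspace_scale[OF N] by (auto simp: mult.assoc)
  then have "?C (Suc e) = ?C e" by (rule e)
  then show ?thesis using that[of e] by blast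
qed

text \<open>By Noetherian induction rather than by counting exponents of generators: an ideal above
  \<open>N\<close> that is maximal among those containing no step of the filtration is prime, so it
  contains \<open>m\<close> and with it step 1.\<close>

lemma filtration_subset_of_radical:
  assumes noeth: "noeth (UNIV :: 'a::comm_ring_1 set)"
    and N: "idl.subspace (N :: 'a set)" "I \<subseteq> N" and rad: "\<And>x. x \<in> m \<Longrightarrow> \<exists>e. x ^ e \<in> N"
  obtains s where "idl_filtration I m s \<subseteq> N"
proof (rule ccontr)
  assume "\<not> thesis"
  then have no: "\<not> idl_filtration I m s \<subseteq> N" for s using that by blast
  let ?A = "{L. idl.subspace L \<and> N \<subseteq> L \<and> (\<forall>s. \<not> idl_filtration I m s \<subseteq> L)}"
  have "\<exists>L\<in>?A. \<forall>L'\<in>?A. L \<subseteq> L' \<longrightarrow> L' = L"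
    using N no by (intro noeth_maximal[OF noeth]) auto
  then obtain L where L: "idl.subspace L" "N \<subseteq> L" "\<And>s. \<not> idl_filtration I m s \<subseteq> L"
    and max: "\<And>L'. idl.subspace L' \<Longrightarrow> L \<subseteq> L' \<Longrightarrow> (\<And>s. \<not> idl_filtration I m s \<subseteq> L') \<Longrightarrow> L' = L"
    by auto
  have large: "\<exists>s. idl_filtration I m s \<subseteq> idl.span (insert a L)" if "a \<notin> L" for a
  proof (rule ccontr)
    assume "\<not> ?thesis"
    then have "idl.span (insert a L) = L"
      using idl.span_superset[of "insert a L"] by (intro max) auto
    then show False using that idl.span_base[of a "insert a L"] by auto
  qed
  have "prime_idl L"
    unfolding prime_idl_def
  proof (intro conjI allI impI)
    have "L \<noteq> UNIV" using L(3)[of 0] by auto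
    then show "1 \<notin> L" using idl.subspace_scale[OF L(1), of 1] by auto
  next
    fix a b assume ab: "a * b \<in> L"
    show "a \<in> L \<or> b \<in> L"
    proof (rule ccontr)
      assume "\<not> ?thesis"
      then obtain s t where st: "idl_filtration I m s \<subseteq> idl.span (insert a L)"
        "idl_filtration I m t \<subseteq> idl.span (insert b L)" using large by blast
      have "u * v \<in> L" if uv: "u \<in> idl_filtration I m s" "v \<in> idl_filtration I m t" for u v
      proof -
        obtain k where k: "u - k * a \<in> L"
          using idl_insert_decomp[OF L(1) subsetD[OF st(1) uv(1)]] by blast
        obtain l where l: "v - l * b \<in> L"
          using idl_insert_decomp[OF L(1) subsetD[OF st(2) uv(2)]] by blast
        have "(u - k * a) * v + (k * a) * (v - l * b) + (k * l) * (a * b) \<in> L"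
          by (rule idl.subspace_add[OF L(1) idl.subspace_add[OF L(1) idl_mult_right[OF L(1) k]
              idl.subspace_scale[OF L(1) l]] idl.subspace_scale[OF L(1) ab]])
        then show ?thesis by (simp add: algebra_simps)
      qed
      then have "idl_filtration I m (s + t) \<subseteq> L"
        using L N by (intro idl_filtration_add_subset) auto
      then show False using L(3) by blast
    qed
  qed (rule L(1))
  then have "m \<subseteq> L" using rad L(2) prime_idl_power by blast
  then have "idl_filtration I m (Suc 0) \<subseteq> L"
    using L(1,2) N(2) by (simp, intro idl_sum_prod_minimal) (auto intro: idl_mult_right)
  then show False using L(3) by blast
qed

lemma idl_sum_prod_insert:
  assumes m: "idl.subspace m" and x: "x \<in> idl_sum_prod I m (idl.span (insert g G))"
  obtains a where "a \<in> m" "x - a * g \<in> idl_sum_prod I m (idl.span G)"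
proof -
  let ?K = "idl_sum_prod I m (idl.span G)"
  note K = idl_sum_prod_subspace[of I m "idl.span G"]
  have "\<exists>a\<in>m. x - a * g \<in> ?K"
    using x unfolding idl_sum_prod_def[of I m "idl.span (insert g G)"]
  proof (induct rule: idl.span_induct_alt)
    case base
    show ?case using idl.subspace_0[OF m] idl.subspace_0[OF K] by (intro bexI[of _ 0]) auto
  next
    case (step c x y)
    then obtain a where a: "a \<in> m" "y - a * g \<in> ?K" by blast
    have "\<exists>b\<in>m. x - b * g \<in> ?K"
    proof (cases "x \<in> I")
      case True
      then show ?thesis using idl.subspace_0[OF m] idl_sum_prod_left[of x I] by (intro bexI[of _ 0]) auto
    next
      case False
      then obtain b z where bz: "x = b * z" "b \<in> m" "z \<in> idl.span (insert g G)" using step(1) by auto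
      then obtain k where k: "z - k * g \<in> idl.span G" by (auto simp: idl.span_insert)
      have "b * (z - k * g) \<in> ?K" by (rule idl_sum_prod_mult[OF bz(2) k])
      then have "x - (b * k) * g \<in> ?K" by (simp add: bz(1) algebra_simps)
      then show ?thesis using idl_mult_right[OF m bz(2)] by blast
    qed
    then obtain b where b: "b \<in> m" "x - b * g \<in> ?K" by blast
    have "c * (x - b * g) + (y - a * g) \<in> ?K"
      by (rule idl.subspace_add[OF K idl.subspace_scale[OF K b(2)] a(2)])
    then have "c * x + y - (c * b + a) * g \<in> ?K" by (simp add: algebra_simps)
    then show ?case using idl.subspace_add[OF m idl.subspace_scale[OF m b(1)] a(1)] by blast
  qed
  then show ?thesis using that by blast
qed

text \<open>Generators are eliminated one by one in place of a determinant; the factor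
  \<open>w\<close> congruent to 1 modulo \<open>m\<close> accumulates along the way and need not
  become a unit, as \<open>m\<close> is an arbitrary ideal.\<close>

lemma nakayama:
  assumes m: "idl.subspace m" and I: "idl.subspace I" and "finite G"
    and w: "1 - w \<in> m" "\<And>g. g \<in> G \<Longrightarrow> w * g \<in> idl_sum_prod I m (idl.span G)"
  shows "\<exists>w'. 1 - w' \<in> m \<and> (\<forall>g\<in>G. w' * g \<in> I)"
  using assms(3) w
proof (induct G arbitrary: w)
  case empty
  then show ?case by blast
next
  case (insert g G)
  let ?K = "idl_sum_prod I m (idl.span G)"
  note K = idl_sum_prod_subspace[of I m "idl.span G"]
  obtain a where a: "a \<in> m" "w * g - a * g \<in> ?K"
    using idl_sum_prod_insert[OF m insert(5)[of g]] by blast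
  let ?v = "w - a"
  have v: "?v * g \<in> ?K" using a(2) by (simp add: algebra_simps)
  have "(1 - w) + a \<in> m" by (rule idl.subspace_add[OF m insert(4) a(1)])
  then have vm: "1 - ?v \<in> m" by (simp add: algebra_simps)
  have "?v * (1 - w) + (1 - ?v) \<in> m"
    by (rule idl.subspace_add[OF m idl.subspace_scale[OF m insert(4)] vm])
  then have 1: "1 - ?v * w \<in> m" by (simp add: algebra_simps)
  \<comment> \<open>Multiplication by \<open>?v\<close> removes the multiple of \<open>g\<close>
    from the relation for \<open>h\<close>, because \<open>?v * g \<in> ?K\<close>.\<close>
  have 2: "?v * w * h \<in> ?K" if h: "h \<in> G" for h
  proof -
    obtain b where b: "b \<in> m" "w * h - b * g \<in> ?K"
      using idl_sum_prod_insert[OF m insert(5)[of h]] h by blast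
    have "?v * (w * h - b * g) + b * (?v * g) \<in> ?K"
      by (rule idl.subspace_add[OF K idl.subspace_scale[OF K b(2)] idl.subspace_scale[OF K v]])
    then show ?thesis by (simp add: algebra_simps)
  qed
  obtain w' where w': "1 - w' \<in> m" "\<And>h. h \<in> G \<Longrightarrow> w' * h \<in> I"
    using insert(3)[OF 1 2] by blast
  have "idl.span G \<subseteq> {z. w' * z \<in> I}"
    using w'(2) by (intro idl.span_minimal subspace_colon I) auto
  then have "?K \<subseteq> {z. w' * z \<in> I}"
    by (intro idl_sum_prod_minimal subspace_colon I)
      (auto intro: idl.subspace_scale[OF I] simp: mult.left_commute[of w'])
  then have "w' * (?v * g) \<in> I" using v by blast
  moreover have "w' * ?v * h \<in> I" if "h \<in> G" for h
    using idl.subspace_scale[OF I w'(2)[OF that], of ?v] by (simp only: mult_ac)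
  moreover have "1 - w' * ?v \<in> m"
  proof -
    have "w' * (1 - ?v) + (1 - w') \<in> m"
      by (rule idl.subspace_add[OF m idl.subspace_scale[OF m vm] w'(1)])
    then show ?thesis by (simp add: algebra_simps)
  qed
  ultimately show ?case by (intro exI[of _ "w' * ?v"]) (auto simp: mult.assoc)
qed

text \<open>Nakayama's lemma needs \<open>Q \<subseteq> I + m Q\<close> for the intersection
  \<open>Q\<close>. In place of the Artin-Rees lemma, an ideal \<open>N\<close> above
  \<open>I + m Q\<close> is taken maximal with \<open>N \<inter> Q \<subseteq> I + m Q\<close>; a
  step of the filtration lies in \<open>N\<close>, and so does \<open>Q\<close>.\<close>

theorem krull_intersection:
  assumes noeth: "noeth (UNIV :: 'a::comm_ring_1 set)"
    and I: "prime_idl (I :: 'a set)" and m: "idl.subspace m" "1 \<notin> m" "I \<subseteq> m"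
    and f: "\<And>s. f \<in> idl_filtration I m s"
  shows "f \<in> I"
proof -
  note Is = prime_idlD(1)[OF I]
  define Q where "Q = (\<Inter>s. idl_filtration I m s)"
  have Q: "idl.subspace Q" unfolding Q_def by (intro idl.subspace_Int idl_filtration_subspace)
  let ?K = "idl_sum_prod I m Q"
  have IK: "I \<subseteq> ?K" using idl_sum_prod_left by blast
  let ?A = "{N. idl.subspace N \<and> ?K \<subseteq> N \<and> N \<inter> Q \<subseteq> ?K}"
  have "\<exists>N\<in>?A. \<forall>N'\<in>?A. N \<subseteq> N' \<longrightarrow> N' = N"
    using idl_sum_prod_subspace[of I m Q] by (intro noeth_maximal[OF noeth]) auto
  then obtain N where N: "idl.subspace N" "?K \<subseteq> N" "N \<inter> Q \<subseteq> ?K"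
    and max: "\<And>N'. idl.subspace N' \<Longrightarrow> N' \<inter> Q \<subseteq> ?K \<Longrightarrow> N \<subseteq> N' \<Longrightarrow> N' = N"
    by auto
  \<comment> \<open>Adding a power of \<open>x\<close> at which the colon ideals are stable does not
    enlarge the intersection with \<open>Q\<close>, so by maximality this power is in
    \<open>N\<close>.\<close>
  have "\<exists>e. x ^ e \<in> N" if x: "x \<in> m" for x
  proof -
    obtain e where e: "\<And>b. x ^ Suc e * b \<in> N \<Longrightarrow> x ^ e * b \<in> N"
      using idl_power_colon_stable[OF noeth N(1)] by blast
    have "idl.span (insert (x ^ e) N) = N"
    proof (rule max)
      show "idl.span (insert (x ^ e) N) \<inter> Q \<subseteq> ?K"
      proof
        fix y assume "y \<in> idl.span (insert (x ^ e) N) \<inter> Q"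
        then have y: "y \<in> idl.span (insert (x ^ e) N)" "y \<in> Q" by auto
        obtain k where k: "y - k * x ^ e \<in> N" using idl_insert_decomp[OF N(1) y(1)] by blast
        have xy: "x * y \<in> N" using idl_sum_prod_mult[OF x y(2)] N(2) by blast
        have "x * y - x * (y - k * x ^ e) \<in> N"
          by (rule idl.subspace_diff[OF N(1) xy idl.subspace_scale[OF N(1) k]])
        then have "x ^ Suc e * k \<in> N" by (simp add: algebra_simps)
        from e[OF this] have "x ^ e * k \<in> N" .
        then have "(y - k * x ^ e) + x ^ e * k \<in> N" using idl.subspace_add[OF N(1) k] by blast
        then have "y \<in> N" by (simp add: algebra_simps)
        then show "y \<in> ?K" using N(3) y(2) by blast
      qed
    qed (use idl.span_superset[of "insert (x ^ e) N"] in auto)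
    then show ?thesis using idl.span_base[of "x ^ e" "insert (x ^ e) N"] by auto
  qed
  then obtain s where "idl_filtration I m s \<subseteq> N"
    using filtration_subset_of_radical[OF noeth N(1)] IK N(2) by blast
  then have QK: "Q \<subseteq> ?K" using N(3) unfolding Q_def by blast
  obtain G where G: "finite G" "Q = idl.span G" using noeth_finitely_generated[OF noeth Q] by blast
  have "1 * g \<in> idl_sum_prod I m (idl.span G)" if "g \<in> G" for g
    using QK idl.span_base[OF that] by (auto simp: G(2))
  then obtain w where w: "1 - w \<in> m" "\<And>g. g \<in> G \<Longrightarrow> w * g \<in> I"
    using nakayama[OF m(1) Is G(1), of 1] idl.subspace_0[OF m(1)] by auto
  have "w \<notin> I"
  proof
    assume "w \<in> I"
    then have "w + (1 - w) \<in> m" using m(3) by (intro idl.subspace_add[OF m(1) _ w(1)]) auto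
    then show False using m(2) by simp
  qed
  then have "G \<subseteq> I" using w(2) prime_idlD(3)[OF I] by blast
  then have "Q \<subseteq> I" unfolding G(2) using Is by (rule idl.span_minimal)
  then show ?thesis using f by (auto simp: Q_def)
qed

section \<open>Minors and rank modulo a prime ideal\<close>

text \<open>The index lists may be unsorted and may repeat entries, so replacing a row or a column
  by any other requires no case distinction.\<close>

definition minor :: "(nat \<Rightarrow> 'n \<Rightarrow> 'a::comm_ring_1) \<Rightarrow> nat list \<Rightarrow> 'n list \<Rightarrow> 'a" where
  "minor M rs cs = det (mat (length rs) (length rs) (\<lambda>(a, b). M (rs ! a) (cs ! b)))"

text \<open>For prime \<open>p\<close>, linear independence of rows over the field of fractions of
  the quotient by \<open>p\<close>, with denominators cleared.\<close>

definition indep_mod :: "'a::comm_ring_1 set \<Rightarrow> nat set \<Rightarrow> (nat \<Rightarrow> 'n \<Rightarrow> 'a) \<Rightarrow> bool" where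
  "indep_mod p T M \<longleftrightarrow> (\<forall>c. (\<forall>j. (\<Sum>i\<in>T. c i * M i j) \<in> p) \<longrightarrow> (\<forall>i\<in>T. c i \<in> p))"

lemma minor_Nil: "minor M [] [] = 1"
  by (simp add: minor_def)

lemma minor_repeated_row: "\<not> distinct rs \<Longrightarrow> minor M rs cs = 0"
  unfolding minor_def distinct_conv_nth
  by (auto intro!: det_identical_rows[where n = "length rs"] eq_vecI)

lemma minor_repeated_column:
  assumes "length cs = length rs" "\<not> distinct cs" shows "minor M rs cs = 0"
proof -
  obtain i j where "i < length rs" "j < length rs" "i \<noteq> j" "cs ! i = cs ! j"
    using assms by (auto simp: distinct_conv_nth)
  then show ?thesis
    unfolding minor_def
    by (intro det_identical_columns[where n = "length rs" and i = i and j = j] eq_vecI) auto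
qed

lemma cofactor_cong:
  assumes "A \<in> carrier_mat n n" "B \<in> carrier_mat n n"
    and "\<And>i j. i < n \<Longrightarrow> j < n \<Longrightarrow> i \<noteq> a \<Longrightarrow> j \<noteq> b \<Longrightarrow> A $$ (i, j) = B $$ (i, j)"
  shows "cofactor A a b = cofactor B a b"
proof -
  have "mat_delete A a b = mat_delete B a b"
    using assms by (intro eq_matI) (auto simp: mat_delete_def)
  then show ?thesis by (simp add: cofactor_def)
qed

text \<open>Cofactors along the last column do not involve its entries, so one family
  \<open>C\<close> serves every \<open>j\<close>; \<open>undefined\<close> in the proof is an
  arbitrary choice of that column.\<close>

lemma minor_expand_last_column:
  fixes M :: "nat \<Rightarrow> 'n \<Rightarrow> 'a::comm_ring_1"
  assumes "length rs = Suc n" "length cs = n"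
  obtains C where "\<And>j. minor M rs (cs @ [j]) = (\<Sum>a<Suc n. C a * M (rs ! a) j)"
    "C n = minor M (take n rs) cs"
proof -
  define A where "A j = mat (Suc n) (Suc n) (\<lambda>(a, b). M (rs ! a) ((cs @ [j]) ! b))" for j
  have A: "A j \<in> carrier_mat (Suc n) (Suc n)" for j by (simp add: A_def)
  define C where "C a = cofactor (A undefined) a n" for a
  have C: "cofactor (A j) a n = C a" for j a
    unfolding C_def using assms by (intro cofactor_cong[OF A A]) (auto simp: A_def nth_append)
  have "minor M rs (cs @ [j]) = (\<Sum>a<Suc n. C a * M (rs ! a) j)" for j
  proof -
    have "minor M rs (cs @ [j]) = det (A j)" using assms by (simp add: minor_def A_def)
    also have "\<dots> = (\<Sum>a<Suc n. A j $$ (a, n) * cofactor (A j) a n)"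
      by (rule laplace_expansion_column[OF A]) simp
    also have "\<dots> = (\<Sum>a<Suc n. C a * M (rs ! a) j)"
    proof (intro sum.cong refl)
      fix a assume "a \<in> {..<Suc n}"
      then have "A j $$ (a, n) = M (rs ! a) j" using assms by (simp add: A_def nth_append)
      then show "A j $$ (a, n) * cofactor (A j) a n = C a * M (rs ! a) j" by (simp add: C mult.commute)
    qed
    finally show ?thesis .
  qed
  moreover have "C n = minor M (take n rs) cs"
  proof -
    have "mat_delete (A undefined) n n = mat n n (\<lambda>(a, b). M (take n rs ! a) (cs ! b))"
      using assms by (intro eq_matI) (auto simp: mat_delete_def A_def nth_append)
    then show ?thesis using assms by (simp add: C_def cofactor_def minor_def)
  qed
  ultimately show ?thesis using that by blast
qed

lemma sum_set_nth: "distinct rs \<Longrightarrow> (\<Sum>i\<in>set rs. g i) = (\<Sum>a<length rs. g (rs ! a))"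
  by (rule sum.reindex_bij_betw[symmetric]) (rule bij_betw_nth, auto)

text \<open>Multiplying a relation between the rows by the adjugate matrix turns each coefficient
  into its multiple by the minor.\<close>

lemma minor_imp_indep_mod:
  assumes p: "prime_idl p" and "length cs = length rs" and nz: "minor M rs cs \<notin> p"
  shows "indep_mod p (set rs) M"
  unfolding indep_mod_def
proof (intro allI impI ballI)
  note ps = prime_idlD(1)[OF p]
  fix c i assume c: "\<forall>j. (\<Sum>i\<in>set rs. c i * M i j) \<in> p" and i: "i \<in> set rs"
  have d: "distinct rs" using minor_repeated_row[of rs M cs] nz idl.subspace_0[OF ps] by (cases "distinct rs") auto
  define n where "n = length rs"
  define A where "A = mat n n (\<lambda>(a, b). M (rs ! a) (cs ! b))"
  have A: "A \<in> carrier_mat n n" by (simp add: A_def)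
  obtain k where k: "k < n" "i = rs ! k" using i by (auto simp: in_set_conv_nth n_def)
  have row: "(\<Sum>a<n. c (rs ! a) * A $$ (a, b)) \<in> p" if "b < n" for b
  proof -
    have "(\<Sum>a<n. c (rs ! a) * A $$ (a, b)) = (\<Sum>i\<in>set rs. c i * M i (cs ! b))"
      using that by (simp add: sum_set_nth[OF d] n_def[symmetric] A_def)
    then show ?thesis using c by simp
  qed
  have "(\<Sum>b<n. (\<Sum>a<n. c (rs ! a) * A $$ (a, b)) * adj_mat A $$ (b, k)) \<in> p"
    by (intro idl.subspace_sum[OF ps] idl_mult_right[OF ps] row) auto
  also have "(\<Sum>b<n. (\<Sum>a<n. c (rs ! a) * A $$ (a, b)) * adj_mat A $$ (b, k))
      = (\<Sum>a<n. c (rs ! a) * (\<Sum>b<n. A $$ (a, b) * adj_mat A $$ (b, k)))"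
    unfolding sum_distrib_right sum_distrib_left by (subst sum.swap) (simp add: mult.assoc)
  also have "\<dots> = (\<Sum>a<n. c (rs ! a) * (A * adj_mat A) $$ (a, k))"
    using A adj_mat(1)[OF A] k
    by (intro sum.cong refl) (auto simp: scalar_prod_def atLeast0LessThan)
  also have "\<dots> = (\<Sum>a<n. if a = k then c (rs ! a) * det A else 0)"
    using k by (intro sum.cong refl) (auto simp: adj_mat(2)[OF A])
  also have "\<dots> = det A * c i" using k by (simp add: mult.commute)
  finally have "det A * c i \<in> p" .
  moreover have "det A \<notin> p" using nz by (simp add: minor_def A_def n_def)
  ultimately show "c i \<in> p" using prime_idlD(3)[OF p] by blast
qed

text \<open>Take a largest minor outside \<open>p\<close> with rows in \<open>T\<close>. If a row
  \<open>i0\<close> were left over, all minors bordered by it would lie in \<open>p\<close>, and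
  their expansion along the last column would be a relation in which \<open>i0\<close> has the
  chosen minor as coefficient.\<close>

lemma indep_mod_imp_minor:
  assumes p: "prime_idl p" and T: "finite T" "indep_mod p T M"
  obtains rs cs where "set rs = T" "distinct rs" "length cs = length rs" "minor M rs cs \<notin> p"
proof -
  note ps = prime_idlD(1)[OF p]
  define R where "R t \<longleftrightarrow> (\<exists>rs cs. set rs \<subseteq> T \<and> length rs = t \<and> length cs = t \<and> minor M rs cs \<notin> p)" for t
  have dist: "distinct rs" if "minor M rs cs \<notin> p" for rs cs
    using minor_repeated_row[of rs M cs] that idl.subspace_0[OF ps] by (cases "distinct rs") auto
  have bound: "t \<le> card T" if "R t" for t
    using that dist T(1) unfolding R_def by (metis card_mono distinct_card)
  have "R 0" using prime_idlD(2)[OF p] by (auto simp: R_def minor_Nil)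
  define t where "t = (GREATEST t. R t)"
  have Rt: "R t" unfolding t_def using \<open>R 0\<close> bound by (rule GreatestI_nat)
  have tmax: "s \<le> t" if "R s" for s unfolding t_def using that bound by (rule Greatest_le_nat)
  obtain rs cs where rs: "set rs \<subseteq> T" "length rs = t" "length cs = t" "minor M rs cs \<notin> p"
    using Rt by (auto simp: R_def)
  have "set rs = T"
  proof (rule ccontr)
    assume "set rs \<noteq> T"
    then obtain i0 where i0: "i0 \<in> T" "i0 \<notin> set rs" using rs(1) by blast
    let ?l = "rs @ [i0]"
    have dl: "distinct ?l" using dist[OF rs(4)] i0 by simp
    obtain C where C: "\<And>j. minor M ?l (cs @ [j]) = (\<Sum>a<Suc t. C a * M (?l ! a) j)"
      "C t = minor M (take t ?l) cs"
      using minor_expand_last_column[of ?l t cs M] rs(2,3) by auto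
    have mem: "minor M ?l (cs @ [j]) \<in> p" for j
    proof (rule ccontr)
      assume "\<not> ?thesis"
      then have "R (Suc t)" unfolding R_def using rs i0
        by (intro exI[of _ ?l] exI[of _ "cs @ [j]"]) auto
      then show False using tmax by fastforce
    qed
    define ix where "ix = inv_into {..<Suc t} ((!) ?l)"
    have ix: "ix (?l ! a) = a" if "a < Suc t" for a
      unfolding ix_def using dl rs(2) that by (intro inv_into_f_f inj_on_nth) auto
    define c where "c i = (if i \<in> set ?l then C (ix i) else 0)" for i
    have "(\<Sum>i\<in>T. c i * M i j) \<in> p" for j
    proof -
      have "(\<Sum>i\<in>T. c i * M i j) = (\<Sum>i\<in>set ?l. c i * M i j)"
        using rs(1) i0 T(1) by (intro sum.mono_neutral_right) (auto simp: c_def)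
      also have "\<dots> = (\<Sum>a<Suc t. c (?l ! a) * M (?l ! a) j)"
        using sum_set_nth[OF dl, of "\<lambda>i. c i * M i j"] rs(2) by simp
      also have "\<dots> = (\<Sum>a<Suc t. C a * M (?l ! a) j)"
        using rs(2) by (intro sum.cong refl) (auto simp: c_def ix simp del: set_append)
      finally show ?thesis using mem[of j] C(1)[of j] by simp
    qed
    then have "c i0 \<in> p" using T(2) i0(1) unfolding indep_mod_def by blast
    moreover have "c i0 = minor M rs cs"
      using ix[of t] rs(2) C(2) by (simp add: c_def nth_append)
    ultimately show False using rs(4) by simp
  qed
  then show ?thesis using that rs dist by metis
qed

text \<open>For the Jacobian matrix, \<open>I\<close> gives the generic rank and
  \<open>point_idl P\<close> the rank at \<open>P\<close>, so both ranks are treated at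
  once.\<close>

definition rank_mod :: "'a::comm_ring_1 set \<Rightarrow> nat \<Rightarrow> (nat \<Rightarrow> 'n \<Rightarrow> 'a) \<Rightarrow> nat" where
  "rank_mod p m M = Max {card S |S. S \<subseteq> {..<m} \<and> indep_mod p S M}"

lemma finite_rank_mod_set: "finite {card S |S. S \<subseteq> {..<m::nat} \<and> Q S}"
  by (rule finite_subset[of _ "card ` Pow {..<m}"]) auto

lemma minor_le_rank_mod:
  assumes p: "prime_idl p" and rs: "set rs \<subseteq> {..<m}" "length cs = length rs" "minor M rs cs \<notin> p"
  shows "length rs \<le> rank_mod p m M"
proof -
  have "distinct rs"
    using minor_repeated_row[of rs M cs] rs(3) idl.subspace_0[OF prime_idlD(1)[OF p]] by (cases "distinct rs") auto
  then show ?thesis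
    unfolding rank_mod_def using minor_imp_indep_mod[OF p rs(2,3)] rs(1)
    by (intro Max_ge finite_rank_mod_set) (auto simp: distinct_card[symmetric])
qed

lemma rank_mod_minor:
  assumes p: "prime_idl p"
  obtains rs cs where "set rs \<subseteq> {..<m}" "length rs = rank_mod p m M" "length cs = length rs" "minor M rs cs \<notin> p"
proof -
  have "indep_mod p {} M" by (simp add: indep_mod_def)
  then have "{card S |S. S \<subseteq> {..<m} \<and> indep_mod p S M} \<noteq> {}" by blast
  from Max_in[OF finite_rank_mod_set this] obtain S where
    S: "S \<subseteq> {..<m}" "indep_mod p S M" "rank_mod p m M = card S" unfolding rank_mod_def by blast
  have "finite S" using S(1) by (rule finite_subset) simp
  then obtain rs cs where "set rs = S" "distinct rs" "length cs = length rs" "minor M rs cs \<notin> p"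
    using indep_mod_imp_minor[OF p _ S(2)] by blast
  then show ?thesis using S distinct_card[of rs] by (intro that[of rs cs]) auto
qed

section \<open>Derivations and nonsingular points\<close>

text \<open>Given the product rule, vanishing on constants amounts to linearity over
  \<open>k\<close>.\<close>

definition mpoly_deriv :: "(('n, 'k::comm_ring_1) mpoly \<Rightarrow> ('n, 'k) mpoly) \<Rightarrow> bool" where
  "mpoly_deriv E \<longleftrightarrow> (\<forall>f g. E (f + g) = E f + E g) \<and> (\<forall>f g. E (f * g) = E f * g + f * E g) \<and>
     (\<forall>c. E (mpoly_const c) = 0)"

lemma mpoly_derivD:
  assumes "mpoly_deriv E"
  shows "E (f + g) = E f + E g" "E (f * g) = E f * g + f * E g" "E (mpoly_const c) = 0"
    "E 0 = 0" "E (f - g) = E f - E g" "E (- f) = - E f"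
proof -
  show a: "E (f + g) = E f + E g" for f g using assms by (simp add: mpoly_deriv_def)
  show "E (f * g) = E f * g + f * E g" "E (mpoly_const c) = 0"
    using assms by (simp_all add: mpoly_deriv_def)
  show z: "E 0 = 0" using a[of 0 0] by simp
  show n: "E (- f) = - E f" for f using a[of f "- f"] z by (simp add: eq_neg_iff_add_eq_0 add.commute)
  show "E (f - g) = E f - E g" using a[of f "- g"] n by simp
qed

lemma mpoly_deriv_sum: "mpoly_deriv E \<Longrightarrow> E (sum f A) = (\<Sum>x\<in>A. E (f x))"
  by (induct A rule: infinite_finite_induct) (simp_all add: mpoly_derivD)

lemma mpoly_deriv_partial: "mpoly_deriv (mpoly_partial j)"
  by (simp add: mpoly_deriv_def mpoly_partial_add mpoly_partial_mult)

lemma mpoly_deriv_combination: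
  assumes "\<And>b. b \<in> A \<Longrightarrow> mpoly_deriv (E b)"
  shows "mpoly_deriv (\<lambda>f. \<Sum>b\<in>A. C b * E b f)"
  unfolding mpoly_deriv_def
proof (intro conjI allI)
  fix f g
  show "(\<Sum>b\<in>A. C b * E b (f + g)) = (\<Sum>b\<in>A. C b * E b f) + (\<Sum>b\<in>A. C b * E b g)"
    unfolding sum.distrib[symmetric]
    by (intro sum.cong refl) (simp add: mpoly_derivD[OF assms] distrib_left)
  show "(\<Sum>b\<in>A. C b * E b (f * g)) = (\<Sum>b\<in>A. C b * E b f) * g + f * (\<Sum>b\<in>A. C b * E b g)"
    unfolding sum_distrib_right sum_distrib_left sum.distrib[symmetric]
    by (intro sum.cong refl) (simp add: mpoly_derivD[OF assms] algebra_simps)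
  show "(\<Sum>b\<in>A. C b * E b (mpoly_const c)) = 0" for c
    by (intro sum.neutral) (simp add: mpoly_derivD[OF assms])
qed

lemma mpoly_deriv_eqI:
  assumes "mpoly_deriv E" "mpoly_deriv E'" "\<And>i. E (mpoly_var i) = E' (mpoly_var i)"
  shows "E f = E' f"
  using assms by (induct f rule: mpoly_induct) (simp_all add: mpoly_derivD)

lemma mpoly_deriv_chain:
  fixes E :: "('n::finite, 'k::comm_ring_1) mpoly \<Rightarrow> ('n, 'k) mpoly"
  assumes "mpoly_deriv E"
  shows "E f = (\<Sum>j\<in>UNIV. E (mpoly_var j) * mpoly_partial j f)"
proof (rule mpoly_deriv_eqI[OF assms])
  show "mpoly_deriv (\<lambda>f. \<Sum>j\<in>UNIV. E (mpoly_var j) * mpoly_partial j f)"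
    by (intro mpoly_deriv_combination mpoly_deriv_partial)
qed (simp add: mpoly_partial_var if_distrib[of "(*) _"] cong: if_cong)

definition derivs_on :: "('n, 'k::comm_ring_1) mpoly set \<Rightarrow> (('n, 'k) mpoly \<Rightarrow> ('n, 'k) mpoly) set" where
  "derivs_on I = {E. mpoly_deriv E \<and> (\<forall>f\<in>I. E f \<in> I)}"

lemma deriv_preserves_span:
  assumes E: "mpoly_deriv E" and G: "\<And>g. g \<in> G \<Longrightarrow> E g \<in> idl.span G" and f: "f \<in> idl.span G"
  shows "E f \<in> idl.span G"
  using f
proof (induct rule: idl.span_induct_alt)
  case (step c x y)
  have "E c * x + c * E x + E y \<in> idl.span G"
    by (intro idl.span_add idl.span_scale G step idl.span_base)
  then show ?case by (simp add: mpoly_derivD[OF E])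
qed (simp add: mpoly_derivD[OF E] idl.span_zero)

lemma idl_filtration_mult_mult:
  assumes "u \<in> idl_filtration I m s" "v \<in> idl_filtration I m t"
  shows "u * v \<in> idl_filtration I m (s + t)"
  using assms(1)
proof (induct s arbitrary: u)
  case 0
  then show ?case using idl.subspace_scale[OF idl_filtration_subspace assms(2)] by simp
next
  case (Suc s)
  have "idl_sum_prod I m (idl_filtration I m s) \<subseteq> {z. v * z \<in> idl_filtration I m (Suc s + t)}"
  proof (rule idl_sum_prod_minimal)
    show "I \<subseteq> {z. v * z \<in> idl_filtration I m (Suc s + t)}"
      using idl.subspace_scale[OF idl_filtration_subspace idl_filtration_base] by blast
    show "idl.subspace {z. v * z \<in> idl_filtration I m (Suc s + t)}"
      by (intro subspace_colon idl_filtration_subspace)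
    fix a b assume ab: "a \<in> m" "b \<in> idl_filtration I m s"
    have "a * (b * v) \<in> idl_filtration I m (Suc (s + t))"
      by (rule idl_filtration_mult[OF ab(1) Suc(1)[OF ab(2)]])
    then show "a * b \<in> {z. v * z \<in> idl_filtration I m (Suc s + t)}"
      by (simp add: mult_ac)
  qed
  then have "v * u \<in> idl_filtration I m (Suc s + t)" using Suc(2) by auto
  then show ?case by (simp only: mult.commute)
qed

section \<open>The maximal ideal of a point and the derivations available there\<close>

definition point_idl :: "'k::field ^ 'n::finite \<Rightarrow> ('n, 'k) mpoly set" where
  "point_idl P = {f. mpoly_eval P f = 0}"

lemma prime_point_idl: "prime_idl (point_idl P)"
  by (auto simp: prime_idl_def point_idl_def idl.subspace_def)

definition shifted_var :: "'k::field ^ 'n::finite \<Rightarrow> 'n \<Rightarrow> ('n, 'k) mpoly" where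
  "shifted_var P l = mpoly_var l - mpoly_const (vec_nth P l)"

lemma shifted_var_in: "shifted_var P l \<in> point_idl P"
  by (simp add: shifted_var_def point_idl_def)

text \<open>Elements outside the maximal ideal are invertible on the graded pieces of the filtration.\<close>

lemma idl_filtration_cancel:
  fixes h :: "('n::finite, 'k::field) mpoly"
  assumes h: "h \<notin> point_idl P" and x: "x \<in> idl_filtration I (point_idl P) s"
    and hx: "h * x \<in> idl_filtration I (point_idl P) (Suc s)"
  shows "x \<in> idl_filtration I (point_idl P) (Suc s)"
proof -
  let ?V = "idl_filtration I (point_idl P) (Suc s)"
  note V = idl_filtration_subspace[of I "point_idl P" "Suc s"]
  define c where "c = mpoly_eval P h"
  have c: "c \<noteq> 0" using h by (simp add: c_def point_idl_def)
  have "h - mpoly_const c \<in> point_idl P" by (simp add: point_idl_def c_def)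
  then have "(h - mpoly_const c) * x \<in> ?V" using x by (rule idl_filtration_mult)
  then have "h * x - (h - mpoly_const c) * x \<in> ?V" by (rule idl.subspace_diff[OF V hx])
  then have "mpoly_const c * x \<in> ?V" by (simp add: algebra_simps)
  then have "mpoly_const (1 / c) * (mpoly_const c * x) \<in> ?V" by (rule idl.subspace_scale[OF V])
  moreover have "mpoly_const (1 / c) * mpoly_const c = (1 :: ('n, 'k) mpoly)"
    using c by (simp flip: mpoly_const_mult)
  ultimately show ?thesis by (simp flip: mult.assoc)
qed

text \<open>The partial derivatives need not be evaluated at \<open>P\<close>: the error is a
  product of two elements of \<open>point_idl P\<close>.\<close>

lemma taylor_first_order:
  fixes P :: "'k::field ^ 'n::finite"
  shows "f - mpoly_const (mpoly_eval P f) - (\<Sum>l\<in>UNIV. mpoly_partial l f * shifted_var P l)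
    \<in> idl_filtration I (point_idl P) 2"
proof (induct f rule: mpoly_induct)
  case (const c)
  show ?case by (simp add: idl.subspace_0[OF idl_filtration_subspace])
next
  case (var i)
  have "(\<Sum>l\<in>UNIV. mpoly_partial l (mpoly_var i) * shifted_var P l) = shifted_var P i"
    by (simp add: mpoly_partial_var if_distrib[of "\<lambda>z. z * _"] cong: if_cong)
  then show ?case by (simp add: shifted_var_def idl.subspace_0[OF idl_filtration_subspace])
next
  case (add f g)
  from idl.subspace_add[OF idl_filtration_subspace this] show ?case
    by (simp add: mpoly_partial_add mpoly_const_add sum.distrib algebra_simps)
next
  case (mult f g)
  let ?V = "idl_filtration I (point_idl P) 2"
  note V = idl_filtration_subspace[of I "point_idl P" 2]
  define f0 g0 :: "('n, 'k) mpoly" where "f0 = mpoly_const (mpoly_eval P f)" and "g0 = mpoly_const (mpoly_eval P g)"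
  define F G where "F = (\<Sum>l\<in>UNIV. mpoly_partial l f * shifted_var P l)"
    and "G = (\<Sum>l\<in>UNIV. mpoly_partial l g * shifted_var P l)"
  have "f - f0 \<in> point_idl P" "g - g0 \<in> point_idl P"
    by (simp_all add: f0_def g0_def point_idl_def)
  then have "(f - f0) * ((g - g0) * 1) \<in> idl_filtration I (point_idl P) (Suc (Suc 0))"
    by (intro idl_filtration_mult) simp_all
  then have 1: "(f - f0) * (g - g0) \<in> ?V" by (simp add: numeral_2_eq_2)
  have m: "f - f0 - F \<in> ?V" "g - g0 - G \<in> ?V"
    using mult by (simp_all add: f0_def g0_def F_def G_def)
  \<comment> \<open>This combination expands to
    \<open>f * g - f0 * g0 - (g * F + f * G)\<close>.\<close>
  have "g * (f - f0 - F) + f * (g - g0 - G) - (f - f0) * (g - g0) \<in> ?V"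
    by (rule idl.subspace_diff[OF V idl.subspace_add[OF V idl.subspace_scale[OF V m(1)] idl.subspace_scale[OF V m(2)]] 1])
  moreover have "(\<Sum>l\<in>UNIV. mpoly_partial l (f * g) * shifted_var P l) = g * F + f * G"
    by (simp add: F_def G_def mpoly_partial_mult sum_distrib_left sum.distrib algebra_simps)
  ultimately show ?case
    by (simp add: mpoly_const_mult f0_def[symmetric] g0_def[symmetric] algebra_simps)
qed

text \<open>The fresh index \<open>m\<close> carries an arbitrary last row \<open>v\<close>. When
  \<open>v\<close> is the gradient of a polynomial, the expansion is a derivation applied to that
  polynomial.\<close>

lemma minor_expand_last_row:
  fixes M :: "nat \<Rightarrow> 'n \<Rightarrow> 'a::comm_ring_1"
  assumes "length rs = n" "length cs = n" "m \<notin> set rs"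
  obtains C where "\<And>v. minor (M(m := v)) (rs @ [m]) (cs @ [j]) = (\<Sum>b<Suc n. C b * v ((cs @ [j]) ! b))"
    "C n = minor M rs cs"
proof -
  define A where "A v = mat (Suc n) (Suc n) (\<lambda>(a, b). (M(m := v)) ((rs @ [m]) ! a) ((cs @ [j]) ! b))" for v
  have A: "A v \<in> carrier_mat (Suc n) (Suc n)" for v by (simp add: A_def)
  define C where "C b = cofactor (A undefined) n b" for b
  have ne: "rs ! a \<noteq> m" if "a < n" for a using assms that by auto
  have C: "cofactor (A v) n b = C b" for v b
    unfolding C_def using assms ne by (intro cofactor_cong[OF A A]) (auto simp: A_def nth_append)
  have "minor (M(m := v)) (rs @ [m]) (cs @ [j]) = (\<Sum>b<Suc n. C b * v ((cs @ [j]) ! b))" for v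
  proof -
    have "minor (M(m := v)) (rs @ [m]) (cs @ [j]) = det (A v)" using assms by (simp add: minor_def A_def)
    also have "\<dots> = (\<Sum>b<Suc n. A v $$ (n, b) * cofactor (A v) n b)"
      by (rule laplace_expansion_row[OF A]) simp
    also have "\<dots> = (\<Sum>b<Suc n. C b * v ((cs @ [j]) ! b))"
    proof (intro sum.cong refl)
      fix b assume "b \<in> {..<Suc n}"
      then have "A v $$ (n, b) = v ((cs @ [j]) ! b)" using assms(1) by (simp add: A_def nth_append)
      then show "A v $$ (n, b) * cofactor (A v) n b = C b * v ((cs @ [j]) ! b)" by (simp add: C mult.commute)
    qed
    finally show ?thesis .
  qed
  moreover have "C n = minor M rs cs"
  proof -
    have "mat_delete (A undefined) n n = mat n n (\<lambda>(a, b). M (rs ! a) (cs ! b))"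
      using assms ne by (intro eq_matI) (auto simp: mat_delete_def A_def nth_append)
    then show ?thesis using assms by (simp add: C_def cofactor_def minor_def)
  qed
  ultimately show ?thesis using that by blast
qed

abbreviation jacobian :: "('n, 'k::comm_ring_1) mpoly list \<Rightarrow> nat \<Rightarrow> 'n \<Rightarrow> ('n, 'k) mpoly" where
  "jacobian fs i j \<equiv> mpoly_partial j (fs ! i)"

text \<open>\<open>E g\<close> is the minor on \<open>rs\<close>, \<open>cs\<close> bordered by
  column \<open>j\<close> and by the gradient of \<open>g\<close>. On a generator it is a Jacobian
  minor larger than the generic rank, hence in \<open>I\<close>; on a variable outside
  \<open>cs\<close> only the corner entry can survive.\<close>

lemma determinantal_derivation:
  fixes fs :: "('n::finite, 'k::field) mpoly list"
  assumes I: "prime_idl I" "I = idl.span (set fs)"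
    and rs: "set rs \<subseteq> {..<length fs}" "length cs = length rs" "rank_mod I (length fs) (jacobian fs) \<le> length rs"
    and j: "j \<notin> set cs"
  obtains E where "E \<in> derivs_on I"
    "\<And>l. l \<notin> set cs \<Longrightarrow> E (mpoly_var l) = (if l = j then minor (jacobian fs) rs cs else 0)"
proof -
  let ?m = "length fs" and ?n = "length rs" and ?J = "jacobian fs"
  have m: "?m \<notin> set rs" using rs(1) by auto
  obtain C where C: "\<And>v. minor (?J(?m := v)) (rs @ [?m]) (cs @ [j]) = (\<Sum>b<Suc ?n. C b * v ((cs @ [j]) ! b))"
    "C ?n = minor ?J rs cs"
    using minor_expand_last_row[OF refl rs(2) m, of ?J j] by blast
  define E where "E g = (\<Sum>b<Suc ?n. C b * mpoly_partial ((cs @ [j]) ! b) g)" for g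
  have dE: "mpoly_deriv E"
    using mpoly_deriv_combination[of "{..<Suc ?n}" "\<lambda>b. mpoly_partial ((cs @ [j]) ! b)" C]
    unfolding E_def[abs_def] by (simp add: mpoly_deriv_partial)
  have "E g \<in> I" if g: "g \<in> set fs" for g
  proof -
    obtain i where i: "i < ?m" "g = fs ! i" using g by (auto simp: in_set_conv_nth)
    have "E g = minor (?J(?m := ?J i)) (rs @ [?m]) (cs @ [j])"
      unfolding C(1) E_def i(2) ..
    also have "\<dots> = minor ?J (rs @ [i]) (cs @ [j])"
    proof -
      have "(?J(?m := ?J i)) ((rs @ [?m]) ! a) = ?J ((rs @ [i]) ! a)" if "a < Suc ?n" for a
      proof (cases "a < ?n")
        case True
        then have "rs ! a \<noteq> ?m" using m by (metis nth_mem)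
        then show ?thesis using True by (simp add: nth_append)
      next
        case False
        then have "a = ?n" using that by simp
        then show ?thesis by simp
      qed
      then have "mat (Suc ?n) (Suc ?n) (\<lambda>(a, b). (?J(?m := ?J i)) ((rs @ [?m]) ! a) ((cs @ [j]) ! b))
        = mat (Suc ?n) (Suc ?n) (\<lambda>(a, b). ?J ((rs @ [i]) ! a) ((cs @ [j]) ! b))"
        by (intro eq_matI) simp_all
      then show ?thesis by (simp add: minor_def)
    qed
    also have "\<dots> \<in> I"
    proof (rule ccontr)
      assume "minor ?J (rs @ [i]) (cs @ [j]) \<notin> I"
      then have "length (rs @ [i]) \<le> rank_mod I ?m ?J"
        using rs i by (intro minor_le_rank_mod[OF I(1)]) auto
      then show False using rs(3) by simp
    qed
    finally show ?thesis .
  qed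
  then have "E f \<in> I" if "f \<in> I" for f
    using deriv_preserves_span[OF dE, of "set fs" f] that I(2) by simp
  then have "E \<in> derivs_on I" using dE by (simp add: derivs_on_def)
  moreover have "E (mpoly_var l) = (if l = j then minor ?J rs cs else 0)" if "l \<notin> set cs" for l
  proof -
    have "cs ! b \<noteq> l" if "b < ?n" for b using \<open>l \<notin> set cs\<close> that rs(2) by (metis nth_mem)
    then have "(\<Sum>b<?n. C b * mpoly_partial ((cs @ [j]) ! b) (mpoly_var l)) = 0"
      using rs(2) by (intro sum.neutral) (auto simp: nth_append mpoly_partial_var)
    then have "E (mpoly_var l) = C ?n * mpoly_partial j (mpoly_var l)"
      using rs(2) by (simp add: E_def nth_append)
    then show ?thesis by (simp add: C(2) mpoly_partial_var)
  qed
  ultimately show ?thesis using that by blast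
qed

lemma deriv_preserves_filtration:
  assumes E: "E \<in> derivs_on I" and m: "\<And>f. f \<in> m \<Longrightarrow> E f \<in> m" and f: "f \<in> idl_filtration I m s"
  shows "E f \<in> idl_filtration I m s"
  using f
proof (induct s arbitrary: f)
  case (Suc s)
  let ?V = "idl_filtration I m (Suc s)"
  note V = idl_filtration_subspace[of I m "Suc s"]
  have dE: "mpoly_deriv E" using E by (simp add: derivs_on_def)
  have "E f \<in> ?V \<and> f \<in> ?V"
    using Suc(2) unfolding idl_filtration.simps idl_sum_prod_def[of I m "idl_filtration I m s"]
  proof (induct rule: idl.span_induct_alt)
    case base
    show ?case by (simp add: mpoly_derivD[OF dE] idl.span_zero)
  next
    case (step c x y)
    have V': "idl.span (I \<union> {a * b |a b. a \<in> m \<and> b \<in> idl_filtration I m s}) = ?V"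
      by (simp add: idl_sum_prod_def)
    note step = step[unfolded V']
    have "E x \<in> ?V \<and> x \<in> ?V"
    proof (cases "x \<in> I")
      case True
      then show ?thesis using E by (intro conjI idl_filtration_base) (auto simp: derivs_on_def)
    next
      case False
      then obtain a b where ab: "x = a * b" "a \<in> m" "b \<in> idl_filtration I m s" using step(1) by auto
      have "E a * b + a * E b \<in> ?V"
        by (intro idl.subspace_add[OF V] idl_filtration_mult ab m Suc(1))
      then show ?thesis using idl_filtration_mult[OF ab(2,3)] ab(1) by (simp add: mpoly_derivD[OF dE])
    qed
    then have "E c * x + c * E x + E y \<in> ?V" "c * x + y \<in> ?V"
      using step(2)
      by (metis idl.subspace_add[OF V] idl.subspace_scale[OF V])+
    then show ?case unfolding V' by (simp add: mpoly_derivD[OF dE])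
  qed
  then show ?case ..
qed simp

theorem stable_idl_at_nonsingular_point:
  fixes fs :: "('n::finite, 'k::field_char_0) mpoly list"
  assumes I: "prime_idl I" "I = idl.span (set fs)" and IP: "I \<subseteq> point_idl P"
    and rank: "rank_mod I (length fs) (jacobian fs) \<le> rank_mod (point_idl P) (length fs) (jacobian fs)"
    and Q: "idl.subspace Q" "Q \<subseteq> point_idl P"
    and stable: "\<And>E f. E \<in> derivs_on I \<Longrightarrow> f \<in> Q \<Longrightarrow> E f \<in> Q"
  shows "Q \<subseteq> I"
proof -
  let ?m = "point_idl P" and ?J = "jacobian fs" and ?V = "idl_filtration I (point_idl P)"
  let ?t = "shifted_var P"
  note Vs = idl_filtration_subspace[of I ?m]
  note ms = prime_idlD(1)[OF prime_point_idl[of P]]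
  obtain rs cs where rs: "set rs \<subseteq> {..<length fs}" "length rs = rank_mod ?m (length fs) ?J"
    "length cs = length rs" "minor ?J rs cs \<notin> ?m"
    by (rule rank_mod_minor[OF prime_point_idl])
  define h where "h = minor ?J rs cs"
  have h: "h \<notin> ?m" using rs(4) by (simp add: h_def)
  \<comment> \<open>The size of the minor \<open>h\<close> is the rank at \<open>P\<close>, hence at
    least the generic rank, as the construction of the derivations requires.\<close>
  have "\<exists>E. E \<in> derivs_on I \<and> (\<forall>l. l \<notin> set cs \<longrightarrow> E (mpoly_var l) = (if l = j then h else 0))"
    if "j \<notin> set cs" for j
    using determinantal_derivation[OF I rs(1,3) _ that] rank rs(2) unfolding h_def by metis
  then obtain E where E: "\<And>j. j \<notin> set cs \<Longrightarrow> E j \<in> derivs_on I"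
    "\<And>j l. j \<notin> set cs \<Longrightarrow> l \<notin> set cs \<Longrightarrow> E j (mpoly_var l) = (if l = j then h else 0)"
    by metis
  have dE: "mpoly_deriv (E j)" if "j \<in> - set cs" for j using E(1) that by (simp add: derivs_on_def)
  define \<Theta> where "\<Theta> f = (\<Sum>j\<in>- set cs. ?t j * E j f)" for f
  have d\<Theta>: "mpoly_deriv \<Theta>" unfolding \<Theta>_def[abs_def] by (intro mpoly_deriv_combination dE)
  have \<Theta>m: "\<Theta> f \<in> ?m" for f
    unfolding \<Theta>_def by (intro idl.subspace_sum[OF ms] idl_mult_right[OF ms] shifted_var_in)
  have "\<Theta> f \<in> I" if "f \<in> I" for f
    unfolding \<Theta>_def using E(1) that
    by (intro idl.subspace_sum[OF prime_idlD(1)[OF I(1)]] idl.subspace_scale[OF prime_idlD(1)[OF I(1)]])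
      (auto simp: derivs_on_def)
  then have \<Theta>: "\<Theta> \<in> derivs_on I" using d\<Theta> by (simp add: derivs_on_def)
  have \<Theta>V: "\<Theta> f \<in> ?V s" if "f \<in> ?V s" for f s
    using deriv_preserves_filtration[OF \<Theta> \<Theta>m that] .
  have mm: "a * b \<in> ?V 2" if "a \<in> ?m" "b \<in> ?m" for a b
    using idl_filtration_mult[OF that(1) idl_filtration_mult[OF that(2), of 1 I 0]]
    by (simp add: numeral_2_eq_2)
  have m1: "f \<in> ?V 1" if "f \<in> ?m" for f using idl_filtration_1[OF ms IP] that by simp
  have tail: "\<Theta> (?t l) = h * ?t l" if "l \<notin> set cs" for l
  proof -
    have "\<Theta> (?t l) = (\<Sum>j\<in>- set cs. if l = j then ?t j * h else 0)"
      unfolding \<Theta>_def using that dE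
      by (intro sum.cong) (auto simp: shifted_var_def mpoly_derivD E(2))
    then show ?thesis using that by (simp add: mult.commute)
  qed
  text \<open>The columns in \<open>cs\<close> are eliminated with the rows in \<open>rs\<close>, whose polynomials vanish on the variety.\<close>
  have head: "\<Theta> (?t c) - h * ?t c \<in> ?V 2" if c: "c \<in> set cs" for c
  proof -
    define n where "n = length rs"
    obtain k where k: "k < n" "c = cs ! k" using c rs(3) by (auto simp: in_set_conv_nth n_def)
    define A where "A = mat n n (\<lambda>(a, b). ?J (rs ! a) (cs ! b))"
    have A: "A \<in> carrier_mat n n" and hA: "h = det A" by (simp_all add: A_def h_def minor_def n_def)
    have "h \<noteq> 0" using h by (auto simp: point_idl_def)
    have dc: "distinct cs"
      using minor_repeated_column[OF rs(3), of ?J] \<open>h \<noteq> 0\<close> by (auto simp: h_def)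
    \<comment> \<open>The first-order expansion of a generator is a linear relation between the
      shifted variables modulo \<open>?V 2\<close>; \<open>U a\<close> is its part in the
      coordinates outside \<open>cs\<close>, on which \<Theta> is known.\<close>
    define U where "U a = (\<Sum>l\<in>- set cs. ?J (rs ! a) l * ?t l)" for a
    have row: "(\<Sum>b<n. A $$ (a, b) * ?t (cs ! b)) + U a \<in> ?V 2" if a: "a < n" for a
    proof -
      let ?f = "fs ! (rs ! a)"
      have "rs ! a < length fs" using subsetD[OF rs(1) nth_mem[of a rs]] a by (simp add: n_def)
      then have fI: "?f \<in> I" unfolding I(2) by (simp add: idl.span_base)
      then have "mpoly_eval P ?f = 0" using IP by (auto simp: point_idl_def)
      then have "?f - (\<Sum>l\<in>UNIV. ?J (rs ! a) l * ?t l) \<in> ?V 2"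
        using taylor_first_order[of ?f P I] by simp
      then have "?f - (?f - (\<Sum>l\<in>UNIV. ?J (rs ! a) l * ?t l)) \<in> ?V 2"
        by (rule idl.subspace_diff[OF Vs idl_filtration_base[OF fI]])
      then have "(\<Sum>l\<in>UNIV. ?J (rs ! a) l * ?t l) \<in> ?V 2" by simp
      also have "(\<Sum>l\<in>UNIV. ?J (rs ! a) l * ?t l) = (\<Sum>l\<in>set cs. ?J (rs ! a) l * ?t l) + U a"
        unfolding U_def by (subst sum.union_disjoint[symmetric]) auto
      also have "(\<Sum>l\<in>set cs. ?J (rs ! a) l * ?t l) = (\<Sum>b<n. A $$ (a, b) * ?t (cs ! b))"
        using a rs(3) by (simp add: sum_set_nth[OF dc] n_def[symmetric] A_def)
      finally show ?thesis .
    qed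
    \<comment> \<open>Cramer's rule: row \<open>k\<close> of the adjugate solves the relations for
      \<open>h * ?t c\<close>, which equals \<open>- W\<close> modulo \<open>?V 2\<close>.\<close>
    define W where "W = (\<Sum>a<n. adj_mat A $$ (k, a) * U a)"
    have "(\<Sum>a<n. adj_mat A $$ (k, a) * ((\<Sum>b<n. A $$ (a, b) * ?t (cs ! b)) + U a)) \<in> ?V 2"
      by (intro idl.subspace_sum[OF Vs] idl.subspace_scale[OF Vs] row) simp
    also have "(\<Sum>a<n. adj_mat A $$ (k, a) * ((\<Sum>b<n. A $$ (a, b) * ?t (cs ! b)) + U a))
      = (\<Sum>b<n. (\<Sum>a<n. adj_mat A $$ (k, a) * A $$ (a, b)) * ?t (cs ! b)) + W"
      unfolding W_def distrib_left sum.distrib sum_distrib_left sum_distrib_right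
      by (subst sum.swap) (simp add: mult.assoc)
    also have "(\<Sum>b<n. (\<Sum>a<n. adj_mat A $$ (k, a) * A $$ (a, b)) * ?t (cs ! b))
      = (\<Sum>b<n. (adj_mat A * A) $$ (k, b) * ?t (cs ! b))"
      using A adj_mat(1)[OF A] k
      by (intro sum.cong refl) (auto simp: scalar_prod_def atLeast0LessThan)
    also have "\<dots> = (\<Sum>b<n. if b = k then h * ?t (cs ! b) else 0)"
      using k by (intro sum.cong refl) (auto simp: adj_mat(3)[OF A] hA)
    also have "\<dots> = h * ?t c" using k by simp
    finally have hW: "h * ?t c + W \<in> ?V 2" .
    have \<Theta>W: "\<Theta> W - h * W \<in> ?V 2"
    proof -
      have U: "\<Theta> (U a) - h * U a \<in> ?V 2" for a
      proof -
        have "\<Theta> (U a) - h * U a = (\<Sum>l\<in>- set cs. \<Theta> (?J (rs ! a) l) * ?t l)"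
          unfolding U_def mpoly_deriv_sum[OF d\<Theta>] sum_distrib_left sum_subtractf[symmetric]
          by (intro sum.cong refl) (simp add: mpoly_derivD[OF d\<Theta>] tail algebra_simps)
        also have "\<dots> \<in> ?V 2" by (intro idl.subspace_sum[OF Vs] mm \<Theta>m shifted_var_in)
        finally show ?thesis .
      qed
      have Um: "U a \<in> ?m" for a
        unfolding U_def by (intro idl.subspace_sum[OF ms] idl.subspace_scale[OF ms] shifted_var_in)
      have "\<Theta> W - h * W = (\<Sum>a<n. \<Theta> (adj_mat A $$ (k, a)) * U a + adj_mat A $$ (k, a) * (\<Theta> (U a) - h * U a))"
        unfolding W_def mpoly_deriv_sum[OF d\<Theta>] sum_distrib_left sum_subtractf[symmetric]
        by (intro sum.cong refl) (simp add: mpoly_derivD[OF d\<Theta>] algebra_simps)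
      also have "\<dots> \<in> ?V 2"
        by (intro idl.subspace_sum[OF Vs] idl.subspace_add[OF Vs] idl.subspace_scale[OF Vs] mm \<Theta>m Um U)
      finally show ?thesis .
    qed
    \<comment> \<open>All other terms cancel and \<open>h * (\<Theta> (?t c) - h * ?t c)\<close>
      remains, from which \<open>h\<close> can be removed.\<close>
    have "\<Theta> (h * ?t c + W) - h * (h * ?t c + W) - (\<Theta> W - h * W) - \<Theta> h * ?t c \<in> ?V 2"
      by (rule idl.subspace_diff[OF Vs idl.subspace_diff[OF Vs idl.subspace_diff[OF Vs
          \<Theta>V[OF hW] idl.subspace_scale[OF Vs hW]] \<Theta>W] mm[OF \<Theta>m shifted_var_in]])
    then have "h * (\<Theta> (?t c) - h * ?t c) \<in> ?V (Suc 1)"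
      by (simp add: mpoly_derivD[OF d\<Theta>] algebra_simps numeral_2_eq_2)
    moreover have "\<Theta> (?t c) - h * ?t c \<in> ?V 1"
      by (intro m1 idl.subspace_diff[OF ms] idl.subspace_scale[OF ms] \<Theta>m shifted_var_in)
    ultimately have "\<Theta> (?t c) - h * ?t c \<in> ?V (Suc 1)" using idl_filtration_cancel[OF h] by blast
    then show ?thesis by (simp add: numeral_2_eq_2)
  qed
  have var: "\<Theta> (?t l) - h * ?t l \<in> ?V 2" for l
    using tail[of l] head[of l] idl.subspace_0[OF Vs] by (cases "l \<in> set cs") auto
  have deg1: "\<Theta> f - h * f \<in> ?V 2" if f: "f \<in> ?m" for f
  proof -
    define F where "F = (\<Sum>l\<in>UNIV. mpoly_partial l f * ?t l)"
    have fF: "f - F \<in> ?V 2"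
      using taylor_first_order[of f P I] f by (simp add: F_def point_idl_def)
    have "\<Theta> F - h * F = (\<Sum>l\<in>UNIV. \<Theta> (mpoly_partial l f) * ?t l + mpoly_partial l f * (\<Theta> (?t l) - h * ?t l))"
      unfolding F_def mpoly_deriv_sum[OF d\<Theta>] sum_distrib_left sum_subtractf[symmetric]
      by (intro sum.cong refl) (simp add: mpoly_derivD[OF d\<Theta>] algebra_simps)
    also have "\<dots> \<in> ?V 2"
      by (intro idl.subspace_sum[OF Vs] idl.subspace_add[OF Vs] idl.subspace_scale[OF Vs] mm \<Theta>m shifted_var_in var)
    finally have F: "\<Theta> F - h * F \<in> ?V 2" .
    have "\<Theta> (f - F) - h * (f - F) + (\<Theta> F - h * F) \<in> ?V 2"
      by (rule idl.subspace_add[OF Vs idl.subspace_diff[OF Vs \<Theta>V[OF fF] idl.subspace_scale[OF Vs fF]] F])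
    then show ?thesis by (simp add: mpoly_derivD[OF d\<Theta>] algebra_simps)
  qed
  have euler: "\<Theta> f - of_nat s * h * f \<in> ?V (Suc s)" if "f \<in> ?V s" for f s
    using that
  proof (induct s arbitrary: f)
    case 0
    show ?case using m1[OF \<Theta>m] by simp
  next
    case (Suc s)
    let ?W = "?V (Suc (Suc s))"
    have V': "idl.span (I \<union> {a * b |a b. a \<in> ?m \<and> b \<in> ?V s}) = ?V (Suc s)"
      by (simp add: idl_sum_prod_def)
    have "f \<in> idl.span (I \<union> {a * b |a b. a \<in> ?m \<and> b \<in> ?V s})" using Suc(2) V' by simp
    \<comment> \<open>Membership in \<open>?V (Suc s)\<close> is carried along because the product
      rule produces \<open>\<Theta> c * x\<close>, which must lie one step deeper than
      \<open>x\<close>.\<close>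
    then have "\<Theta> f - of_nat (Suc s) * h * f \<in> ?W \<and> f \<in> ?V (Suc s)"
    proof (induct rule: idl.span_induct_alt)
      case base
      show ?case by (simp add: mpoly_derivD[OF d\<Theta>] idl.subspace_0[OF idl_sum_prod_subspace])
    next
      case (step c x y)
      have "\<Theta> x - of_nat (Suc s) * h * x \<in> ?W \<and> x \<in> ?V (Suc s)"
      proof (cases "x \<in> I")
        case True
        then show ?thesis using \<open>\<And>f. f \<in> I \<Longrightarrow> \<Theta> f \<in> I\<close>
          by (intro conjI idl.subspace_diff[OF Vs] idl.subspace_scale[OF Vs] idl_filtration_base)
      next
        case False
        then obtain a b where ab: "x = a * b" "a \<in> ?m" "b \<in> ?V s" using step(1) by auto
        have 1: "(\<Theta> a - h * a) * b \<in> ?W"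
          using idl_filtration_mult_mult[OF deg1[OF ab(2)] ab(3)] by (simp add: numeral_2_eq_2)
        have 2: "a * (\<Theta> b - of_nat s * h * b) \<in> ?W"
          by (rule idl_filtration_mult[OF ab(2) Suc(1)[OF ab(3)]])
        have "(\<Theta> a - h * a) * b + a * (\<Theta> b - of_nat s * h * b) \<in> ?W"
          by (rule idl.subspace_add[OF Vs 1 2])
        then have "\<Theta> x - of_nat (Suc s) * h * x \<in> ?W"
          by (simp add: ab(1) mpoly_derivD[OF d\<Theta>] algebra_simps del: idl_filtration.simps)
        then show ?thesis using idl_filtration_mult[OF ab(2,3)] ab(1) by blast
      qed
      note x = conjunct1[OF this] conjunct2[OF this] and y = conjunct1[OF step(2)] conjunct2[OF step(2)]
      have "\<Theta> c * x + c * (\<Theta> x - of_nat (Suc s) * h * x) + (\<Theta> y - of_nat (Suc s) * h * y) \<in> ?W"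
        by (rule idl.subspace_add[OF Vs idl.subspace_add[OF Vs idl_filtration_mult[OF \<Theta>m x(2)]
            idl.subspace_scale[OF Vs x(1)]] y(1)])
      then have "\<Theta> (c * x + y) - of_nat (Suc s) * h * (c * x + y) \<in> ?W"
        by (simp add: mpoly_derivD[OF d\<Theta>] algebra_simps del: idl_filtration.simps)
      moreover have "c * x + y \<in> ?V (Suc s)"
        by (rule idl.subspace_add[OF Vs idl.subspace_scale[OF Vs x(2)] y(2)])
      ultimately show ?case ..
    qed
    then show ?case ..
  qed
  have QV: "Q \<subseteq> ?V s" for s
  proof (induct s)
    case (Suc s)
    show ?case
    \<comment> \<open>The factor \<open>of_nat s\<close> is useless at \<open>s = 0\<close>; there
      the assumption that \<open>Q\<close> vanishes at \<open>P\<close> takes over.\<close>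
    proof (cases "s = 0")
      case True
      then show ?thesis using Q(2) m1 by auto
    next
      case False
      show ?thesis
      proof
        fix f assume f: "f \<in> Q"
        \<comment> \<open>By stability each \<open>E j f\<close> is again in \<open>Q\<close>, hence
          in \<open>?V s\<close>, and the factor \<open>?t j\<close> adds one step.\<close>
        have "\<Theta> f \<in> ?V (Suc s)"
          unfolding \<Theta>_def
          using Suc stable[OF E(1) f]
          by (intro idl.subspace_sum[OF Vs] idl_filtration_mult shifted_var_in) auto
        moreover have "\<Theta> f - of_nat s * h * f \<in> ?V (Suc s)" using euler Suc f by blast
        ultimately have "\<Theta> f - (\<Theta> f - of_nat s * h * f) \<in> ?V (Suc s)"
          by (rule idl.subspace_diff[OF Vs])
        then have "(of_nat s * h) * f \<in> ?V (Suc s)" by simp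
        \<comment> \<open>Characteristic 0 enters here.\<close>
        moreover have "of_nat s * h \<notin> ?m"
        proof -
          have "mpoly_eval P (of_nat s) = (of_nat s :: 'k)" by (induct s) simp_all
          then show ?thesis using h False by (simp add: point_idl_def)
        qed
        ultimately show "f \<in> ?V (Suc s)" using idl_filtration_cancel Suc f by blast
      qed
    qed
  qed simp
  show "Q \<subseteq> I"
    using krull_intersection[OF noeth_mpoly I(1) ms prime_idlD(2)[OF prime_point_idl] IP] QV by blast
qed

section \<open>The ideal of minors of the Jacobian matrix\<close>

lemma mpoly_deriv_bracket:
  assumes "mpoly_deriv E" "mpoly_deriv E'"
  shows "mpoly_deriv (\<lambda>f. E (E' f) - E' (E f))"
  unfolding mpoly_deriv_def
  by (simp add: mpoly_derivD[OF assms(1)] mpoly_derivD[OF assms(2)] algebra_simps)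

lemma mpoly_deriv_of_int: "mpoly_deriv E \<Longrightarrow> E (of_int z * f) = of_int z * E f"
proof -
  assume E: "mpoly_deriv E"
  have c: "of_int z = mpoly_const (of_int z)" by (simp add: mpoly_const_def)
  show ?thesis by (simp only: c mpoly_derivD[OF E]) simp
qed

lemma mpoly_deriv_prod:
  assumes E: "mpoly_deriv E" and "finite A"
  shows "E (\<Prod>i\<in>A. x i) = (\<Sum>a\<in>A. E (x a) * (\<Prod>i\<in>A - {a}. x i))"
  using assms(2)
proof induct
  case empty
  show ?case using mpoly_derivD(3)[OF E, of 1] by simp
next
  case (insert y A)
  have "(\<Sum>a\<in>A. E (x a) * (\<Prod>i\<in>insert y A - {a}. x i)) = x y * (\<Sum>a\<in>A. E (x a) * (\<Prod>i\<in>A - {a}. x i))"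
    unfolding sum_distrib_left
  proof (intro sum.cong refl)
    fix a assume "a \<in> A"
    then have "insert y A - {a} = insert y (A - {a})" using insert(2) by auto
    then show "E (x a) * (\<Prod>i\<in>insert y A - {a}. x i) = x y * (E (x a) * (\<Prod>i\<in>A - {a}. x i))"
      using insert(1,2) by (simp add: mult_ac)
  qed
  then show ?case using insert by (simp add: mpoly_derivD[OF E])
qed

text \<open>Jacobi's formula: the determinant is differentiated one row at a time, and the matrix
  \<open>R a\<close> with row \<open>a\<close> differentiated is expanded along that row.\<close>

lemma mpoly_deriv_det:
  assumes E: "mpoly_deriv E" and A: "A \<in> carrier_mat n n"
  shows "E (det A) = (\<Sum>a<n. \<Sum>b<n. E (A $$ (a, b)) * cofactor A a b)"
proof -
  define R where "R a = mat n n (\<lambda>(i, j). if i = a then E (A $$ (a, j)) else A $$ (i, j))" for a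
  have R: "R a \<in> carrier_mat n n" for a by (simp add: R_def)
  let ?P = "{\<pi>. \<pi> permutes {0..<n}}"
  have "E (det A) = (\<Sum>\<pi>\<in>?P. of_int (sign \<pi>) * (\<Sum>a\<in>{0..<n}. E (A $$ (a, \<pi> a)) * (\<Prod>i\<in>{0..<n} - {a}. A $$ (i, \<pi> i))))"
    using A by (simp add: det_def mpoly_deriv_sum[OF E] mpoly_deriv_of_int[OF E] mpoly_deriv_prod[OF E])
  also have "\<dots> = (\<Sum>\<pi>\<in>?P. of_int (sign \<pi>) * (\<Sum>a\<in>{0..<n}. \<Prod>i\<in>{0..<n}. R a $$ (i, \<pi> i)))"
  proof (intro sum.cong refl arg_cong2[where f = "(*)"])
    fix \<pi> a assume \<pi>: "\<pi> \<in> ?P" and a: "a \<in> {0..<n}"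
    have lt: "\<pi> i < n" if "i < n" for i using \<pi> that permutes_in_image[of \<pi> "{0..<n}" i] by simp
    have "(\<Prod>i\<in>{0..<n}. R a $$ (i, \<pi> i)) = R a $$ (a, \<pi> a) * (\<Prod>i\<in>{0..<n} - {a}. R a $$ (i, \<pi> i))"
      using a by (subst prod.remove[of _ a]) auto
    also have "(\<Prod>i\<in>{0..<n} - {a}. R a $$ (i, \<pi> i)) = (\<Prod>i\<in>{0..<n} - {a}. A $$ (i, \<pi> i))"
      using lt by (intro prod.cong) (auto simp: R_def)
    also have "R a $$ (a, \<pi> a) = E (A $$ (a, \<pi> a))" using a lt by (simp add: R_def)
    finally show "E (A $$ (a, \<pi> a)) * (\<Prod>i\<in>{0..<n} - {a}. A $$ (i, \<pi> i)) = (\<Prod>i\<in>{0..<n}. R a $$ (i, \<pi> i))" ..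
  qed
  also have "\<dots> = (\<Sum>a<n. det (R a))"
    unfolding det_def'[OF R] sum_distrib_left by (subst sum.swap) (simp add: atLeast0LessThan)
  also have "\<dots> = (\<Sum>a<n. \<Sum>b<n. E (A $$ (a, b)) * cofactor A a b)"
  proof (intro sum.cong refl)
    fix a assume a: "a \<in> {..<n}"
    have "det (R a) = (\<Sum>b<n. R a $$ (a, b) * cofactor (R a) a b)"
      using a by (intro laplace_expansion_row[OF R]) simp
    also have "\<dots> = (\<Sum>b<n. E (A $$ (a, b)) * cofactor A a b)"
    proof (intro sum.cong refl arg_cong2[where f = "(*)"])
      fix b assume "b \<in> {..<n}"
      then show "R a $$ (a, b) = E (A $$ (a, b))" using a by (simp add: R_def)
      show "cofactor (R a) a b = cofactor A a b" by (rule cofactor_cong[OF R A]) (simp add: R_def)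
    qed
    finally show "det (R a) = (\<Sum>b<n. E (A $$ (a, b)) * cofactor A a b)" .
  qed
  finally show ?thesis .
qed

text \<open>Cofactors along row \<open>a\<close> ignore the entries of that row, so pairing them
  with row \<open>i\<close> gives the minor in which \<open>i\<close> stands in its place.\<close>

lemma minor_replace_row:
  assumes "a < length rs" "length cs = length rs"
  shows "(\<Sum>b<length rs. M i (cs ! b) * cofactor (mat (length rs) (length rs) (\<lambda>(a, b). M (rs ! a) (cs ! b))) a b)
    = minor M (rs[a := i]) cs"
proof -
  let ?n = "length rs"
  let ?B = "mat ?n ?n (\<lambda>(k, b). M (rs[a := i] ! k) (cs ! b))"
  have B: "?B \<in> carrier_mat ?n ?n" by simp
  have "minor M (rs[a := i]) cs = (\<Sum>b<?n. ?B $$ (a, b) * cofactor ?B a b)"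
    unfolding minor_def length_list_update by (rule laplace_expansion_row[OF B assms(1)])
  also have "\<dots> = (\<Sum>b<?n. M i (cs ! b) * cofactor (mat ?n ?n (\<lambda>(a, b). M (rs ! a) (cs ! b))) a b)"
    using assms by (intro sum.cong refl arg_cong2[where f = "(*)"] cofactor_cong[where n = ?n]) simp_all
  finally show ?thesis ..
qed

lemma minor_replace_column:
  assumes "b < length rs" "length cs = length rs"
  shows "(\<Sum>a<length rs. M (rs ! a) l * cofactor (mat (length rs) (length rs) (\<lambda>(a, b). M (rs ! a) (cs ! b))) a b)
    = minor M rs (cs[b := l])"
proof -
  let ?n = "length rs"
  let ?B = "mat ?n ?n (\<lambda>(k, j). M (rs ! k) (cs[b := l] ! j))"
  have B: "?B \<in> carrier_mat ?n ?n" by simp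
  have "minor M rs (cs[b := l]) = (\<Sum>a<?n. ?B $$ (a, b) * cofactor ?B a b)"
    unfolding minor_def by (rule laplace_expansion_column[OF B assms(1)])
  also have "\<dots> = (\<Sum>a<?n. M (rs ! a) l * cofactor (mat ?n ?n (\<lambda>(a, b). M (rs ! a) (cs ! b))) a b)"
    using assms by (intro sum.cong refl arg_cong2[where f = "(*)"] cofactor_cong[where n = ?n]) simp_all
  finally show ?thesis ..
qed

lemma span_set_list_sum:
  assumes "f \<in> idl.span (set fs)"
  obtains g where "f = (\<Sum>i<length fs. g i * fs ! i)"
proof -
  have "\<exists>g. f = (\<Sum>i<length fs. g i * fs ! i)"
    using assms
  proof (induct rule: idl.span_induct_alt)
    case base
    show ?case by (intro exI[of _ "\<lambda>_. 0"]) simp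
  next
    case (step c x y)
    then obtain g k where g: "y = (\<Sum>i<length fs. g i * fs ! i)" "k < length fs" "x = fs ! k"
      by (auto simp: in_set_conv_nth)
    have "c * x + y = (\<Sum>i<length fs. (g i + (if i = k then c else 0)) * fs ! i)"
      using g by (simp add: distrib_right sum.distrib if_distrib[of "\<lambda>z. z * _"] cong: if_cong)
    then show ?case by (intro exI[of _ "\<lambda>i. g i + (if i = k then c else 0)"])
  qed
  then show ?thesis using that by blast
qed

text \<open>With \<open>fs\<close> among the generators, this is the preimage of the ideal that the
  minors generate in \<open>A\<close>.\<close>

definition minor_idl :: "('n, 'k::comm_ring_1) mpoly list \<Rightarrow> nat \<Rightarrow> ('n, 'k) mpoly set" where
  "minor_idl fs r = idl.span (set fs \<union>
     {minor (jacobian fs) rs cs |rs cs. set rs \<subseteq> {..<length fs} \<and> length rs = r \<and> length cs = r})"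

text \<open>
  With \<open>J\<close> the Jacobian matrix, a derivation \<open>E\<close> preserving the ideal acts on it as
  \<open>E J = G J - J W\<close> modulo the ideal, so it maps minors to combinations of minors of the same size.
\<close>

theorem minor_idl_stable:
  fixes fs :: "('n::finite, 'k::field) mpoly list"
  assumes E: "mpoly_deriv E" and EI: "\<And>f. f \<in> set fs \<Longrightarrow> E f \<in> idl.span (set fs)"
    and f: "f \<in> minor_idl fs r"
  shows "E f \<in> minor_idl fs r"
proof -
  let ?J = "jacobian fs" and ?m = "length fs"
  let ?K = "minor_idl fs r"
  let ?S = "{minor ?J rs cs |rs cs. set rs \<subseteq> {..<?m} \<and> length rs = r \<and> length cs = r}"
  have K: "idl.subspace ?K" by (simp add: minor_idl_def)
  have IK: "x \<in> ?K" if "x \<in> idl.span (set fs)" for x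
    unfolding minor_idl_def using that idl.span_mono[of "set fs" "set fs \<union> ?S"] by blast
  have mK: "minor ?J rs cs \<in> ?K" if "set rs \<subseteq> {..<?m}" "length rs = r" "length cs = r" for rs cs
    unfolding minor_idl_def using that by (intro idl.span_base) auto
  have fsI: "fs ! i \<in> idl.span (set fs)" if "i < ?m" for i using that by (intro idl.span_base) simp
  have "\<exists>g. \<forall>i<?m. E (fs ! i) = (\<Sum>k<?m. g i k * fs ! k)"
  proof -
    have "\<exists>g. E (fs ! i) = (\<Sum>k<?m. g k * fs ! k)" if "i < ?m" for i
      using span_set_list_sum[OF EI[of "fs ! i"]] that by (metis nth_mem)
    then show ?thesis by metis
  qed
  then obtain g where g: "\<And>i. i < ?m \<Longrightarrow> E (fs ! i) = (\<Sum>k<?m. g i k * fs ! k)" by blast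
  define w where "w j l = mpoly_partial j (E (mpoly_var l))" for j l
  have EJ: "E (?J i j) = (\<Sum>k<?m. g i k * ?J k j) - (\<Sum>l\<in>UNIV. w j l * ?J i l) + (\<Sum>k<?m. mpoly_partial j (g i k) * fs ! k)"
    if i: "i < ?m" for i j
  proof -
    note p = mpoly_derivD[OF mpoly_deriv_partial]
    have v: "E (mpoly_partial j (mpoly_var l)) = 0" for l
      using mpoly_derivD(3)[OF E, of 1] by (simp add: mpoly_partial_var mpoly_derivD(4)[OF E])
    \<comment> \<open>The commutator of \<open>E\<close> with a partial derivative is a derivation
      with value \<open>- w j l\<close> at the variable \<open>l\<close>; the chain rule does the
      rest.\<close>
    have "E (?J i j) - mpoly_partial j (E (fs ! i)) = - (\<Sum>l\<in>UNIV. w j l * ?J i l)"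
      using mpoly_deriv_chain[OF mpoly_deriv_bracket[OF E mpoly_deriv_partial], of j "fs ! i"]
      by (simp add: v w_def sum_negf)
    then have "E (?J i j) = mpoly_partial j (E (fs ! i)) - (\<Sum>l\<in>UNIV. w j l * ?J i l)"
      by (simp add: algebra_simps)
    also have "mpoly_partial j (E (fs ! i)) = (\<Sum>k<?m. g i k * ?J k j) + (\<Sum>k<?m. mpoly_partial j (g i k) * fs ! k)"
      by (simp add: g[OF i] mpoly_deriv_sum[OF mpoly_deriv_partial] p sum.distrib)
    finally show ?thesis by (simp add: algebra_simps)
  qed
  have Em: "E (minor ?J rs cs) \<in> ?K" if rs: "set rs \<subseteq> {..<?m}" "length rs = r" "length cs = r" for rs cs
  proof -
    define A where "A = mat r r (\<lambda>(a, b). ?J (rs ! a) (cs ! b))"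
    have A: "A \<in> carrier_mat r r" by (simp add: A_def)
    have ri: "rs ! a < ?m" if "a < r" for a using subsetD[OF rs(1) nth_mem[of a rs]] that rs(2) by simp
    let ?c = "\<lambda>a b. cofactor A a b"
    \<comment> \<open>\<open>T1\<close> will replace rows, \<open>T2\<close> will replace columns,
      and \<open>T3\<close> is the remainder with coefficients in the ideal of
      \<open>fs\<close>.\<close>
    define T1 where "T1 a b = (\<Sum>k<?m. g (rs ! a) k * ?J k (cs ! b))" for a b
    define T2 where "T2 a b = (\<Sum>l\<in>UNIV. w (cs ! b) l * ?J (rs ! a) l)" for a b
    define T3 where "T3 a b = (\<Sum>k<?m. mpoly_partial (cs ! b) (g (rs ! a) k) * fs ! k)" for a b
    have "E (minor ?J rs cs) = E (det A)" using rs by (simp add: minor_def A_def)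
    also have "\<dots> = (\<Sum>a<r. \<Sum>b<r. E (A $$ (a, b)) * ?c a b)" by (rule mpoly_deriv_det[OF E A])
    also have "\<dots> = (\<Sum>a<r. \<Sum>b<r. T1 a b * ?c a b - T2 a b * ?c a b + T3 a b * ?c a b)"
      by (intro sum.cong refl) (simp add: A_def EJ ri T1_def T2_def T3_def algebra_simps)
    also have "\<dots> = (\<Sum>a<r. \<Sum>b<r. T1 a b * ?c a b) - (\<Sum>a<r. \<Sum>b<r. T2 a b * ?c a b) + (\<Sum>a<r. \<Sum>b<r. T3 a b * ?c a b)"
      by (simp only: sum.distrib sum_subtractf)
    also have "(\<Sum>a<r. \<Sum>b<r. T1 a b * ?c a b) = (\<Sum>a<r. \<Sum>k<?m. g (rs ! a) k * (\<Sum>b<r. ?J k (cs ! b) * ?c a b))"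
      unfolding T1_def sum_distrib_left sum_distrib_right
      by (rule sum.cong[OF refl], subst sum.swap) (simp add: mult.assoc)
    also have "\<dots> = (\<Sum>a<r. \<Sum>k<?m. g (rs ! a) k * minor ?J (rs[a := k]) cs)"
      using minor_replace_row[of _ rs cs ?J] rs by (intro sum.cong refl) (simp add: A_def)
    also have "(\<Sum>a<r. \<Sum>b<r. T2 a b * ?c a b) = (\<Sum>b<r. \<Sum>l\<in>UNIV. w (cs ! b) l * (\<Sum>a<r. ?J (rs ! a) l * ?c a b))"
      unfolding T2_def sum_distrib_left sum_distrib_right
      by (subst sum.swap, rule sum.cong[OF refl], subst sum.swap) (simp add: mult.assoc)
    also have "\<dots> = (\<Sum>b<r. \<Sum>l\<in>UNIV. w (cs ! b) l * minor ?J rs (cs[b := l]))"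
      using minor_replace_column[of _ rs cs ?J] rs by (intro sum.cong refl) (simp add: A_def)
    finally have eq: "E (minor ?J rs cs) = (\<Sum>a<r. \<Sum>k<?m. g (rs ! a) k * minor ?J (rs[a := k]) cs)
      - (\<Sum>b<r. \<Sum>l\<in>UNIV. w (cs ! b) l * minor ?J rs (cs[b := l]))
      + (\<Sum>a<r. \<Sum>b<r. T3 a b * ?c a b)" .
    have 1: "(\<Sum>a<r. \<Sum>k<?m. g (rs ! a) k * minor ?J (rs[a := k]) cs) \<in> ?K"
    proof (intro idl.subspace_sum[OF K] idl.subspace_scale[OF K] mK)
      fix a k assume "k \<in> {..<?m}"
      then show "set (rs[a := k]) \<subseteq> {..<?m}" using rs(1) set_update_subset_insert[of rs a k] by blast
    qed (use rs in auto)
    have 2: "(\<Sum>b<r. \<Sum>l\<in>UNIV. w (cs ! b) l * minor ?J rs (cs[b := l])) \<in> ?K"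
      using rs by (intro idl.subspace_sum[OF K] idl.subspace_scale[OF K] mK) auto
    have 3: "(\<Sum>a<r. \<Sum>b<r. T3 a b * ?c a b) \<in> ?K"
      unfolding T3_def
      by (intro idl.subspace_sum[OF K] idl_mult_right[OF K] idl.subspace_scale[OF K] IK fsI) simp
    show ?thesis
      unfolding eq by (rule idl.subspace_add[OF K idl.subspace_diff[OF K 1 2] 3])
  qed
  show ?thesis
    using deriv_preserves_span[OF E, of "set fs \<union> ?S" f] f EI IK Em
    unfolding minor_idl_def[symmetric] by (auto simp: minor_idl_def[symmetric])
qed

section \<open>Ideals of Lie algebras of derivations\<close>

text \<open>The setting of Jordan's argument for operators on a ring in which \<open>I\<close> plays
  the role of zero: \<open>D\<close> is a Lie algebra closed under multiplication by ring elements,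
  \<open>W\<close> is a Lie ideal of it, and \<open>W_trivial\<close> accounts for derivations that
  vanish modulo \<open>I\<close>.\<close>

locale derivation_family =
  fixes I :: "'a::comm_ring_1 set" and D :: "('a \<Rightarrow> 'a) set" and W :: "('a \<Rightarrow> 'a) set"
  assumes I: "prime_idl I" and two: "2 \<notin> I"
    and D_add: "E \<in> D \<Longrightarrow> E (f + g) = E f + E g"
    and D_mult: "E \<in> D \<Longrightarrow> E (f * g) = E f * g + f * E g"
    and D_scale: "E \<in> D \<Longrightarrow> (\<lambda>f. a * E f) \<in> D"
    and D_bracket: "E \<in> D \<Longrightarrow> E' \<in> D \<Longrightarrow> (\<lambda>f. E (E' f) - E' (E f)) \<in> D"
    and W_D: "W \<subseteq> D"
    and W_diff: "w \<in> W \<Longrightarrow> w' \<in> W \<Longrightarrow> (\<lambda>f. w f - w' f) \<in> W"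
    and W_trivial: "E \<in> D \<Longrightarrow> (\<And>f. E f \<in> I) \<Longrightarrow> E \<in> W"
    and W_bracket: "E \<in> D \<Longrightarrow> w \<in> W \<Longrightarrow> (\<lambda>f. E (w f) - w (E f)) \<in> W"
begin

definition K where "K = {a. \<forall>E\<in>D. (\<lambda>f. a * E f) \<in> W}"

lemma K_D: "a \<in> K \<Longrightarrow> E \<in> D \<Longrightarrow> (\<lambda>f. a * E f) \<in> W"
  by (simp add: K_def)

lemma D_2: "E \<in> D \<Longrightarrow> E 2 = 0"
  using D_mult[of E 1 1] D_add[of E 1 1] by simp

lemma W_neg: "w \<in> W \<Longrightarrow> (\<lambda>f. - w f) \<in> W"
  using W_diff[OF W_diff[of w w], of w] by simp

lemma W_add: "w \<in> W \<Longrightarrow> w' \<in> W \<Longrightarrow> (\<lambda>f. w f + w' f) \<in> W"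
  using W_diff[OF _ W_neg, of w w'] by simp

lemma W_bracket': "E \<in> D \<Longrightarrow> w \<in> W \<Longrightarrow> (\<lambda>f. w (E f) - E (w f)) \<in> W"
  using W_neg[OF W_bracket, of E w] by simp

lemma I_subset_K: "I \<subseteq> K"
proof
  fix a assume a: "a \<in> I"
  show "a \<in> K"
    unfolding K_def using D_scale idl_mult_right[OF prime_idlD(1)[OF I] a] by (auto intro: W_trivial)
qed

lemma K_subspace: "idl.subspace K"
  unfolding idl.subspace_def
proof (intro conjI ballI allI)
  show "0 \<in> K" using I_subset_K idl.subspace_0[OF prime_idlD(1)[OF I]] by blast
next
  fix a b assume "a \<in> K" "b \<in> K"
  then show "a + b \<in> K" unfolding K_def using W_add by (fastforce simp: distrib_right)
next
  fix c a assume a: "a \<in> K"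
  have "(\<lambda>f. (c * a) * E f) \<in> W" if "E \<in> D" for E
  proof -
    have "(\<lambda>f. a * (c * E f)) \<in> W" by (rule K_D[OF a D_scale[OF that]])
    then show ?thesis by (simp add: mult_ac)
  qed
  then show "c * a \<in> K" unfolding K_def by blast
qed

text \<open>In \<open>[d, a E] = d(a) E + a [d, E]\<close> the left side and the last term belong to
  \<open>W\<close>.\<close>

lemma K_stable:
  assumes d: "d \<in> D" and a: "a \<in> K"
  shows "d a \<in> K"
  unfolding K_def
proof (intro CollectI ballI)
  fix E assume E: "E \<in> D"
  have 1: "(\<lambda>f. d (a * E f) - a * E (d f)) \<in> W"
    by (rule W_bracket[OF d K_D[OF a E]])
  have 2: "(\<lambda>f. a * (d (E f) - E (d f))) \<in> W"
    by (rule K_D[OF a D_bracket[OF d E]])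
  show "(\<lambda>f. d a * E f) \<in> W"
    using W_diff[OF 1 2] by (simp add: D_mult[OF d] algebra_simps)
qed

text \<open>First all multiples of \<open>b w\<close> are placed in \<open>W\<close> for some
  \<open>b\<close> outside \<open>I\<close>, then all multiples of derivations by
  \<open>b * w f0\<close>.\<close>

lemma K_nontrivial:
  assumes w: "w \<in> W" and f0: "w f0 \<notin> I"
  obtains a where "a \<in> K" "a \<notin> I"
proof -
  note Is = prime_idlD(1)[OF I]
  have wD: "w \<in> D" using w W_D by blast
  note wm = D_mult[OF wD]
  obtain f where f: "w (w f) \<notin> I"
  proof (rule ccontr)
    assume "\<not> thesis"
    then have all: "w (w f) \<in> I" for f using that by blast
    \<comment> \<open>By the product rule this difference is \<open>2 * (w f0)^2\<close>.\<close>
    have "w (w (f0 * f0)) - 2 * f0 * w (w f0) \<in> I"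
      by (intro idl.subspace_diff[OF Is] idl.subspace_scale[OF Is] all)
    then have "2 * (w f0 * w f0) \<in> I"
      by (simp add: wm D_add[OF wD] D_2[OF wD] algebra_simps)
    then show False using prime_idlD(3)[OF I] two f0 by blast
  qed
  define b where "b = 2 * w (w f)"
  have b: "b \<notin> I" unfolding b_def using prime_idlD(3)[OF I] two f by blast
  \<comment> \<open>This is the bracket \<open>[w, f w]\<close>.\<close>
  have \<phi>: "(\<lambda>x. w f * w x) \<in> W"
    using W_bracket'[OF D_scale[OF wD, of f] w] by (simp add: wm)
  \<comment> \<open>With \<open>u = w f\<close>, the difference
    \<open>[w, (u g) w] - [u w, g w]\<close> equals \<open>2 g w(u) w\<close>; this is where the
    constant 2 in \<open>b\<close> comes from.\<close>
  have \<mu>: "(\<lambda>x. g * (b * w x)) \<in> W" for g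
  proof -
    have 1: "(\<lambda>x. w (w f * g * w x) - w f * g * w (w x)) \<in> W"
      by (rule W_bracket'[OF D_scale[OF wD] w])
    have 2: "(\<lambda>x. w f * w (g * w x) - g * w (w f * w x)) \<in> W"
      by (rule W_bracket'[OF D_scale[OF wD] \<phi>])
    show ?thesis using W_diff[OF 1 2] by (simp add: wm b_def algebra_simps)
  qed
  have "(\<lambda>x. (b * w f0) * E x) \<in> W" if E: "E \<in> D" for E
  proof -
    \<comment> \<open>With \<open>v = b w\<close>, the expression
      \<open>[v, f0 E] - [f0 v, E] - E(f0) v\<close> reduces to \<open>v(f0) E\<close>.\<close>
    have 1: "(\<lambda>x. b * w (f0 * E x) - f0 * E (b * w x)) \<in> W"
      using W_bracket'[OF D_scale[OF E] \<mu>[of 1]] by simp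
    have 2: "(\<lambda>x. f0 * (b * w (E x)) - E (f0 * (b * w x))) \<in> W"
      by (rule W_bracket'[OF E \<mu>])
    have "(\<lambda>x. (b * w (f0 * E x) - f0 * E (b * w x)) - (f0 * (b * w (E x)) - E (f0 * (b * w x))) - E f0 * (b * w x)) \<in> W"
      by (rule W_diff[OF W_diff[OF 1 2] \<mu>])
    then show ?thesis by (simp add: wm D_mult[OF E] algebra_simps)
  qed
  then have "b * w f0 \<in> K" unfolding K_def by blast
  moreover have "b * w f0 \<notin> I" using prime_idlD(3)[OF I] b f0 by blast
  ultimately show ?thesis using that by blast
qed

end

section \<open>The Lie algebra of vector fields\<close>

lemma vanishing_ideal_subspace: "idl.subspace (vanishing_ideal X)"
  by (auto simp: vanishing_ideal_def idl.subspace_def)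

lemma ideal_mpoly_ring_iff: "ideal J (cring_class_ops :: 'a::comm_ring_1 ring) \<longleftrightarrow> idl.subspace J"
proof
  assume "ideal J (cring_class_ops :: 'a ring)"
  then interpret ideal J "cring_class_ops :: 'a ring" .
  show "idl.subspace J"
    unfolding idl.subspace_def
    using a_closed I_l_closed additive_subgroup.zero_closed[OF additive_subgroup_axioms]
    by (auto simp: carrier_class class_simps)
next
  assume J: "idl.subspace J"
  show "ideal J (cring_class_ops :: 'a ring)"
  proof (rule idealI)
    show "ring (cring_class_ops :: 'a ring)" by (rule cring.axioms(1)[OF cring_class])
    show "subgroup J (add_monoid (cring_class_ops :: 'a ring))"
    proof (rule group.subgroupI)
      show "Group.group (add_monoid (cring_class_ops :: 'a ring))"
        using abelian_group.a_group cring_class.abelian_group_axioms by blast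
      show "J \<noteq> {}" using idl.subspace_0[OF J] by blast
      fix a assume "a \<in> J"
      then have "- a \<in> J" by (rule idl.subspace_neg[OF J])
      then show "inv\<^bsub>add_monoid (cring_class_ops :: 'a ring)\<^esub> a \<in> J"
        using uminus_class[of a] by (simp add: a_inv_def)
    qed (use idl.subspace_add[OF J] in \<open>auto simp: cring_class_ops_def\<close>)
  qed (use idl.subspace_scale[OF J] idl_mult_right[OF J] in \<open>auto simp: class_simps\<close>)
qed

lemma genideal_mpoly_ring: "Idl\<^bsub>cring_class_ops\<^esub> S = idl.span (S :: 'a::comm_ring_1 set)"
proof -
  have "idl.span S = \<Inter>{J. idl.subspace J \<and> S \<subseteq> J}"
    by (simp add: idl.span_def hull_def)
  then show ?thesis by (simp add: genideal_def ideal_mpoly_ring_iff)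
qed

locale variety =
  fixes X :: "('k::field ^ 'n::finite) set"
begin

abbreviation "I \<equiv> vanishing_ideal X"
abbreviation "A \<equiv> coordinate_algebra X"
abbreviation "res \<equiv> residue_class X"

lemmas Is = vanishing_ideal_subspace[of X]

lemma ideal_I: "ideal I cring_class_ops"
  by (simp add: ideal_mpoly_ring_iff Is)

lemma res_altdef: "res f = {h + f |h. h \<in> I}"
  unfolding residue_class_def a_r_coset_def' by (auto simp: plus_class)

lemma res_eq_iff: "res f = res g \<longleftrightarrow> f - g \<in> I"
proof
  assume "res f = res g"
  moreover have "f \<in> res f" unfolding res_altdef using idl.subspace_0[OF Is] by force
  ultimately obtain h where "h \<in> I" "f = h + g" by (auto simp: res_altdef)
  then show "f - g \<in> I" by simp
next
  assume fg: "f - g \<in> I"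
  have "h + f = (h + (f - g)) + g" "h + g = (h - (f - g)) + f" for h by simp_all
  then show "res f = res g"
    unfolding res_altdef using idl.subspace_add[OF Is _ fg] idl.subspace_diff[OF Is _ fg] by blast
qed

lemma res_eq_0_iff: "res f = res 0 \<longleftrightarrow> f \<in> I"
  by (simp add: res_eq_iff)

lemma A_simps:
  "carrier A = range res" "mult A (res f) (res g) = res (f * g)" "add A (res f) (res g) = res (f + g)"
  "one A = res 1" "ring.zero A = res 0" "module.smult A c (res f) = res (mpoly_const c * f)"
proof -
  interpret ideal I cring_class_ops by (rule ideal_I)
  have c: "carrier (cring_class_ops :: ('n, 'k) mpoly ring) = UNIV" by (simp add: cring_class_ops_def)
  have m: "rcoset_mult cring_class_ops I (res f) (res g) = res (f * g)" for f g
    using rcoset_mult_add[of f g] by (simp add: residue_class_def c times_class)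
  show "mult A (res f) (res g) = res (f * g)"
    by (simp add: coordinate_algebra_def Let_def FactRing_def m)
  show "module.smult A c (res f) = res (mpoly_const c * f)"
    by (simp add: coordinate_algebra_def Let_def FactRing_def m mpoly_const_def)
  show "add A (res f) (res g) = res (f + g)"
    using a_rcos_sum[of f g] by (simp add: coordinate_algebra_def Let_def FactRing_def residue_class_def c plus_class)
  show "one A = res 1"
    by (simp add: coordinate_algebra_def Let_def FactRing_def residue_class_def one_class)
  have "res 0 = I" by (auto simp: res_altdef)
  then show "ring.zero A = res 0" by (simp add: coordinate_algebra_def Let_def FactRing_def)
  show "carrier A = range res"
    by (auto simp: coordinate_algebra_def Let_def FactRing_def A_RCOSETS_def' residue_class_def c)
qed

lemma res_cases: assumes "a \<in> carrier A" obtains f where "a = res f"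
  using assms by (auto simp: A_simps)

lemma res_carrier: "res f \<in> carrier A"
  by (simp add: A_simps)

lemma abelian_group_A: "abelian_group A"
proof (rule abelian_groupI)
  fix x assume "x \<in> carrier A"
  then obtain f where "x = res f" by (rule res_cases)
  then show "\<exists>y\<in>carrier A. y \<oplus>\<^bsub>A\<^esub> x = \<zero>\<^bsub>A\<^esub>"
    by (intro bexI[of _ "res (- f)"]) (simp_all add: A_simps)
qed (auto simp: A_simps add_ac)

lemma A_uminus: "\<ominus>\<^bsub>A\<^esub> res f = res (- f)"
  using abelian_group.minus_equality[OF abelian_group_A, of "res (- f)" "res f"] by (simp add: A_simps)

lemma A_minus: "res f \<ominus>\<^bsub>A\<^esub> res g = res (f - g)"
  by (simp add: a_minus_def A_uminus A_simps)

text \<open>The representative is chosen arbitrarily; for \<open>E\<close> preserving the vanishing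
  ideal the choice has no effect.\<close>

definition lift :: "(('n, 'k) mpoly \<Rightarrow> ('n, 'k) mpoly) \<Rightarrow> ('n, 'k) mpoly set \<Rightarrow> ('n, 'k) mpoly set" where
  "lift E = (\<lambda>a\<in>carrier A. res (E (SOME f. res f = a)))"

abbreviation "L \<equiv> polynomial_vector_fields X"

lemma derivs_on_deriv: "E \<in> derivs_on I \<Longrightarrow> mpoly_deriv E"
  by (simp add: derivs_on_def)

lemma lift_res:
  assumes "E \<in> derivs_on I" shows "lift E (res f) = res (E f)"
proof -
  have "res (SOME g. res g = res f) = res f" by (rule someI) (rule refl)
  then have "E ((SOME g. res g = res f) - f) \<in> I"
    using assms by (auto simp: res_eq_iff derivs_on_def)
  then have "E (SOME g. res g = res f) - E f \<in> I"
    by (simp add: mpoly_derivD[OF derivs_on_deriv[OF assms]])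
  then show ?thesis by (simp add: lift_def res_carrier res_eq_iff)
qed

lemma lift_eqI:
  assumes "E \<in> derivs_on I" "D \<in> carrier A \<rightarrow>\<^sub>E carrier A" "\<And>f. D (res f) = res (E f)"
  shows "D = lift E"
proof (rule ext)
  fix a
  show "D a = lift E a"
  proof (cases "a \<in> carrier A")
    case True
    then show ?thesis using assms lift_res by (auto simp: A_simps)
  next
    case False
    then show ?thesis using assms(2) by (simp add: lift_def PiE_def extensional_def)
  qed
qed

lemma lift_eq_iff:
  assumes "E \<in> derivs_on I" "E' \<in> derivs_on I"
  shows "lift E = lift E' \<longleftrightarrow> (\<forall>f. E f - E' f \<in> I)"
proof
  assume "lift E = lift E'"
  then have "lift E (res f) = lift E' (res f)" for f by simp
  then show "\<forall>f. E f - E' f \<in> I" by (simp add: lift_res assms res_eq_iff)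
next
  assume *: "\<forall>f. E f - E' f \<in> I"
  show "lift E = lift E'"
  proof (rule lift_eqI[OF assms(2)])
    show "lift E \<in> carrier A \<rightarrow>\<^sub>E carrier A" unfolding lift_def using res_carrier by auto
  qed (use * in \<open>simp add: lift_res assms res_eq_iff\<close>)
qed

lemma derivs_on_closed:
  "(\<lambda>f. 0) \<in> derivs_on I"
  "E \<in> derivs_on I \<Longrightarrow> E' \<in> derivs_on I \<Longrightarrow> (\<lambda>f. E f + E' f) \<in> derivs_on I"
  "E \<in> derivs_on I \<Longrightarrow> (\<lambda>f. a * E f) \<in> derivs_on I"
  "E \<in> derivs_on I \<Longrightarrow> E' \<in> derivs_on I \<Longrightarrow> (\<lambda>f. E (E' f) - E' (E f)) \<in> derivs_on I"
  "E \<in> derivs_on I \<Longrightarrow> E' \<in> derivs_on I \<Longrightarrow> (\<lambda>f. E f - E' f) \<in> derivs_on I"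
  using mpoly_deriv_bracket[of E E']
  by (auto simp: derivs_on_def mpoly_deriv_def algebra_simps
      intro: idl.subspace_add[OF Is] idl.subspace_scale[OF Is] idl_mult_right[OF Is]
        idl.subspace_diff[OF Is] idl.subspace_0[OF Is])

lemma lift_derivation:
  assumes "E \<in> derivs_on I" shows "lift E \<in> derivations cring_class_ops A"
  unfolding derivations_def
  using mpoly_derivD[OF derivs_on_deriv[OF assms]] lift_res[OF assms]
  by (auto simp: A_simps) (auto simp: lift_def A_simps)

text \<open>Representatives of the values of \<open>D\<close> on the coordinate functions determine
  a derivation of the polynomial ring. It agrees with \<open>D\<close> on all residue classes, and
  it preserves \<open>I\<close> because \<open>D\<close> is well defined on them.\<close>

lemma derivation_is_lift:
  assumes D: "D \<in> derivations cring_class_ops A"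
  obtains E where "E \<in> derivs_on I" "D = lift E"
proof -
  have DC: "D \<in> carrier A \<rightarrow>\<^sub>E carrier A" using D by (simp add: derivations_def)
  have add: "D (res (f + g)) = D (res f) \<oplus>\<^bsub>A\<^esub> D (res g)"
    and mult: "D (res (f * g)) = D (res f) \<otimes>\<^bsub>A\<^esub> res g \<oplus>\<^bsub>A\<^esub> res f \<otimes>\<^bsub>A\<^esub> D (res g)"
    and scal: "D (res (mpoly_const c * f)) = c \<odot>\<^bsub>A\<^esub> D (res f)" for f g c
    using D by (auto simp: derivations_def A_simps cring_class_ops_def)
  have "\<exists>v. \<forall>j. D (res (mpoly_var j)) = res (v j)"
    using DC by (intro choice allI) (auto simp: A_simps PiE_def Pi_def)
  then obtain v where v: "\<And>j. D (res (mpoly_var j)) = res (v j)" by blast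
  define E where "E f = (\<Sum>j\<in>UNIV. v j * mpoly_partial j f)" for f
  have dE: "mpoly_deriv E"
    unfolding E_def[abs_def] by (intro mpoly_deriv_combination mpoly_deriv_partial)
  have DE: "D (res f) = res (E f)" for f
  proof (induct f rule: mpoly_induct)
    case (const c)
    \<comment> \<open>The product rule for 1 times 1 gives \<open>D 1 = D 1 + D 1\<close>, so
      \<open>D\<close> kills 1 and by linearity all constants.\<close>
    obtain u where u: "D (res 1) = res u" using DC by (auto simp: A_simps PiE_def Pi_def)
    have "res u = res (u + u)" using mult[of 1 1] by (simp add: u A_simps)
    then have "- u \<in> I" by (simp add: res_eq_iff)
    then have "u \<in> I" using idl.subspace_neg[OF Is, of "- u"] by simp
    then have "mpoly_const c * u \<in> I" by (rule idl.subspace_scale[OF Is])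
    then show ?case using scal[of c 1] by (simp add: u A_simps mpoly_derivD[OF dE] res_eq_iff)
  next
    case (var i)
    show ?case by (simp add: v E_def mpoly_partial_var if_distrib[of "(*) _"] cong: if_cong)
  next
    case (add f g)
    then show ?case using \<open>\<And>g f. D (res (f + g)) = _ f g\<close> by (simp add: A_simps mpoly_derivD[OF dE])
  next
    case (mult f g)
    then show ?case using \<open>\<And>g f. D (res (f * g)) = _ f g\<close> by (simp add: A_simps mpoly_derivD[OF dE])
  qed
  have "E f \<in> I" if "f \<in> I" for f
  proof -
    have "res f = res 0" using that by (simp add: res_eq_0_iff)
    then have "res (E f) = res (E 0)" using DE by metis
    then show ?thesis by (simp add: mpoly_derivD[OF dE] res_eq_iff)
  qed
  then have "E \<in> derivs_on I" using dE by (simp add: derivs_on_def)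
  then show ?thesis using that lift_eqI[OF _ DC DE] by blast
qed

lemma L_carrier: "carrier L = lift ` derivs_on I"
  unfolding polynomial_vector_fields_def Der_def
  using lift_derivation derivation_is_lift by (auto, metis image_eqI)

lemma L_simps:
  assumes "E \<in> derivs_on I"
  shows "E' \<in> derivs_on I \<Longrightarrow> lift E \<oplus>\<^bsub>L\<^esub> lift E' = lift (\<lambda>f. E f + E' f)"
    "E' \<in> derivs_on I \<Longrightarrow> lift E \<otimes>\<^bsub>L\<^esub> lift E' = lift (\<lambda>f. E (E' f) - E' (E f))"
    "c \<odot>\<^bsub>L\<^esub> lift E = lift (\<lambda>f. mpoly_const c * E f)"
    "\<zero>\<^bsub>L\<^esub> = lift (\<lambda>f. 0)"
  unfolding polynomial_vector_fields_def Der_def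
  by (simp_all, (rule lift_eqI; use assms in \<open>auto simp: derivs_on_closed lift_res A_simps A_minus\<close>)+)

lemma L_zero: "\<zero>\<^bsub>L\<^esub> = lift (\<lambda>f. 0)"
  using L_simps(4)[OF derivs_on_closed(1)] .

lemma lift_eq_zero_iff: "E \<in> derivs_on I \<Longrightarrow> lift E = \<zero>\<^bsub>L\<^esub> \<longleftrightarrow> (\<forall>f. E f \<in> I)"
  by (simp add: L_zero lift_eq_iff derivs_on_closed)

lemma lie_algebra_L: "lie_algebra cring_class_ops L"
proof -
  note d = derivs_on_closed
  have ab: "abelian_group L"
  proof (rule abelian_groupI)
    fix x assume "x \<in> carrier L"
    then obtain E where E: "E \<in> derivs_on I" "x = lift E" by (auto simp: L_carrier)
    show "\<exists>y\<in>carrier L. y \<oplus>\<^bsub>L\<^esub> x = \<zero>\<^bsub>L\<^esub>"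
      using E d(3)[OF E(1), of "- 1"]
      by (intro bexI[of _ "lift (\<lambda>f. - 1 * E f)"]) (auto simp: L_carrier L_zero L_simps)
  qed (auto simp: L_carrier L_zero L_simps d add_ac)
  have mod: "module cring_class_ops L"
    by (rule moduleI[OF cring_class ab])
      (auto simp: L_carrier L_zero L_simps d carrier_class class_simps mpoly_const_add mpoly_const_mult
          distrib_left distrib_right mult.assoc)
  have ax: "lie_algebra_axioms cring_class_ops L"
  proof
    fix x y z assume "x \<in> carrier L" "y \<in> carrier L" "z \<in> carrier L"
    then obtain E F G where E: "E \<in> derivs_on I" "F \<in> derivs_on I" "G \<in> derivs_on I"
      and [simp]: "x = lift E" "y = lift F" "z = lift G" by (auto simp: L_carrier)
    note m = E[THEN derivs_on_deriv]
    note br = d(4)[OF E(1,2)] d(4)[OF E(2,3)] d(4)[OF E(3,1)] d(4)[OF E(1,3)]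
    note br' = d(4)[OF E(1) br(2)] d(4)[OF E(2) br(3)] d(4)[OF E(3) br(1)]
    note s = mpoly_derivD(1,2,5,6)[OF m(1)] mpoly_derivD(1,2,5,6)[OF m(2)] mpoly_derivD(1,2,5,6)[OF m(3)]
    show "(x \<oplus>\<^bsub>L\<^esub> y) \<otimes>\<^bsub>L\<^esub> z = x \<otimes>\<^bsub>L\<^esub> z \<oplus>\<^bsub>L\<^esub> y \<otimes>\<^bsub>L\<^esub> z"
      "x \<otimes>\<^bsub>L\<^esub> (y \<oplus>\<^bsub>L\<^esub> z) = x \<otimes>\<^bsub>L\<^esub> y \<oplus>\<^bsub>L\<^esub> x \<otimes>\<^bsub>L\<^esub> z"
      by (simp_all add: L_simps E br d(2)[OF E(1,2)] d(2)[OF E(2,3)]) (simp_all add: s algebra_simps)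
    show "x \<otimes>\<^bsub>L\<^esub> (y \<otimes>\<^bsub>L\<^esub> z) \<oplus>\<^bsub>L\<^esub> (y \<otimes>\<^bsub>L\<^esub> (z \<otimes>\<^bsub>L\<^esub> x) \<oplus>\<^bsub>L\<^esub> z \<otimes>\<^bsub>L\<^esub> (x \<otimes>\<^bsub>L\<^esub> y)) = \<zero>\<^bsub>L\<^esub>"
      by (simp add: L_simps E br br' d(2)[OF br'(2,3)] L_zero) (simp add: s)
  next
    fix x y assume "x \<in> carrier L" "y \<in> carrier L"
    then obtain E F where E: "E \<in> derivs_on I" "F \<in> derivs_on I"
      and [simp]: "x = lift E" "y = lift F" by (auto simp: L_carrier)
    note m = E[THEN derivs_on_deriv]
    note s = mpoly_derivD[OF m(1)] mpoly_derivD[OF m(2)]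
    show "x \<otimes>\<^bsub>L\<^esub> y \<in> carrier L" using E by (auto simp: L_simps d L_carrier)
    show "(c \<odot>\<^bsub>L\<^esub> x) \<otimes>\<^bsub>L\<^esub> y = c \<odot>\<^bsub>L\<^esub> (x \<otimes>\<^bsub>L\<^esub> y)" "x \<otimes>\<^bsub>L\<^esub> (c \<odot>\<^bsub>L\<^esub> y) = c \<odot>\<^bsub>L\<^esub> (x \<otimes>\<^bsub>L\<^esub> y)" for c
      by (simp_all add: L_simps E d(3)[OF E(1)] d(3)[OF E(2)] d(4)[OF E]) (simp_all add: s algebra_simps)
    show "x \<otimes>\<^bsub>L\<^esub> x = \<zero>\<^bsub>L\<^esub>" by (simp add: L_simps E L_zero)
  qed
  show ?thesis
    by (intro lie_algebra.intro field_class mod ax)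
qed

end

section \<open>Ranks over the residue field and the field of fractions\<close>

lemma finsum_class: "finite S \<Longrightarrow> finsum cring_class_ops f S = sum f (S :: 'b set)"
proof (induct S rule: finite_induct)
  case (insert x S)
  then show ?case
    using abelian_monoid.finsum_insert[OF cring_class.abelian_monoid_axioms insert(1,2), of f]
    by (simp add: carrier_class plus_class)
qed (simp add: abelian_monoid.finsum_empty[OF cring_class.abelian_monoid_axioms] zero_class)

text \<open>The quotient by \<open>point_idl P\<close> is \<open>k\<close>: coefficients pass in one
  direction by evaluation at \<open>P\<close>, in the other as constant polynomials.\<close>

lemma jacobian_rank_at_eq:
  "jacobian_rank_at fs P = rank_mod (point_idl P) (length fs) (jacobian fs)"
proof -
  have "lin_indep_rows cring_class_ops S (\<lambda>i j. mpoly_eval P (jacobian fs i j)) \<longleftrightarrow> indep_mod (point_idl P) S (jacobian fs)"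
    if S: "S \<subseteq> {..<length fs}" for S
  proof -
    have fin: "finite S" using S by (rule finite_subset) simp
    have l: "lin_indep_rows cring_class_ops S (\<lambda>i j. mpoly_eval P (jacobian fs i j)) \<longleftrightarrow>
      (\<forall>c. (\<forall>j. (\<Sum>i\<in>S. c i * mpoly_eval P (jacobian fs i j)) = 0) \<longrightarrow> (\<forall>i\<in>S. c i = 0))"
      unfolding lin_indep_rows_def by (simp add: finsum_class fin class_simps Pi_def carrier_class)
    show ?thesis
      unfolding l
    proof
      assume *: "\<forall>c. (\<forall>j. (\<Sum>i\<in>S. c i * mpoly_eval P (jacobian fs i j)) = 0) \<longrightarrow> (\<forall>i\<in>S. c i = 0)"
      show "indep_mod (point_idl P) S (jacobian fs)"
        unfolding indep_mod_def
      proof (intro allI impI)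
        fix c assume "\<forall>j. (\<Sum>i\<in>S. c i * jacobian fs i j) \<in> point_idl P"
        then show "\<forall>i\<in>S. c i \<in> point_idl P"
          using *[rule_format, of "\<lambda>i. mpoly_eval P (c i)"] by (simp add: point_idl_def mpoly_eval_sum)
      qed
    next
      assume *: "indep_mod (point_idl P) S (jacobian fs)"
      show "\<forall>c. (\<forall>j. (\<Sum>i\<in>S. c i * mpoly_eval P (jacobian fs i j)) = 0) \<longrightarrow> (\<forall>i\<in>S. c i = 0)"
      proof (intro allI impI)
        fix c assume "\<forall>j. (\<Sum>i\<in>S. c i * mpoly_eval P (jacobian fs i j)) = 0"
        then show "\<forall>i\<in>S. c i = 0"
          using *[unfolded indep_mod_def, rule_format, of "\<lambda>i. mpoly_const (c i)"]
          by (simp add: point_idl_def mpoly_eval_sum)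
      qed
    qed
  qed
  then have eq: "S \<subseteq> {..<length fs} \<and> lin_indep_rows cring_class_ops S (\<lambda>i j. mpoly_eval P (jacobian fs i j))
    \<longleftrightarrow> S \<subseteq> {..<length fs} \<and> indep_mod (point_idl P) S (jacobian fs)" for S
    by blast
  show ?thesis by (simp only: jacobian_rank_at_def matrix_rank_def rank_mod_def eq)
qed

locale integral_variety = variety X for X :: "('k::field ^ 'n::finite) set" +
  assumes prime: "prime_idl I"
begin

definition fr :: "('n, 'k) mpoly \<Rightarrow> ('n, 'k) mpoly \<Rightarrow> (('n, 'k) mpoly set \<times> ('n, 'k) mpoly set) set" where
  "fr a b = fraction A (res a) (res b)"

abbreviation "F \<equiv> frac_field A"

lemma I_mult: "b \<notin> I \<Longrightarrow> d \<notin> I \<Longrightarrow> b * d \<notin> I"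
  using prime_idlD(3)[OF prime] by blast

lemma one_notin: "1 \<notin> I"
  using prime_idlD(2)[OF prime] .

lemma frac_rel_res: "((res a, res b), (res c, res d)) \<in> frac_rel A \<longleftrightarrow> b \<notin> I \<and> d \<notin> I \<and> a * d - c * b \<in> I"
  by (auto simp: frac_rel_def A_simps res_eq_iff)

lemma fr_altdef: "b \<notin> I \<Longrightarrow> fr a b = {(res c, res d) |c d. d \<notin> I \<and> a * d - c * b \<in> I}"
proof (intro equalityI subsetI)
  fix z assume b: "b \<notin> I" and "z \<in> fr a b"
  then have z: "((res a, res b), z) \<in> frac_rel A" by (simp add: fr_def fraction_def)
  then obtain c d where "z = (res c, res d)" by (auto simp: frac_rel_def A_simps)
  then show "z \<in> {(res c, res d) |c d. d \<notin> I \<and> a * d - c * b \<in> I}" using z frac_rel_res by auto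
next
  fix z assume b: "b \<notin> I" and "z \<in> {(res c, res d) |c d. d \<notin> I \<and> a * d - c * b \<in> I}"
  then show "z \<in> fr a b" by (auto simp: fr_def fraction_def frac_rel_res)
qed

lemma fr_eq_iff:
  assumes "b \<notin> I" "d \<notin> I"
  shows "fr a b = fr c d \<longleftrightarrow> a * d - c * b \<in> I"
proof
  assume eq: "fr a b = fr c d"
  have "(res c, res d) \<in> fr c d" using assms idl.subspace_0[OF Is] by (auto simp: fr_def fraction_def frac_rel_res)
  then have "(res c, res d) \<in> fr a b" by (simp only: eq)
  then show "a * d - c * b \<in> I" by (simp add: fr_def fraction_def frac_rel_res)
next
  assume *: "a * d - c * b \<in> I"
  have aux: "c * y - x * d \<in> I" if "b \<notin> I" "a * y - x * b \<in> I" "a * d - c * b \<in> I" for a b c d x y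
  proof -
    have "d * (a * y - x * b) - y * (a * d - c * b) \<in> I"
      by (intro idl.subspace_diff[OF Is] idl.subspace_scale[OF Is] that)
    then have "b * (c * y - x * d) \<in> I" by (simp add: algebra_simps)
    then show ?thesis using prime_idlD(3)[OF prime] that(1) by blast
  qed
  have **: "c * b - a * d \<in> I" using idl.subspace_neg[OF Is *] by simp
  have "a * y - x * b \<in> I \<longleftrightarrow> c * y - x * d \<in> I" for x y
    using aux[OF assms(1) _ *, of y x] aux[OF assms(2) _ **, of y x] by blast
  then show "fr a b = fr c d"
    by (simp add: fr_altdef assms)
qed

lemma fr_cases:
  assumes "p \<in> carrier F"
  obtains a b where "b \<notin> I" "p = fr a b"
proof -
  have "p \<in> (carrier A \<times> (carrier A - {\<zero>\<^bsub>A\<^esub>})) // frac_rel A"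
    using assms by (simp add: frac_field_def)
  then obtain x y where xy: "x \<in> carrier A" "y \<in> carrier A" "y \<noteq> \<zero>\<^bsub>A\<^esub>" "p = frac_rel A `` {(x, y)}"
    by (auto elim!: quotientE)
  obtain a b where ab: "x = res a" "y = res b" using xy(1,2) by (auto simp: A_simps)
  then have "b \<notin> I" using xy(3) by (simp add: A_simps res_eq_0_iff)
  then show ?thesis using that xy(4) ab by (simp add: fr_def fraction_def)
qed

lemma fr_carrier: "b \<notin> I \<Longrightarrow> fr a b \<in> carrier F"
  unfolding frac_field_def partial_object.simps fr_def fraction_def
  by (rule quotientI) (simp add: A_simps res_eq_0_iff)

text \<open>For the operations of \<open>frac_field\<close>, which are unions over representatives:
  a class is nonempty, so a family constant on it has that constant as its union.\<close>

lemma UN_fr: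
  assumes "b \<notin> I" "\<And>x y. y \<notin> I \<Longrightarrow> a * y - x * b \<in> I \<Longrightarrow> g (res x) (res y) = s"
  shows "(\<Union>(x, y)\<in>fr a b. g x y) = s"
proof -
  have "(res a, res b) \<in> fr a b"
    using assms(1) idl.subspace_0[OF Is] by (simp add: fr_def fraction_def frac_rel_res)
  then have ne: "fr a b \<noteq> {}" by blast
  have "g x y = s" if "(x, y) \<in> fr a b" for x y
    using that assms by (auto simp: fr_altdef)
  then have "(\<Union>(x, y)\<in>fr a b. g x y) = (\<Union>z\<in>fr a b. s)" by (intro SUP_cong refl) auto
  then show ?thesis using ne by simp
qed

lemma F_mult:
  assumes b: "b \<notin> I" "d \<notin> I"
  shows "fr a b \<otimes>\<^bsub>F\<^esub> fr c d = fr (a * c) (b * d)"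
  unfolding frac_field_def monoid.simps
proof (rule UN_fr[OF b(1)], rule UN_fr[OF b(2)])
  fix x y x' y' assume y: "y \<notin> I" "a * y - x * b \<in> I" "y' \<notin> I" "c * y' - x' * d \<in> I"
  have "(c * y') * (a * y - x * b) + (x * b) * (c * y' - x' * d) \<in> I"
    by (intro idl.subspace_add[OF Is] idl.subspace_scale[OF Is] y)
  then have "(a * c) * (y * y') - (x * x') * (b * d) \<in> I" by (simp add: algebra_simps)
  then have "fr (a * c) (b * d) = fr (x * x') (y * y')"
    by (simp add: fr_eq_iff I_mult b y)
  then show "fraction A (res x \<otimes>\<^bsub>A\<^esub> res x') (res y \<otimes>\<^bsub>A\<^esub> res y') = fr (a * c) (b * d)"
    by (simp add: A_simps fr_def)
qed

lemma F_add:
  assumes b: "b \<notin> I" "d \<notin> I"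
  shows "fr a b \<oplus>\<^bsub>F\<^esub> fr c d = fr (a * d + c * b) (b * d)"
  unfolding frac_field_def ring.simps
proof (rule UN_fr[OF b(1)], rule UN_fr[OF b(2)])
  fix x y x' y' assume y: "y \<notin> I" "a * y - x * b \<in> I" "y' \<notin> I" "c * y' - x' * d \<in> I"
  have "(d * y') * (a * y - x * b) + (b * y) * (c * y' - x' * d) \<in> I"
    by (intro idl.subspace_add[OF Is] idl.subspace_scale[OF Is] y)
  then have "(a * d + c * b) * (y * y') - (x * y' + x' * y) * (b * d) \<in> I" by (simp add: algebra_simps)
  then have "fr (a * d + c * b) (b * d) = fr (x * y' + x' * y) (y * y')"
    by (simp add: fr_eq_iff I_mult b y)
  then show "fraction A (res x \<otimes>\<^bsub>A\<^esub> res y' \<oplus>\<^bsub>A\<^esub> res x' \<otimes>\<^bsub>A\<^esub> res y) (res y \<otimes>\<^bsub>A\<^esub> res y') = fr (a * d + c * b) (b * d)"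
    by (simp add: A_simps fr_def)
qed

lemma F_zero: "\<zero>\<^bsub>F\<^esub> = fr 0 1"
  by (simp add: frac_field_def fr_def A_simps)

lemma abelian_monoid_F: "abelian_monoid F"
proof (rule abelian_monoidI)
  fix x y z assume "x \<in> carrier F" "y \<in> carrier F" "z \<in> carrier F"
  obtain a b where 1: "b \<notin> I" "x = fr a b" using \<open>x \<in> carrier F\<close> by (rule fr_cases)
  obtain c d where 2: "d \<notin> I" "y = fr c d" using \<open>y \<in> carrier F\<close> by (rule fr_cases)
  obtain e g where 3: "g \<notin> I" "z = fr e g" using \<open>z \<in> carrier F\<close> by (rule fr_cases)
  note * = 1 2 3
  have eq: "fr u v = fr u' v'" if "u = u'" "v = v'" for u v u' v' using that by simp
  show "x \<oplus>\<^bsub>F\<^esub> y \<in> carrier F" by (simp add: * F_add I_mult fr_carrier)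
  show "(x \<oplus>\<^bsub>F\<^esub> y) \<oplus>\<^bsub>F\<^esub> z = x \<oplus>\<^bsub>F\<^esub> (y \<oplus>\<^bsub>F\<^esub> z)"
    by (simp add: * F_add I_mult) (intro eq; simp add: algebra_simps)
  show "x \<oplus>\<^bsub>F\<^esub> y = y \<oplus>\<^bsub>F\<^esub> x"
    by (simp add: * F_add I_mult) (intro eq; simp add: algebra_simps)
  show "\<zero>\<^bsub>F\<^esub> \<oplus>\<^bsub>F\<^esub> x = x"
    by (simp add: * F_zero F_add one_notin)
qed (simp add: F_zero fr_carrier one_notin)

lemma finsum_fr:
  assumes "finite S" and b: "b \<notin> I"
  shows "(\<Oplus>\<^bsub>F\<^esub>i\<in>S. fr (a i) b) = fr (\<Sum>i\<in>S. a i) b"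
  using assms(1)
proof induct
  case empty
  show ?case
    by (simp add: abelian_monoid.finsum_empty[OF abelian_monoid_F] F_zero fr_eq_iff one_notin b idl.subspace_0[OF Is])
next
  case (insert x S)
  have "(\<Oplus>\<^bsub>F\<^esub>i\<in>insert x S. fr (a i) b) = fr (a x) b \<oplus>\<^bsub>F\<^esub> fr (\<Sum>i\<in>S. a i) b"
    using insert by (simp add: abelian_monoid.finsum_insert[OF abelian_monoid_F] fr_carrier b)
  also have "\<dots> = fr (a x + (\<Sum>i\<in>S. a i)) b"
  proof -
    have "((a x) * b + (\<Sum>i\<in>S. a i) * b) * b - (a x + (\<Sum>i\<in>S. a i)) * (b * b) = 0"
      by (simp add: algebra_simps)
    then show ?thesis using idl.subspace_0[OF Is] by (simp add: F_add b fr_eq_iff I_mult)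
  qed
  finally show ?case using insert by simp
qed

lemma prod_notin: "finite S \<Longrightarrow> (\<And>i. i \<in> S \<Longrightarrow> b i \<notin> I) \<Longrightarrow> (\<Prod>i\<in>S. b i) \<notin> I"
  by (induct S rule: finite_induct) (auto simp: one_notin I_mult)

lemma lin_indep_rows_F:
  assumes fin: "finite S"
  shows "lin_indep_rows F S (\<lambda>i j. fr (M i j) 1) \<longleftrightarrow> indep_mod I S M"
proof
  assume *: "lin_indep_rows F S (\<lambda>i j. fr (M i j) 1)"
  show "indep_mod I S M"
    unfolding indep_mod_def
  proof (intro allI impI)
    fix c assume c: "\<forall>j. (\<Sum>i\<in>S. c i * M i j) \<in> I"
    have "(\<Oplus>\<^bsub>F\<^esub>i\<in>S. fr (c i) 1 \<otimes>\<^bsub>F\<^esub> fr (M i j) 1) = \<zero>\<^bsub>F\<^esub>" for j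
      using c by (simp add: F_mult one_notin finsum_fr fin F_zero fr_eq_iff)
    then have zero: "\<forall>j. (\<Oplus>\<^bsub>F\<^esub>i\<in>S. fr (c i) 1 \<otimes>\<^bsub>F\<^esub> fr (M i j) 1) = \<zero>\<^bsub>F\<^esub>" ..
    have "(\<lambda>i. fr (c i) 1) \<in> S \<rightarrow> carrier F" by (simp add: fr_carrier one_notin)
    from bspec[OF *[unfolded lin_indep_rows_def] this, THEN mp, OF zero]
    have "\<forall>i\<in>S. fr (c i) 1 = \<zero>\<^bsub>F\<^esub>" .
    then show "\<forall>i\<in>S. c i \<in> I" by (simp add: F_zero fr_eq_iff one_notin)
  qed
next
  assume *: "indep_mod I S M"
  show "lin_indep_rows F S (\<lambda>i j. fr (M i j) 1)"
    unfolding lin_indep_rows_def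
  proof (intro ballI impI)
    fix C i assume C: "C \<in> S \<rightarrow> carrier F"
      and zero: "\<forall>j. (\<Oplus>\<^bsub>F\<^esub>i\<in>S. C i \<otimes>\<^bsub>F\<^esub> fr (M i j) 1) = \<zero>\<^bsub>F\<^esub>" and i: "i \<in> S"
    have "\<exists>a b. b \<notin> I \<and> C i = fr a b" if i: "i \<in> S" for i
    proof -
      have "C i \<in> carrier F" using C i by auto
      then obtain a b where "b \<notin> I" "C i = fr a b" by (rule fr_cases)
      then show ?thesis by blast
    qed
    then obtain a b where ab: "\<And>i. i \<in> S \<Longrightarrow> b i \<notin> I" "\<And>i. i \<in> S \<Longrightarrow> C i = fr (a i) (b i)" by metis
    \<comment> \<open>A common denominator of the coefficients, so that a relation over the field of
      fractions becomes one between numerators modulo \<open>I\<close>.\<close>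
    define d where "d = (\<Prod>i\<in>S. b i)"
    define a' where "a' i = a i * (\<Prod>k\<in>S - {i}. b k)" for i
    have d: "d \<notin> I" unfolding d_def using fin ab(1) by (rule prod_notin)
    have Cd: "C i = fr (a' i) d" if "i \<in> S" for i
    proof -
      have "d = b i * (\<Prod>k\<in>S - {i}. b k)" unfolding d_def using fin that by (rule prod.remove)
      then have "a i * d - a' i * b i = 0" by (simp add: a'_def algebra_simps)
      then show ?thesis using idl.subspace_0[OF Is] by (simp add: ab that fr_eq_iff d)
    qed
    have "(\<Sum>i\<in>S. a' i * M i j) \<in> I" for j
    proof -
      have "(\<Oplus>\<^bsub>F\<^esub>i\<in>S. C i \<otimes>\<^bsub>F\<^esub> fr (M i j) 1) = (\<Oplus>\<^bsub>F\<^esub>i\<in>S. fr (a' i * M i j) d)"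
        by (rule abelian_monoid.finsum_cong'[OF abelian_monoid_F])
          (auto simp: Cd F_mult d one_notin fr_carrier)
      then have "fr (\<Sum>i\<in>S. a' i * M i j) d = fr 0 1"
        using zero by (simp add: finsum_fr fin d F_zero)
      then show ?thesis by (simp add: fr_eq_iff d one_notin)
    qed
    then have "a' i \<in> I" using * i unfolding indep_mod_def by blast
    then show "C i = \<zero>\<^bsub>F\<^esub>" by (simp add: Cd i F_zero fr_eq_iff d one_notin)
  qed
qed

lemma generic_jacobian_rank_eq: "generic_jacobian_rank fs X = rank_mod I (length fs) (jacobian fs)"
proof -
  have "lin_indep_rows F S (\<lambda>i j. fr (jacobian fs i j) 1) \<longleftrightarrow> indep_mod I S (jacobian fs)"
    if "S \<subseteq> {..<length fs}" for S
    using that by (intro lin_indep_rows_F) (auto intro: finite_subset)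
  then have eq: "S \<subseteq> {..<length fs} \<and> lin_indep_rows F S (\<lambda>i j. fr (jacobian fs i j) 1)
    \<longleftrightarrow> S \<subseteq> {..<length fs} \<and> indep_mod I S (jacobian fs)" for S
    by blast
  have fr: "fraction A (res f) \<one>\<^bsub>A\<^esub> = fr f 1" for f by (simp add: fr_def A_simps)
  show ?thesis by (simp only: generic_jacobian_rank_def matrix_rank_def rank_mod_def fr eq)
qed

end

section \<open>Smoothness and simplicity\<close>

lemma irreducible_prime:
  assumes "irreducible_affine_variety X"
  shows "prime_idl (vanishing_ideal X)"
  unfolding prime_idl_def
proof (intro conjI allI impI vanishing_ideal_subspace)
  have X: "zariski_closed X" "X \<noteq> {}"
    and irr: "\<And>Y Z. zariski_closed Y \<Longrightarrow> zariski_closed Z \<Longrightarrow> X = Y \<union> Z \<Longrightarrow> X = Y \<or> X = Z"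
    using assms by (auto simp: irreducible_affine_variety_def)
  show "1 \<notin> vanishing_ideal X" using X(2) by (auto simp: vanishing_ideal_def)
  fix f g assume fg: "f * g \<in> vanishing_ideal X"
  obtain S where S: "X = zero_locus S" using X(1) by (auto simp: zariski_closed_def)
  have z: "zariski_closed {P \<in> X. mpoly_eval P h = 0}" for h
    unfolding zariski_closed_def by (rule exI[of _ "insert h S"]) (auto simp: S zero_locus_def)
  have "X = {P \<in> X. mpoly_eval P f = 0} \<union> {P \<in> X. mpoly_eval P g = 0}"
    using fg by (auto simp: vanishing_ideal_def)
  from irr[OF z z this] show "f \<in> vanishing_ideal X \<or> g \<in> vanishing_ideal X"
    by (auto simp: vanishing_ideal_def)
qed

lemma zero_of_vanishing_ideal:
  assumes "zariski_closed X" "\<And>f. f \<in> vanishing_ideal X \<Longrightarrow> mpoly_eval P f = 0"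
  shows "P \<in> X"
proof -
  obtain S where S: "X = zero_locus S" using assms(1) by (auto simp: zariski_closed_def)
  have "S \<subseteq> vanishing_ideal X" by (auto simp: S zero_locus_def vanishing_ideal_def)
  then show ?thesis using assms(2) by (auto simp: S zero_locus_def)
qed

locale nontrivial_variety = integral_variety X
  for X :: "('k::{alg_closed_field, field_char_0} ^ 'n::finite) set" +
  assumes closed: "zariski_closed X" and nonempty: "X \<noteq> {}" and no_point: "\<nexists>P. X = {P}"
begin

lemma I_subset_point_idl: "P \<in> X \<Longrightarrow> I \<subseteq> point_idl P"
  by (auto simp: vanishing_ideal_def point_idl_def)

text \<open>Otherwise every \<open>shifted_var P i\<close> would vanish on \<open>X\<close>, forcing
  all points of \<open>X\<close> to equal \<open>P\<close>.\<close>

lemma point_idl_not_subset: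
  assumes "P \<in> X" shows "\<not> point_idl P \<subseteq> I"
proof
  assume sub: "point_idl P \<subseteq> I"
  have "P' = P" if "P' \<in> X" for P'
  proof -
    have "mpoly_eval P' (shifted_var P i) = 0" for i
      using sub shifted_var_in[of P i] that by (auto simp: vanishing_ideal_def)
    then show ?thesis by (simp add: shifted_var_def Finite_Cartesian_Product.vec_eq_iff)
  qed
  then have "X = {P}" using assms by blast
  then show False using no_point by blast
qed

lemma smooth_imp_stable_trivial:
  assumes smooth: "smooth_variety X" and K: "idl.subspace K" "I \<subseteq> K" "1 \<notin> K"
    and stable: "\<And>E f. E \<in> derivs_on I \<Longrightarrow> f \<in> K \<Longrightarrow> E f \<in> K"
  shows "K \<subseteq> I"
proof -
  obtain P where P: "\<And>f. f \<in> K \<Longrightarrow> mpoly_eval P f = 0" using mpoly_nullstellensatz[OF K(1,3)] by blast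
  have PX: "P \<in> X" using zero_of_vanishing_ideal[OF closed] P K(2) by blast
  obtain G where G: "finite G" "I = idl.span G" using noeth_finitely_generated[OF noeth_mpoly Is] by blast
  obtain fs where fs: "set fs = G" using finite_list[OF G(1)] by blast
  have "generic_jacobian_rank fs X \<le> jacobian_rank_at fs P"
    using smooth PX fs G(2) by (force simp: smooth_variety_def singular_point_def genideal_mpoly_ring)
  then have "rank_mod I (length fs) (jacobian fs) \<le> rank_mod (point_idl P) (length fs) (jacobian fs)"
    by (simp add: generic_jacobian_rank_eq jacobian_rank_at_eq)
  then show ?thesis
    using stable_idl_at_nonsingular_point[of I fs P K] prime G(2) fs I_subset_point_idl[OF PX] K(1) P stable
    by (auto simp: point_idl_def)
qed

lemma lie_ideal_closed:
  assumes J: "lie_ideal J cring_class_ops L"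
  shows "J \<subseteq> carrier L" "\<zero>\<^bsub>L\<^esub> \<in> J" "x \<in> J \<Longrightarrow> y \<in> J \<Longrightarrow> x \<oplus>\<^bsub>L\<^esub> y \<in> J" "x \<in> J \<Longrightarrow> c \<odot>\<^bsub>L\<^esub> x \<in> J"
    "x \<in> carrier L \<Longrightarrow> y \<in> J \<Longrightarrow> x \<otimes>\<^bsub>L\<^esub> y \<in> J"
proof -
  interpret J: submodule J cring_class_ops L using J by (simp add: lie_ideal_def)
  show "J \<subseteq> carrier L" using J.subset by simp
  show "\<zero>\<^bsub>L\<^esub> \<in> J" using J.one_closed by simp
  show "x \<in> J \<Longrightarrow> y \<in> J \<Longrightarrow> x \<oplus>\<^bsub>L\<^esub> y \<in> J" using J.m_closed by simp
  show "x \<in> J \<Longrightarrow> c \<odot>\<^bsub>L\<^esub> x \<in> J" using J.smult_closed by (simp add: carrier_class)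
  show "x \<in> carrier L \<Longrightarrow> y \<in> J \<Longrightarrow> x \<otimes>\<^bsub>L\<^esub> y \<in> J" using J by (simp add: lie_ideal_def)
qed

lemma derivation_family_lie_ideal:
  assumes J: "lie_ideal J cring_class_ops L"
  shows "derivation_family I (derivs_on I) {E \<in> derivs_on I. lift E \<in> J}"
proof
  note d = derivs_on_closed and Jc = lie_ideal_closed[OF J]
  show "prime_idl I" by (rule prime)
  show "2 \<notin> I"
  proof
    assume "2 \<in> I"
    then have "mpoly_const (1 / 2) * (mpoly_const 1 + mpoly_const 1) \<in> I"
      by (intro idl.subspace_scale[OF Is]) simp
    then have "(1 :: ('n, 'k) mpoly) \<in> I" by (simp flip: mpoly_const_mult mpoly_const_add del: mpoly_const_1) simp
    then show False using one_notin by simp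
  qed
  fix E assume E: "E \<in> derivs_on I"
  note dE = derivs_on_deriv[OF E]
  show "E (f + g) = E f + E g" "E (f * g) = E f * g + f * E g" for f g
    by (simp_all add: mpoly_derivD[OF dE])
  show "(\<lambda>f. a * E f) \<in> derivs_on I" for a by (rule d(3)[OF E])
  show "(\<lambda>f. E (E' f) - E' (E f)) \<in> derivs_on I" if "E' \<in> derivs_on I" for E' by (rule d(4)[OF E that])
  show "E \<in> {E \<in> derivs_on I. lift E \<in> J}" if "\<And>f. E f \<in> I"
    using E that Jc(2) by (simp add: lift_eq_zero_iff[OF E, THEN iffD2])
  fix w assume w: "w \<in> {E \<in> derivs_on I. lift E \<in> J}"
  show "(\<lambda>f. E (w f) - w (E f)) \<in> {E \<in> derivs_on I. lift E \<in> J}"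
    using w d(4)[OF E] Jc(5)[of "lift E" "lift w"] E by (auto simp: L_simps L_carrier)
next
  note d = derivs_on_closed and Jc = lie_ideal_closed[OF J]
  fix w w' assume w: "w \<in> {E \<in> derivs_on I. lift E \<in> J}" "w' \<in> {E \<in> derivs_on I. lift E \<in> J}"
  have "(- 1) \<odot>\<^bsub>L\<^esub> lift w' \<in> J" using w Jc(4) by blast
  then have "lift w \<oplus>\<^bsub>L\<^esub> lift (\<lambda>f. mpoly_const (- 1) * w' f) \<in> J" using w Jc(3) by (simp add: L_simps)
  moreover have "mpoly_const (- 1) = (- 1 :: ('n, 'k) mpoly)" using mpoly_const_diff[of 0 1] by simp
  ultimately have "lift (\<lambda>f. w f + - 1 * w' f) \<in> J" using w d(3)[of w' "- 1"] by (simp add: L_simps)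
  then show "(\<lambda>f. w f - w' f) \<in> {E \<in> derivs_on I. lift E \<in> J}" using w d(5) by simp
qed blast

theorem smooth_imp_simple:
  assumes smooth: "smooth_variety X"
  shows "simple_lie_algebra cring_class_ops L"
  unfolding simple_lie_algebra_def
proof (intro conjI allI impI lie_algebra_L)
  obtain P where P: "P \<in> X" using nonempty by blast
  \<comment> \<open>If every derivation were zero modulo \<open>I\<close>, every ideal containing
    \<open>I\<close> would be stable, including that of a point of \<open>X\<close>.\<close>
  have "\<exists>E\<in>derivs_on I. \<exists>f. E f \<notin> I"
  proof (rule ccontr)
    assume "\<not> ?thesis"
    then have "point_idl P \<subseteq> I"
      using prime_idlD[OF prime_point_idl[of P]] I_subset_point_idl[OF P]
      by (intro smooth_imp_stable_trivial[OF smooth]) auto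
    then show False using point_idl_not_subset[OF P] by blast
  qed
  then obtain E f where E: "E \<in> derivs_on I" "E f \<notin> I" by blast
  \<comment> \<open>The bracket of \<open>E\<close> with \<open>f E\<close> takes the value
    \<open>(E f)^2\<close> at \<open>f\<close>, nonzero modulo the prime \<open>I\<close>.\<close>
  let ?F = "\<lambda>g. f * E g"
  have F: "?F \<in> derivs_on I" by (rule derivs_on_closed(3)[OF E(1)])
  have "E (?F f) - ?F (E f) = E f * E f" by (simp add: mpoly_derivD[OF derivs_on_deriv[OF E(1)]])
  then have "E (?F f) - ?F (E f) \<notin> I" using I_mult E(2) by simp
  then have "lift E \<otimes>\<^bsub>L\<^esub> lift ?F \<noteq> \<zero>\<^bsub>L\<^esub>"
    unfolding L_simps(2)[OF E(1) F] lift_eq_zero_iff[OF derivs_on_closed(4)[OF E(1) F]] by blast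
  then show "\<exists>x\<in>carrier L. \<exists>y\<in>carrier L. x \<otimes>\<^bsub>L\<^esub> y \<noteq> \<zero>\<^bsub>L\<^esub>"
    using E(1) F by (auto simp: L_carrier)
next
  fix J assume J: "lie_ideal J cring_class_ops L"
  let ?W = "{E \<in> derivs_on I. lift E \<in> J}"
  interpret W: derivation_family I "derivs_on I" ?W by (rule derivation_family_lie_ideal[OF J])
  show "J = {\<zero>\<^bsub>L\<^esub>} \<or> J = carrier L"
  proof (cases "J = {\<zero>\<^bsub>L\<^esub>}")
    case False
    then obtain y where y: "y \<in> J" "y \<noteq> \<zero>\<^bsub>L\<^esub>" using lie_ideal_closed(2)[OF J] by blast
    then obtain w where w: "w \<in> ?W" "y = lift w" using lie_ideal_closed(1)[OF J] by (auto simp: L_carrier)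
    then obtain f0 where "w f0 \<notin> I" using y(2) lift_eq_zero_iff by auto
    then obtain a where a: "a \<in> W.K" "a \<notin> I" using W.K_nontrivial[OF w(1)] by blast
    have "1 \<in> W.K"
    proof (rule ccontr)
      assume "1 \<notin> W.K"
      then have "W.K \<subseteq> I"
        using W.K_stable by (intro smooth_imp_stable_trivial[OF smooth W.K_subspace W.I_subset_K])
      then show False using a by blast
    qed
    then have "carrier L \<subseteq> J" by (auto simp: W.K_def L_carrier)
    then show ?thesis using lie_ideal_closed(1)[OF J] by blast
  qed simp
qed

theorem simple_imp_smooth:
  assumes simple: "simple_lie_algebra cring_class_ops L"
  shows "smooth_variety X"
  unfolding smooth_variety_def
proof
  assume "\<exists>P. singular_point X P"
  then obtain P fs where P: "P \<in> X" and "Idl\<^bsub>cring_class_ops\<^esub> (set fs) = I"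
    "jacobian_rank_at fs P < generic_jacobian_rank fs X"
    by (auto simp: singular_point_def)
  then have fs: "I = idl.span (set fs)"
    and rank: "rank_mod (point_idl P) (length fs) (jacobian fs) < rank_mod I (length fs) (jacobian fs)"
    by (simp_all add: genideal_mpoly_ring generic_jacobian_rank_eq jacobian_rank_at_eq)
  define r where "r = rank_mod I (length fs) (jacobian fs)"
  define K where "K = minor_idl fs r"
  have K: "idl.subspace K" by (simp add: K_def minor_idl_def)
  have IK: "I \<subseteq> K"
    unfolding K_def minor_idl_def fs by (rule idl.span_mono) blast
  \<comment> \<open>The size \<open>r\<close> exceeds the rank at \<open>P\<close>, so every such
    minor vanishes there and the ideal of minors is proper.\<close>
  have "minor (jacobian fs) rs cs \<in> point_idl P"
    if "set rs \<subseteq> {..<length fs}" "length rs = r" "length cs = r" for rs cs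
    using minor_le_rank_mod[OF prime_point_idl[of P] that(1), of cs "jacobian fs"] that rank
    by (auto simp: r_def)
  then have KP: "K \<subseteq> point_idl P"
    unfolding K_def minor_idl_def
    using I_subset_point_idl[OF P] idl.span_superset[of "set fs"]
    by (intro idl.span_minimal prime_idlD(1)[OF prime_point_idl]) (auto simp: fs)
  then have K1: "1 \<notin> K" using prime_idlD(2)[OF prime_point_idl[of P]] by blast
  obtain rs cs where rs: "set rs \<subseteq> {..<length fs}" "length rs = r" "length cs = r"
    and nz: "minor (jacobian fs) rs cs \<notin> I"
    unfolding r_def by (rule rank_mod_minor[OF prime, of "length fs" "jacobian fs"]) auto
  define a where "a = minor (jacobian fs) rs cs"
  have a: "a \<in> K" "a \<notin> I"
    using rs nz unfolding K_def minor_idl_def a_def by (auto intro!: idl.span_base)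
  have stable: "E f \<in> K" if "E \<in> derivs_on I" "f \<in> K" for E f
    using that minor_idl_stable[OF derivs_on_deriv[OF that(1)], of fs f r] idl.span_base[of _ "set fs"]
    unfolding K_def by (auto simp: derivs_on_def fs)
  obtain x y where "x \<in> carrier L" "y \<in> carrier L" "x \<otimes>\<^bsub>L\<^esub> y \<noteq> \<zero>\<^bsub>L\<^esub>"
    using simple unfolding simple_lie_algebra_def by blast
  moreover have "x \<otimes>\<^bsub>L\<^esub> y \<in> carrier L"
    using calculation lie_algebra.bracket_closed[OF lie_algebra_L] by blast
  ultimately obtain E0 where E0: "E0 \<in> derivs_on I" "lift E0 \<noteq> \<zero>\<^bsub>L\<^esub>" by (auto simp: L_carrier)
  then obtain f0 where f0: "E0 f0 \<notin> I" using lift_eq_zero_iff[OF E0(1)] by blast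
  let ?V = "idl_filtration I K"
  note Vs = idl_filtration_subspace[of I K]
  have "E f \<in> ?V s" if E: "E \<in> derivs_on I" for E f s
  proof -
    \<comment> \<open>Since \<open>?V s\<close> contains \<open>I\<close>, membership in
      \<open>J\<close> does not depend on the chosen lift; stability of \<open>K\<close> makes
      \<open>J\<close> a Lie ideal.\<close>
    define J where "J = lift ` {E \<in> derivs_on I. \<forall>f. E f \<in> ?V s}"
    have VI: "f \<in> ?V s" if "f \<in> I" for f using that by (rule idl_filtration_base)
    note d = derivs_on_closed
    have mem: "lift E \<in> J \<longleftrightarrow> (\<forall>f. E f \<in> ?V s)" if "E \<in> derivs_on I" for E
    proof
      assume "lift E \<in> J"
      then obtain E' where E': "E' \<in> derivs_on I" "\<And>f. E' f \<in> ?V s" "lift E = lift E'" by (auto simp: J_def)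
      then have "E f - E' f \<in> ?V s" for f using lift_eq_iff[OF that E'(1)] VI by blast
      then have "(E f - E' f) + E' f \<in> ?V s" for f using idl.subspace_add[OF Vs] E'(2) by blast
      then show "\<forall>f. E f \<in> ?V s" by simp
    qed (use that in \<open>auto simp: J_def\<close>)
    have JL: "J \<subseteq> carrier L" by (auto simp: J_def L_carrier)
    interpret L: module cring_class_ops L using lie_algebra_L by (simp add: lie_algebra_def)
    have "lie_ideal J cring_class_ops L"
      unfolding lie_ideal_def
    proof (intro conjI ballI L.submoduleI JL)
      show z: "\<zero>\<^bsub>L\<^esub> \<in> J" unfolding L_zero mem[OF d(1)] using idl.subspace_0[OF Vs] by simp
      fix x y assume "x \<in> J" "y \<in> J"
      then obtain E F where E: "E \<in> derivs_on I" "x = lift E" "\<And>f. E f \<in> ?V s"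
        and F: "F \<in> derivs_on I" "y = lift F" "\<And>f. F f \<in> ?V s" by (auto simp: J_def)
      show "x \<oplus>\<^bsub>L\<^esub> y \<in> J"
        unfolding E(2) F(2) L_simps(1)[OF E(1) F(1)] mem[OF d(2)[OF E(1) F(1)]]
        using E(3) F(3) idl.subspace_add[OF Vs] by blast
    next
      fix c x assume "x \<in> J"
      then obtain E where E: "E \<in> derivs_on I" "x = lift E" "\<And>f. E f \<in> ?V s" by (auto simp: J_def)
      show "c \<odot>\<^bsub>L\<^esub> x \<in> J"
        unfolding E(2) L_simps(3)[OF E(1)] mem[OF d(3)[OF E(1)]]
        using E(3) idl.subspace_scale[OF Vs] by blast
    next
      fix x assume "x \<in> J"
      then obtain E where E: "E \<in> derivs_on I" "x = lift E" "\<And>f. E f \<in> ?V s" by (auto simp: J_def)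
      have "lift (\<lambda>f. - 1 * E f) \<oplus>\<^bsub>L\<^esub> lift E = \<zero>\<^bsub>L\<^esub>"
        using L_simps(1)[OF d(3)[OF E(1), of "- 1"] E(1)] by (simp add: L_zero)
      then have "\<ominus>\<^bsub>L\<^esub> x = lift (\<lambda>f. - 1 * E f)"
        using E d(3)[OF E(1), of "- 1"] by (intro L.minus_equality) (auto simp: L_carrier)
      then show "\<ominus>\<^bsub>L\<^esub> x \<in> J"
        using mem[OF d(3)[OF E(1)], of "- 1"] E(3) idl.subspace_neg[OF Vs] by simp
    next
      fix x y assume "x \<in> carrier L" "y \<in> J"
      then obtain E F where E: "E \<in> derivs_on I" "x = lift E"
        and F: "F \<in> derivs_on I" "y = lift F" "\<And>f. F f \<in> ?V s" by (auto simp: J_def L_carrier)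
      have "E (F f) - F (E f) \<in> ?V s" for f
        by (intro idl.subspace_diff[OF Vs] F(3) deriv_preserves_filtration[OF E(1) stable[OF E(1)]])
      then show "x \<otimes>\<^bsub>L\<^esub> y \<in> J"
        unfolding E(2) F(2) L_simps(2)[OF E(1) F(1)] mem[OF d(4)[OF E(1) F(1)]] by blast
    qed
    moreover have "J \<noteq> {\<zero>\<^bsub>L\<^esub>}"
    proof -
      \<comment> \<open>A nonzero member of \<open>J\<close>: \<open>a ^ s\<close> lies in the
        \<open>s\<close>-th step, and \<open>I\<close> is prime.\<close>
      let ?E = "\<lambda>f. a ^ s * E0 f"
      have E: "?E \<in> derivs_on I" by (rule d(3)[OF E0(1)])
      have "a ^ s \<in> ?V s"
      proof (induct s)
        case (Suc s)
        then show ?case using idl_filtration_mult[OF a(1)] by simp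
      qed simp
      then have "lift ?E \<in> J" unfolding mem[OF E] using idl_mult_right[OF Vs] by blast
      moreover have "?E f0 \<notin> I" using I_mult f0 prime_idl_power[OF prime] a(2) by blast
      then have "lift ?E \<noteq> \<zero>\<^bsub>L\<^esub>" unfolding lift_eq_zero_iff[OF E] by blast
      ultimately show ?thesis by blast
    qed
    ultimately have "J = carrier L" using simple unfolding simple_lie_algebra_def by blast
    then have "lift E \<in> J" using E by (simp add: L_carrier)
    then show ?thesis using mem[OF E] by blast
  qed
  then have "E0 f0 \<in> I"
    using krull_intersection[OF noeth_mpoly prime K K1 IK] E0(1) by blast
  then show False using f0 by blast
qed

end

text \<open>A single point is smooth, but its coordinate algebra is \<open>k\<close>, so its Lie
  algebra is zero and not simple in the sense of \<open>simple_lie_algebra\<close>; this is the case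
  that the second assumption excludes.\<close>

theorem theorem1p1:
  fixes X :: "('k::{alg_closed_field, field_char_0} ^ 'n::finite) set"
  assumes "irreducible_affine_variety X"
    and "\<nexists>P. X = {P}"
  shows "simple_lie_algebra cring_class_ops (polynomial_vector_fields X) \<longleftrightarrow> smooth_variety X"
proof -
  interpret nontrivial_variety X
    using assms irreducible_prime[OF assms(1)]
    by unfold_locales (auto simp: irreducible_affine_variety_def)
  show ?thesis using smooth_imp_simple simple_imp_smooth by blast
qed

end
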